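(* Let $K\in\mathbb C$, let $\bar\alpha_1,\dots,\bar\alpha_k$ be the simple quasiroots, and let $(c_1,\dots,c_k)$ be a $k$-tuple of complex numbers satisfying the Assumption (for $K$) described in the context. (a) The formula $$c(\bar\alpha)=\frac{e_l+K^2e_{l-2}+K^4e_{l-4}+\cdots}{e_{l-1}+K^2e_{l-3}+K^4e_{l-5}+\cdots}\qquad( * )$$ (notation explained in the context) uniquely defines numbers $c(\bar\alpha)$ for all positive quasiroots $\bar\alpha$, with $c(\bar\alpha_i)=c_i$, such that the bivector $v=\sum_{\alpha\in\Omega^+\setminus\Omega_\Gamma}c(\bar\alpha)E_\alpha\wedge E_{-\alpha}$ satisfies $[\![v,v]\!]=K^2\varphi_M$. (b) When $K=0$, the solution described in (a) defines a Poisson bracket on $M$. If all $c(\bar\alpha_i)$ are nonzero (as in the Assumption), there exists a linear form $\lambda$ on $\mathfrak h^*_{\Pi\setminus\Gamma}$ such that $c(\bar\alpha)=1/\lambda(\bar\alpha)$ for all quasiroots $\bar\alpha$ (positive quasiroots, which index the coefficients of $v$).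
   Context: Let $\mathfrak g$ be a simple complex Lie algebra, $\mathfrak h$ a Cartan subalgebra, $\Omega\subset\mathfrak h^*$ the root system, $\Omega^+$ a system of positive roots, $\Pi$ the simple roots. For $\alpha\in\Omega^+$ fix root vectors $E_\alpha,E_{-\alpha}$ with $(E_\alpha,E_{-\alpha})=1$ for the Killing form. For a subset $\Gamma\subset\Pi$ let $\mathfrak h^*_\Gamma$ be the span of $\Gamma$, $\Omega_\Gamma=\Omega\cap\mathfrak h^*_\Gamma$, and let $\mathfrak g_\Gamma$ be the (Levi) subalgebra generated by $\mathfrak h$ and $E_{\pm\alpha}$, $\alpha\in\Gamma$. Let $\mathfrak m$ be the span of $E_{\pm\gamma}$, $\gamma\in\Omega^+\setminus\Omega_\Gamma$; it is the $\mathrm{ad}(\mathfrak g_\Gamma)$-invariant complement of $\mathfrak g_\Gamma$. Let $G$ be a connected complex Lie group with Lie algebra $\mathfrak g$, $G_\Gamma$ the connected subgroup with Lie algebra $\mathfrak g_\Gamma$, and $M=G/G_\Gamma$. Write $\mathfrak h^*=\mathfrak h^*_\Gamma\oplus\mathfrak h^*_{\Pi\setminus\Gamma}$ and let $\alpha\mapsto\bar\alpha$ be the projection to $\mathfrak h^*_{\Pi\setminus\Gamma}\cong\mathfrak h^*/\mathfrak h^*_\Gamma$. The nonzero elements of the image of $\Omega$ are called quasiroots; the (nonzero) images of elements of $\Omega^+$ are the positive quasiroots, and the images of the elements of $\Pi\setminus\Gamma$ are the simple quasiroots; $k=|\Pi\setminus\Gamma|$. $G$-invariant polyvector fields on $M$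 are identified with $(\wedge^\bullet\mathfrak m)^{\mathfrak g_\Gamma}$, where $\mathfrak m\cong\mathfrak g/\mathfrak g_\Gamma\cong T_oM$. The Schouten bracket $[\![X_1\wedge\cdots\wedge X_p,Y_1\wedge\cdots\wedge Y_q]\!]=\sum(-1)^{i+j}[X_i,Y_j]\wedge X_1\wedge\cdots\hat X_i\cdots\hat Y_j\cdots\wedge Y_q$ on $\wedge^\bullet\mathfrak g$ induces (after projection of the result to $\wedge^\bullet\mathfrak m=\wedge^\bullet(\mathfrak g/\mathfrak g_\Gamma)$) the Schouten bracket of invariant polyvector fields on $M$. Put $r=\sum_{\alpha\in\Omega^+}E_\alpha\wedge E_{-\alpha}$, $\varphi=[\![r,r]\!]\in\wedge^3\mathfrak g$ (a $\mathfrak g$-invariant element), and let $\varphi_M$ be the invariant three-vector field on $M$ defined by $\varphi$, i.e. the image of $\varphi$ in $\wedge^3\mathfrak m$. Notation in $( * )$: if $\bar\alpha$ is a positive quasiroot, write it as a sum $\bar\alpha=\bar\alpha_{j_1}+\cdots+\bar\alpha_{j_l}$ of simple quasiroots (with possible repetitions; $l$ is the height of $\bar\alpha$). Then $e_i$ denotes the $i$-th elementary symmetric polynomial of the $l$ numbers $c_{j_1},\dots,c_{j_l}$ (with $e_0=1$ and $e_i=0$ for $i<0$). Assumption (for $K$): $c_i\neq0$ for all $i=1,\dots,k$, and for every positive quasiroot $\bar\alpha$ the denominator in $( * )$ is nonzero. *)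

theory Defs
  imports Complex_Main "HOL-Library.Function_Algebras" "HOL-Library.Poly_Mapping"
begin

section \<open>Complex Lie algebras\<close>

class complex_lie_algebra = ab_group_add +
  fixes scaleC :: "complex \<Rightarrow> 'a \<Rightarrow> 'a"
    and lie_bracket :: "'a \<Rightarrow> 'a \<Rightarrow> 'a"
  assumes scaleC_add_right: "scaleC a (x + y) = scaleC a x + scaleC a y"
    and scaleC_add_left: "scaleC (a + b) x = scaleC a x + scaleC b x"
    and scaleC_scaleC: "scaleC a (scaleC b x) = scaleC (a * b) x"
    and scaleC_one: "scaleC 1 x = x"
    and lie_bracket_add_left: "lie_bracket (x + y) z = lie_bracket x z + lie_bracket y z"
    and lie_bracket_add_right: "lie_bracket x (y + z) = lie_bracket x y + lie_bracket x z"
    and lie_bracket_scale_left: "lie_bracket (scaleC a x) y = scaleC a (lie_bracket x y)"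
    and lie_bracket_scale_right: "lie_bracket x (scaleC a y) = scaleC a (lie_bracket x y)"
    and lie_bracket_self: "lie_bracket x x = 0"
    and jacobi: "lie_bracket x (lie_bracket y z) + lie_bracket y (lie_bracket z x)
                   + lie_bracket z (lie_bracket x y) = 0"

interpretation lie: vector_space "scaleC :: complex \<Rightarrow> 'g \<Rightarrow> 'g::complex_lie_algebra"
  by unfold_locales
    (simp_all add: scaleC_add_right scaleC_add_left scaleC_scaleC scaleC_one)

definition lie_subalgebra :: "'g::complex_lie_algebra set \<Rightarrow> bool" where
  "lie_subalgebra S \<longleftrightarrow> lie.subspace S \<and> (\<forall>x\<in>S. \<forall>y\<in>S. lie_bracket x y \<in> S)"

definition lie_ideal :: "'g::complex_lie_algebra set \<Rightarrow> bool" where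
  "lie_ideal S \<longleftrightarrow> lie.subspace S \<and> (\<forall>x. \<forall>y\<in>S. lie_bracket x y \<in> S)"

definition abelian :: "'g::complex_lie_algebra set \<Rightarrow> bool" where
  "abelian S \<longleftrightarrow> (\<forall>x\<in>S. \<forall>y\<in>S. lie_bracket x y = 0)"

definition generated_subalgebra :: "'g::complex_lie_algebra set \<Rightarrow> 'g set" where
  "generated_subalgebra X = \<Inter>{S. lie_subalgebra S \<and> X \<subseteq> S}"

definition simple_lie_algebra :: "'g::complex_lie_algebra itself \<Rightarrow> bool" where
  "simple_lie_algebra _ \<longleftrightarrow>
     (\<exists>B :: 'g set. finite B \<and> lie.span B = UNIV) \<and>
     \<not> abelian (UNIV :: 'g set) \<and>
     (\<forall>S :: 'g set. lie_ideal S \<longrightarrow> S = {0} \<or> S = UNIV)"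

text \<open>The trace is computed in an arbitrary basis; it does not depend on the choice when the
  space is finite-dimensional and the map is linear.\<close>

definition lie_trace :: "('g::complex_lie_algebra \<Rightarrow> 'g) \<Rightarrow> complex" where
  "lie_trace f = (let B = lie.extend_basis {} in \<Sum>b\<in>B. lie.representation B (f b) b)"

definition killing :: "'g::complex_lie_algebra \<Rightarrow> 'g \<Rightarrow> complex" where
  "killing x y = lie_trace (lie_bracket x \<circ> lie_bracket y)"

definition diagonalizable :: "('g::complex_lie_algebra \<Rightarrow> 'g) \<Rightarrow> bool" where
  "diagonalizable f \<longleftrightarrow> lie.span {x. \<exists>c. f x = scaleC c x} = UNIV"

text \<open>Cartan subalgebra of a semisimple complex Lie algebra: a maximal abelian subalgebra all of
  whose elements are ad-semisimple.\<close>

definition cartan_subalgebra :: "'g::complex_lie_algebra set \<Rightarrow> bool" where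
  "cartan_subalgebra h \<longleftrightarrow>
     lie_subalgebra h \<and> abelian h \<and>
     (\<forall>S. lie_subalgebra S \<and> abelian S \<and> h \<subseteq> S \<longrightarrow> S = h) \<and>
     (\<forall>x\<in>h. diagonalizable (lie_bracket x))"


section \<open>Roots and quasiroots\<close>

definition fun_scale :: "complex \<Rightarrow> ('b \<Rightarrow> complex) \<Rightarrow> 'b \<Rightarrow> complex" where
  "fun_scale c f = (\<lambda>x. c * f x)"

interpretation fun_space: vector_space "fun_scale :: complex \<Rightarrow> ('b \<Rightarrow> complex) \<Rightarrow> 'b \<Rightarrow> complex"
  by unfold_locales (simp_all add: fun_scale_def fun_eq_iff algebra_simps)

definition linear_form_on ::
    "(complex \<Rightarrow> 'v \<Rightarrow> 'v) \<Rightarrow> 'v::ab_group_add set \<Rightarrow> ('v \<Rightarrow> complex) \<Rightarrow> bool" where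
  "linear_form_on scl S f \<longleftrightarrow>
     (\<forall>x\<in>S. \<forall>y\<in>S. f (x + y) = f x + f y) \<and> (\<forall>a. \<forall>x\<in>S. f (scl a x) = a * f x)"

text \<open>Elements of the dual of \<open>h\<close> are represented by functions on the whole Lie algebra that vanish
  outside \<open>h\<close>, so that each of them has exactly one representative.\<close>

definition dual_space :: "'g::complex_lie_algebra set \<Rightarrow> ('g \<Rightarrow> complex) set" where
  "dual_space h = {f. linear_form_on scaleC h f \<and> (\<forall>x. x \<notin> h \<longrightarrow> f x = 0)}"

definition root_space ::
    "'g::complex_lie_algebra set \<Rightarrow> ('g \<Rightarrow> complex) \<Rightarrow> 'g set" where
  "root_space h \<alpha> = {x. \<forall>t\<in>h. lie_bracket t x = scaleC (\<alpha> t) x}"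

definition roots :: "'g::complex_lie_algebra set \<Rightarrow> ('g \<Rightarrow> complex) set" where
  "roots h = {\<alpha> \<in> dual_space h. \<alpha> \<noteq> 0 \<and> root_space h \<alpha> \<noteq> {0}}"

definition positive_system :: "'v::ab_group_add set \<Rightarrow> 'v set \<Rightarrow> bool" where
  "positive_system R P \<longleftrightarrow>
     R = P \<union> uminus ` P \<and> P \<inter> uminus ` P = {} \<and>
     (\<forall>\<alpha>\<in>P. \<forall>\<beta>\<in>P. \<alpha> + \<beta> \<in> R \<longrightarrow> \<alpha> + \<beta> \<in> P)"

definition simple_roots :: "'v::ab_group_add set \<Rightarrow> 'v set" where
  "simple_roots P = {\<alpha> \<in> P. \<not> (\<exists>\<beta>\<in>P. \<exists>\<gamma>\<in>P. \<alpha> = \<beta> + \<gamma>)}"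

text \<open>In what follows \<open>P\<close> is the set of positive roots and \<open>\<Gamma>\<close> a set of simple roots.\<close>

definition levi_roots :: "('g \<Rightarrow> complex) set \<Rightarrow> ('g \<Rightarrow> complex) set \<Rightarrow> ('g \<Rightarrow> complex) set" where
  "levi_roots R \<Gamma> = R \<inter> fun_space.span \<Gamma>"

definition bar ::
    "('g \<Rightarrow> complex) set \<Rightarrow> ('g \<Rightarrow> complex) set \<Rightarrow> ('g \<Rightarrow> complex) \<Rightarrow> ('g \<Rightarrow> complex)" where
  "bar P \<Gamma> \<mu> = (THE \<nu>. \<nu> \<in> fun_space.span (simple_roots P - \<Gamma>) \<and> \<mu> - \<nu> \<in> fun_space.span \<Gamma>)"

definition positive_quasiroots ::
    "('g \<Rightarrow> complex) set \<Rightarrow> ('g \<Rightarrow> complex) set \<Rightarrow> ('g \<Rightarrow> complex) set" where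
  "positive_quasiroots P \<Gamma> = bar P \<Gamma> ` P - {0}"

definition levi_subalgebra ::
    "'g::complex_lie_algebra set \<Rightarrow> (('g \<Rightarrow> complex) \<Rightarrow> 'g) \<Rightarrow> ('g \<Rightarrow> complex) set \<Rightarrow> 'g set" where
  "levi_subalgebra h E \<Gamma> = generated_subalgebra (h \<union> E ` \<Gamma> \<union> E ` uminus ` \<Gamma>)"

definition m_space ::
    "'g::complex_lie_algebra set \<Rightarrow> ('g \<Rightarrow> complex) set \<Rightarrow> (('g \<Rightarrow> complex) \<Rightarrow> 'g)
       \<Rightarrow> ('g \<Rightarrow> complex) set \<Rightarrow> 'g set" where
  "m_space h P E \<Gamma> =
     lie.span (E ` (P - levi_roots (roots h) \<Gamma>) \<union> E ` uminus ` (P - levi_roots (roots h) \<Gamma>))"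

definition m_proj ::
    "'g::complex_lie_algebra set \<Rightarrow> ('g \<Rightarrow> complex) set \<Rightarrow> (('g \<Rightarrow> complex) \<Rightarrow> 'g)
       \<Rightarrow> ('g \<Rightarrow> complex) set \<Rightarrow> 'g \<Rightarrow> 'g" where
  "m_proj h P E \<Gamma> x = (THE y. y \<in> m_space h P E \<Gamma> \<and> x - y \<in> levi_subalgebra h E \<Gamma>)"


section \<open>The exterior algebra and the Schouten bracket\<close>

text \<open>The exterior algebra is the quotient of the free vector space on words \<open>[x\<^sub>1, \<dots>, x\<^sub>p]\<close>
  by multilinearity and by the words with two equal neighbours.\<close>

type_synonym 'g formal = "'g list \<Rightarrow>\<^sub>0 complex"

abbreviation word :: "'g list \<Rightarrow> 'g formal" where
  "word xs \<equiv> Poly_Mapping.single xs 1"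

definition formal_scale :: "complex \<Rightarrow> 'g formal \<Rightarrow> 'g formal" where
  "formal_scale c A = Poly_Mapping.map ((*) c) A"

lemma lookup_formal_scale [simp]:
  "Poly_Mapping.lookup (formal_scale c A) xs = c * Poly_Mapping.lookup A xs"
  by (simp add: formal_scale_def map.rep_eq when_def)

interpretation formal: vector_space "formal_scale :: complex \<Rightarrow> 'g formal \<Rightarrow> 'g formal"
  by unfold_locales (auto intro!: poly_mapping_eqI simp: lookup_add algebra_simps)

definition wedge_relators :: "'g::complex_lie_algebra formal set" where
  "wedge_relators =
     {word (us @ (a + b) # ws) - word (us @ a # ws) - word (us @ b # ws) | us a b ws. True} \<union>
     {word (us @ scaleC c a # ws) - formal_scale c (word (us @ a # ws)) | us c a ws. True} \<union>
     {word (us @ a # a # ws) | us a ws. True}"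

abbreviation wedge_relations :: "'g::complex_lie_algebra formal set" where
  "wedge_relations \<equiv> formal.span wedge_relators"

lemma wedge_relation_add:
  "word (us @ (a + b) # ws) - word (us @ a # ws) - word (us @ b # ws) \<in> wedge_relations"
  by (rule formal.span_base) (unfold wedge_relators_def, blast)

lemma wedge_relation_scale:
  "word (us @ scaleC c a # ws) - formal_scale c (word (us @ a # ws)) \<in> wedge_relations"
  by (rule formal.span_base) (unfold wedge_relators_def, blast)

lemma wedge_relation_alt: "word (us @ a # a # ws) \<in> wedge_relations"
  by (rule formal.span_base) (unfold wedge_relators_def, blast)

definition wedge_equiv :: "'g::complex_lie_algebra formal \<Rightarrow> 'g formal \<Rightarrow> bool" where
  "wedge_equiv A B \<longleftrightarrow> A - B \<in> wedge_relations"

lemma equivp_wedge_equiv: "equivp (wedge_equiv :: 'g::complex_lie_algebra formal \<Rightarrow> 'g formal \<Rightarrow> bool)"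
proof -
  have "wedge_equiv A A" for A :: "'g formal"
    by (simp add: wedge_equiv_def formal.span_zero)
  moreover have "wedge_equiv B A" if "wedge_equiv A B" for A B :: "'g formal"
    using formal.span_neg[of "A - B" wedge_relators] that by (simp add: wedge_equiv_def)
  moreover have "wedge_equiv A C" if "wedge_equiv A B" "wedge_equiv B C" for A B C :: "'g formal"
    using formal.span_add[of "A - B" wedge_relators "B - C"] that by (simp add: wedge_equiv_def)
  ultimately show ?thesis
    by (intro equivpI reflpI sympI transpI) blast+
qed

quotient_type (overloaded) 'g polyvector = "'g::complex_lie_algebra formal" / wedge_equiv
  by (rule equivp_wedge_equiv)

instantiation polyvector :: (complex_lie_algebra) ab_group_add
begin

lift_definition zero_polyvector :: "'a polyvector" is 0 .

lift_definition plus_polyvector :: "'a polyvector \<Rightarrow> 'a polyvector \<Rightarrow> 'a polyvector" is "(+)"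
proof -
  fix A B C D :: "'a formal" assume "wedge_equiv A B" "wedge_equiv C D"
  then show "wedge_equiv (A + C) (B + D)"
    using formal.span_add[of "A - B" wedge_relators "C - D"]
    by (simp add: wedge_equiv_def algebra_simps)
qed

lift_definition uminus_polyvector :: "'a polyvector \<Rightarrow> 'a polyvector" is "uminus"
proof -
  fix A B :: "'a formal" assume "wedge_equiv A B"
  then show "wedge_equiv (- A) (- B)"
    using formal.span_neg[of "A - B" wedge_relators]
    by (simp add: wedge_equiv_def algebra_simps)
qed

lift_definition minus_polyvector :: "'a polyvector \<Rightarrow> 'a polyvector \<Rightarrow> 'a polyvector" is "(-)"
proof -
  fix A B C D :: "'a formal" assume "wedge_equiv A B" "wedge_equiv C D"
  then show "wedge_equiv (A - C) (B - D)"
    using formal.span_diff[of "A - B" wedge_relators "C - D"]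
    by (simp add: wedge_equiv_def algebra_simps)
qed

instance
  by standard
    (transfer; simp add: wedge_equiv_def formal.span_zero algebra_simps)+

end

lift_definition pv_scale :: "complex \<Rightarrow> 'g::complex_lie_algebra polyvector \<Rightarrow> 'g polyvector"
  is formal_scale
proof -
  fix c and A B :: "'g formal" assume "wedge_equiv A B"
  then show "wedge_equiv (formal_scale c A) (formal_scale c B)"
    using formal.span_scale[of "A - B" wedge_relators c]
    by (simp add: wedge_equiv_def formal.scale_right_diff_distrib)
qed

interpretation pv: vector_space
  "pv_scale :: complex \<Rightarrow> 'g polyvector \<Rightarrow> 'g::complex_lie_algebra polyvector"
  by unfold_locales
    (transfer; simp add: wedge_equiv_def formal.span_zero formal.scale_right_distrib
       formal.scale_left_distrib)+

lift_definition wedge :: "'g::complex_lie_algebra list \<Rightarrow> 'g polyvector" is word .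

text \<open>Linear extension of a map given on words.\<close>

definition formal_extend :: "('g list \<Rightarrow> 'h formal) \<Rightarrow> 'g formal \<Rightarrow> 'h formal" where
  "formal_extend F A =
     (\<Sum>xs\<in>Poly_Mapping.keys A. formal_scale (Poly_Mapping.lookup A xs) (F xs))"

lemma formal_extend_superset:
  assumes "finite S" "Poly_Mapping.keys A \<subseteq> S"
  shows "formal_extend F A = (\<Sum>xs\<in>S. formal_scale (Poly_Mapping.lookup A xs) (F xs))"
  unfolding formal_extend_def
  by (rule sum.mono_neutral_left) (use assms in \<open>auto simp: in_keys_iff\<close>)

lemma formal_extend_add: "formal_extend F (A + B) = formal_extend F A + formal_extend F B"
proof -
  let ?S = "Poly_Mapping.keys A \<union> Poly_Mapping.keys B"
  have "Poly_Mapping.keys (A + B) \<subseteq> ?S"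
    by (rule Poly_Mapping.keys_add)
  then show ?thesis
    by (simp add: formal_extend_superset[of ?S] lookup_add formal.scale_left_distrib sum.distrib)
qed

lemma formal_extend_scale: "formal_extend F (formal_scale c A) = formal_scale c (formal_extend F A)"
proof -
  have "Poly_Mapping.keys (formal_scale c A) \<subseteq> Poly_Mapping.keys A"
    by (auto simp: in_keys_iff)
  then show ?thesis
    by (simp add: formal_extend_superset[of "Poly_Mapping.keys A"] formal.scale_sum_right)
qed

lemma formal_extend_zero [simp]: "formal_extend F 0 = 0"
  by (simp add: formal_extend_def)

lemma formal_extend_diff: "formal_extend F (A - B) = formal_extend F A - formal_extend F B"
  using formal_extend_add[of F "A - B" B] by (simp add: algebra_simps)

lemma formal_extend_word [simp]: "formal_extend F (word xs) = F xs"
  by (simp add: formal_extend_def)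

lemma formal_extend_relations:
  assumes add: "\<And>us a b ws. F (us @ (a + b) # ws) - F (us @ a # ws) - F (us @ b # ws) \<in> wedge_relations"
    and scale: "\<And>us c a ws. F (us @ scaleC c a # ws) - formal_scale c (F (us @ a # ws)) \<in> wedge_relations"
    and alt: "\<And>us a ws. F (us @ a # a # ws) \<in> wedge_relations"
    and A: "A \<in> wedge_relations"
  shows "formal_extend F A \<in> wedge_relations"
  using A
proof (induction rule: formal.span_induct_alt)
  case base
  then show ?case by (simp add: formal.span_zero)
next
  case (step c x y)
  have "formal_extend F x \<in> wedge_relations"
    using step.hyps add scale alt
    by (auto simp: wedge_relators_def formal_extend_diff formal_extend_scale)
  then show ?case
    using step.IH by (simp add: formal_extend_add formal_extend_scale formal.span_add formal.span_scale)
qed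

text \<open>The map of exterior algebras induced by a linear map \<open>f\<close> (and \<open>0\<close> if \<open>f\<close> is not linear).\<close>

lift_definition wedge_map ::
    "('g::complex_lie_algebra \<Rightarrow> 'g) \<Rightarrow> 'g polyvector \<Rightarrow> 'g polyvector"
  is "\<lambda>f A. if Vector_Spaces.linear scaleC scaleC f
             then formal_extend (\<lambda>xs. word (map f xs)) A else 0"
proof -
  fix f :: "'g \<Rightarrow> 'g" and A B :: "'g formal"
  assume AB: "wedge_equiv A B"
  let ?F = "\<lambda>xs. word (map f xs)"
  show "wedge_equiv
     (if Vector_Spaces.linear scaleC scaleC f then formal_extend ?F A else 0)
     (if Vector_Spaces.linear scaleC scaleC f then formal_extend ?F B else 0)"
  proof (cases "Vector_Spaces.linear scaleC scaleC f")
    case True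
    then interpret f: Vector_Spaces.linear scaleC scaleC f .
    have "formal_extend ?F (A - B) \<in> wedge_relations"
    proof (rule formal_extend_relations)
      show "A - B \<in> wedge_relations" using AB by (simp add: wedge_equiv_def algebra_simps)
      fix us ws :: "'g list" and a b :: 'g and c :: complex
      show "word (map f (us @ (a + b) # ws)) - word (map f (us @ a # ws))
              - word (map f (us @ b # ws)) \<in> wedge_relations"
        by (simp add: f.add wedge_relation_add)
      show "word (map f (us @ scaleC c a # ws)) - formal_scale c (word (map f (us @ a # ws)))
              \<in> wedge_relations"
        by (simp add: f.scale wedge_relation_scale)
      show "word (map f (us @ a # a # ws)) \<in> wedge_relations"
        by (simp add: wedge_relation_alt)
    qed
    then show ?thesis using True by (simp add: wedge_equiv_def formal_extend_diff)
  next
    case False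
    then show ?thesis by (simp add: wedge_equiv_def formal.span_zero)
  qed
qed

definition del_nth :: "nat \<Rightarrow> 'a list \<Rightarrow> 'a list" where
  "del_nth i xs = take i xs @ drop (Suc i) xs"

text \<open>Positions are counted from 0 here; this does not change the parity of \<open>i + j\<close>.\<close>

definition schouten_words :: "'g::complex_lie_algebra list \<Rightarrow> 'g list \<Rightarrow> 'g formal" where
  "schouten_words xs ys =
     (\<Sum>i<length xs. \<Sum>j<length ys.
        formal_scale ((-1) ^ (i + j)) (word (lie_bracket (xs ! i) (ys ! j) # del_nth i xs @ del_nth j ys)))"

lemma del_nth_cases:
  assumes "i < length (us @ z # ws)"
  obtains "i = length us" "\<And>z. (us @ z # ws) ! i = z" "\<And>z. del_nth i (us @ z # ws) = us @ ws"
  | y us' ws' where "i \<noteq> length us" "\<And>z. (us @ z # ws) ! i = y"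
      "\<And>z. del_nth i (us @ z # ws) = us' @ z # ws'"
proof -
  consider "i = length us" | "i < length us" | "i > length us" by linarith
  then show ?thesis
  proof cases
    case 1
    show ?thesis by (rule that(1)) (auto simp: 1 del_nth_def)
  next
    case 2
    show ?thesis
      by (rule that(2)[of "us ! i" "del_nth i us" ws]) (use 2 in \<open>auto simp: del_nth_def nth_append\<close>)
  next
    case 3
    then obtain k where k: "i = Suc (length us + k)" using less_imp_Suc_add by blast
    show ?thesis
      by (rule that(2)[of "ws ! k" us "del_nth k ws"]) (use 3 k in \<open>auto simp: del_nth_def nth_append\<close>)
  qed
qed

lemma del_nth_cases2:
  assumes "i < length (us @ a # a # ws)"
  obtains "i = length us" | "i = Suc (length us)"
  | us' ws' where "i \<noteq> length us" "i \<noteq> Suc (length us)"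
      "del_nth i (us @ a # a # ws) = us' @ a # a # ws'"
proof -
  consider "i = length us" | "i = Suc (length us)" | "i < length us" | "i > Suc (length us)"
    by linarith
  then show ?thesis
  proof cases
    case 3
    show ?thesis
      by (rule that(3)[of "del_nth i us" ws]) (use 3 in \<open>auto simp: del_nth_def\<close>)
  next
    case 4
    then obtain k where k: "i = Suc (Suc (length us + k))"
      using less_imp_Suc_add[of "Suc (length us)" i] by auto
    show ?thesis
      by (rule that(3)[of us "del_nth k ws"]) (use 4 k in \<open>auto simp: del_nth_def numeral_3_eq_3\<close>)
  qed (fact that)+
qed

abbreviation schouten_term :: "'g::complex_lie_algebra list \<Rightarrow> 'g list \<Rightarrow> nat \<Rightarrow> nat \<Rightarrow> 'g formal" where
  "schouten_term xs ys i j \<equiv>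
     formal_scale ((-1) ^ (i + j)) (word (lie_bracket (xs ! i) (ys ! j) # del_nth i xs @ del_nth j ys))"

lemma schouten_term_slot1:
  assumes "i < length (us @ z # ws)"
  obtains us' q ws' where "\<And>z. schouten_term (us @ z # ws) ys i j =
      formal_scale ((-1) ^ (i + j)) (word (us' @ q z # ws'))"
    and "\<And>a b. q (a + b) = q a + q b" "\<And>c a. q (scaleC c a) = scaleC c (q a)"
  using assms
proof (cases rule: del_nth_cases)
  case 1
  show ?thesis
    by (rule that[of "[]" "\<lambda>z. lie_bracket z (ys ! j)" "us @ ws @ del_nth j ys"])
      (simp_all add: 1(2,3) lie_bracket_add_left lie_bracket_scale_left)
next
  case (2 y us' ws')
  show ?thesis
    by (rule that[of "lie_bracket y (ys ! j) # us'" "\<lambda>z. z" "ws' @ del_nth j ys"])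
      (simp_all add: 2(2,3))
qed

lemma schouten_term_slot2:
  assumes "j < length (us @ z # ws)"
  obtains us' q ws' where "\<And>z. schouten_term xs (us @ z # ws) i j =
      formal_scale ((-1) ^ (i + j)) (word (us' @ q z # ws'))"
    and "\<And>a b. q (a + b) = q a + q b" "\<And>c a. q (scaleC c a) = scaleC c (q a)"
  using assms
proof (cases rule: del_nth_cases)
  case 1
  show ?thesis
    by (rule that[of "[]" "\<lambda>z. lie_bracket (xs ! i) z" "del_nth i xs @ us @ ws"])
      (simp_all add: 1(2,3) lie_bracket_add_right lie_bracket_scale_right)
next
  case (2 y us' ws')
  show ?thesis
    by (rule that[of "lie_bracket (xs ! i) y # del_nth i xs @ us'" "\<lambda>z. z" "ws'"])
      (simp_all add: 2(2,3))
qed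

lemma slot_relations:
  fixes T :: "'g::complex_lie_algebra \<Rightarrow> 'g formal"
  assumes "\<And>z. T z = formal_scale s (word (us @ q z # ws))"
    and "\<And>a b. q (a + b) = q a + q b" "\<And>c a. q (scaleC c a) = scaleC c (q a)"
  shows "T (a + b) - T a - T b \<in> wedge_relations"
    and "T (scaleC c a) - formal_scale c (T a) \<in> wedge_relations"
proof -
  have "T (a + b) - T a - T b =
      formal_scale s (word (us @ (q a + q b) # ws) - word (us @ q a # ws) - word (us @ q b # ws))"
    by (simp add: assms formal.scale_right_diff_distrib)
  then show "T (a + b) - T a - T b \<in> wedge_relations"
    by (metis formal.span_scale wedge_relation_add)
  have "T (scaleC c a) - formal_scale c (T a) =
      formal_scale s (word (us @ scaleC c (q a) # ws) - formal_scale c (word (us @ q a # ws)))"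
    by (simp add: assms formal.scale_right_diff_distrib mult.commute)
  then show "T (scaleC c a) - formal_scale c (T a) \<in> wedge_relations"
    by (metis formal.span_scale wedge_relation_scale)
qed

lemma schouten_words_linear1:
  "schouten_words (us @ (a + b) # ws) ys - schouten_words (us @ a # ws) ys
     - schouten_words (us @ b # ws) ys \<in> wedge_relations"
  "schouten_words (us @ scaleC c a # ws) ys - formal_scale c (schouten_words (us @ a # ws) ys)
     \<in> wedge_relations"
proof -
  have "schouten_term (us @ (a + b) # ws) ys i j - schouten_term (us @ a # ws) ys i j
          - schouten_term (us @ b # ws) ys i j \<in> wedge_relations \<and>
        schouten_term (us @ scaleC c a # ws) ys i j
          - formal_scale c (schouten_term (us @ a # ws) ys i j) \<in> wedge_relations"
    if "i < length us + Suc (length ws)" for i j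
  proof -
    have len: "i < length (us @ a # ws)" using that by simp
    obtain us' q ws' where "\<And>z. schouten_term (us @ z # ws) ys i j =
        formal_scale ((-1) ^ (i + j)) (word (us' @ q z # ws'))"
      and "\<And>a b. q (a + b) = q a + q b" "\<And>c a. q (scaleC c a) = scaleC c (q a)"
      by (fact schouten_term_slot1[OF len, where ys = ys and j = j])
    from slot_relations[OF this] show ?thesis by blast
  qed
  then show "schouten_words (us @ (a + b) # ws) ys - schouten_words (us @ a # ws) ys
     - schouten_words (us @ b # ws) ys \<in> wedge_relations"
    "schouten_words (us @ scaleC c a # ws) ys - formal_scale c (schouten_words (us @ a # ws) ys)
     \<in> wedge_relations"
    unfolding schouten_words_def formal.scale_sum_right length_append length_Cons
      sum_subtractf[symmetric]
    by (intro formal.span_sum; simp only: lessThan_iff)+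
qed

lemma schouten_words_linear2:
  "schouten_words xs (us @ (a + b) # ws) - schouten_words xs (us @ a # ws)
     - schouten_words xs (us @ b # ws) \<in> wedge_relations"
  "schouten_words xs (us @ scaleC c a # ws) - formal_scale c (schouten_words xs (us @ a # ws))
     \<in> wedge_relations"
proof -
  have "schouten_term xs (us @ (a + b) # ws) i j - schouten_term xs (us @ a # ws) i j
          - schouten_term xs (us @ b # ws) i j \<in> wedge_relations \<and>
        schouten_term xs (us @ scaleC c a # ws) i j
          - formal_scale c (schouten_term xs (us @ a # ws) i j) \<in> wedge_relations"
    if "j < length us + Suc (length ws)" for i j
  proof -
    have len: "j < length (us @ a # ws)" using that by simp
    obtain us' q ws' where "\<And>z. schouten_term xs (us @ z # ws) i j =
        formal_scale ((-1) ^ (i + j)) (word (us' @ q z # ws'))"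
      and "\<And>a b. q (a + b) = q a + q b" "\<And>c a. q (scaleC c a) = scaleC c (q a)"
      by (fact schouten_term_slot2[OF len, where xs = xs and i = i])
    from slot_relations[OF this] show ?thesis by blast
  qed
  then show "schouten_words xs (us @ (a + b) # ws) - schouten_words xs (us @ a # ws)
     - schouten_words xs (us @ b # ws) \<in> wedge_relations"
    "schouten_words xs (us @ scaleC c a # ws) - formal_scale c (schouten_words xs (us @ a # ws))
     \<in> wedge_relations"
    unfolding schouten_words_def formal.scale_sum_right length_append length_Cons
      sum_subtractf[symmetric]
    by (intro formal.span_sum; simp only: lessThan_iff)+
qed

lemma sum_cancel_pair:
  fixes f :: "nat \<Rightarrow> 'g::complex_lie_algebra formal"
  assumes "Suc p < n" "f p + f (Suc p) = 0"
    and "\<And>i. i < n \<Longrightarrow> i \<noteq> p \<Longrightarrow> i \<noteq> Suc p \<Longrightarrow> f i \<in> wedge_relations"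
  shows "(\<Sum>i<n. f i) \<in> wedge_relations"
proof -
  have "(\<Sum>i<n. f i) = (\<Sum>i\<in>{..<n} - {p, Suc p}. f i) + (\<Sum>i\<in>{p, Suc p}. f i)"
    by (rule sum.subset_diff) (use assms in auto)
  also have "(\<Sum>i\<in>{p, Suc p}. f i) = 0" using assms by simp
  finally show ?thesis using assms by (auto intro!: formal.span_sum)
qed

lemma schouten_words_alt1: "schouten_words (us @ a # a # ws) ys \<in> wedge_relations"
  unfolding schouten_words_def
proof (rule sum_cancel_pair[of "length us"])
  show "Suc (length us) < length (us @ a # a # ws)" by simp
  show "(\<Sum>j<length ys. schouten_term (us @ a # a # ws) ys (length us) j) +
        (\<Sum>j<length ys. schouten_term (us @ a # a # ws) ys (Suc (length us)) j) = 0"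
    by (simp add: del_nth_def nth_append flip: sum.distrib)
next
  fix i assume "i < length (us @ a # a # ws)" "i \<noteq> length us" "i \<noteq> Suc (length us)"
  then obtain us' ws' where del: "del_nth i (us @ a # a # ws) = us' @ a # a # ws'"
    by (cases rule: del_nth_cases2) auto
  have "word (y # del_nth i (us @ a # a # ws) @ zs) \<in> wedge_relations" for y zs
    unfolding del using wedge_relation_alt[of "y # us'" a "ws' @ zs"] by simp
  then show "(\<Sum>j<length ys. schouten_term (us @ a # a # ws) ys i j) \<in> wedge_relations"
    by (intro formal.span_sum formal.span_scale)
qed

lemma schouten_words_alt2: "schouten_words xs (us @ a # a # ws) \<in> wedge_relations"
proof -
  have "schouten_words xs (us @ a # a # ws) = (\<Sum>j<length (us @ a # a # ws).
      \<Sum>i<length xs. schouten_term xs (us @ a # a # ws) i j)"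
    unfolding schouten_words_def by (rule sum.swap)
  also have "\<dots> \<in> wedge_relations"
  proof (rule sum_cancel_pair[of "length us"])
    show "Suc (length us) < length (us @ a # a # ws)" by simp
    show "(\<Sum>i<length xs. schouten_term xs (us @ a # a # ws) i (length us)) +
          (\<Sum>i<length xs. schouten_term xs (us @ a # a # ws) i (Suc (length us))) = 0"
      by (simp add: del_nth_def nth_append flip: sum.distrib)
  next
    fix j assume "j < length (us @ a # a # ws)" "j \<noteq> length us" "j \<noteq> Suc (length us)"
    then obtain us' ws' where del: "del_nth j (us @ a # a # ws) = us' @ a # a # ws'"
      by (cases rule: del_nth_cases2) auto
    have "word (y # zs @ del_nth j (us @ a # a # ws)) \<in> wedge_relations" for y zs
      unfolding del using wedge_relation_alt[of "y # zs @ us'" a ws'] by simp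
    then show "(\<Sum>i<length xs. schouten_term xs (us @ a # a # ws) i j) \<in> wedge_relations"
      by (intro formal.span_sum formal.span_scale)
  qed
  finally show ?thesis .
qed

lemma formal_extend_mem:
  assumes "\<And>xs. F xs \<in> wedge_relations"
  shows "formal_extend F A \<in> wedge_relations"
  unfolding formal_extend_def by (rule formal.span_sum, rule formal.span_scale, rule assms)

lemma formal_extend_fun_diff:
  "formal_extend F A - formal_extend G A = formal_extend (\<lambda>xs. F xs - G xs) A"
  unfolding formal_extend_def sum_subtractf[symmetric]
  by (rule sum.cong[OF refl], rule formal.scale_right_diff_distrib[symmetric])

lemma formal_extend_fun_scale:
  "formal_scale c (formal_extend F A) = formal_extend (\<lambda>xs. formal_scale c (F xs)) A"
  unfolding formal_extend_def formal.scale_sum_right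
  by (rule sum.cong[OF refl], rule formal.scale_left_commute)

definition schouten_formal :: "'g::complex_lie_algebra formal \<Rightarrow> 'g formal \<Rightarrow> 'g formal" where
  "schouten_formal A B = formal_extend (\<lambda>xs. formal_extend (schouten_words xs) B) A"

lift_definition schouten ::
    "'g::complex_lie_algebra polyvector \<Rightarrow> 'g polyvector \<Rightarrow> 'g polyvector"
  is schouten_formal
proof -
  fix A A' B B' :: "'g formal"
  assume "wedge_equiv A A'" "wedge_equiv B B'"
  then have A: "A - A' \<in> wedge_relations" and B: "B - B' \<in> wedge_relations"
    by (simp_all add: wedge_equiv_def)
  have "schouten_formal (A - A') B \<in> wedge_relations"
    unfolding schouten_formal_def
  proof (rule formal_extend_relations[OF _ _ _ A])
    fix us ws :: "'g list" and a b :: 'g and c :: complex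
    let ?F = "\<lambda>xs. formal_extend (schouten_words xs) B"
    show "?F (us @ (a + b) # ws) - ?F (us @ a # ws) - ?F (us @ b # ws) \<in> wedge_relations"
      unfolding formal_extend_fun_diff by (intro formal_extend_mem schouten_words_linear1)
    show "?F (us @ scaleC c a # ws) - formal_scale c (?F (us @ a # ws)) \<in> wedge_relations"
      unfolding formal_extend_fun_diff formal_extend_fun_scale
      by (intro formal_extend_mem schouten_words_linear1)
    show "?F (us @ a # a # ws) \<in> wedge_relations"
      by (intro formal_extend_mem schouten_words_alt1)
  qed
  moreover have "schouten_formal A' (B - B') \<in> wedge_relations"
    unfolding schouten_formal_def
    by (rule formal_extend_mem, rule formal_extend_relations[OF _ _ _ B])
      (rule schouten_words_linear2 schouten_words_alt2)+
  moreover have "schouten_formal A' (B - B') = schouten_formal A' B - schouten_formal A' B'"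
    unfolding schouten_formal_def formal_extend_fun_diff formal_extend_diff ..
  then have "schouten_formal A B - schouten_formal A' B' =
      schouten_formal (A - A') B + schouten_formal A' (B - B')"
    by (simp add: schouten_formal_def formal_extend_diff)
  ultimately show "wedge_equiv (schouten_formal A B) (schouten_formal A' B')"
    by (simp add: wedge_equiv_def formal.span_add)
qed

text \<open>The values on decomposable elements.\<close>

lemma schouten_wedge:
  "schouten (wedge xs) (wedge ys) =
     (\<Sum>i<length xs. \<Sum>j<length ys.
        pv_scale ((-1) ^ (i + j)) (wedge (lie_bracket (xs ! i) (ys ! j) # del_nth i xs @ del_nth j ys)))"
proof -
  have add: "abs_polyvector (A + B) = abs_polyvector A + abs_polyvector B" for A B :: "'a formal"
    by (simp add: plus_polyvector.abs_eq)
  have sum: "abs_polyvector (\<Sum>i\<in>S. f i) = (\<Sum>i\<in>S. abs_polyvector (f i))"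
    for f :: "nat \<Rightarrow> 'a formal" and S
    by (induction S rule: infinite_finite_induct) (simp_all add: add flip: zero_polyvector.abs_eq)
  show ?thesis
    by (simp add: wedge.abs_eq schouten.abs_eq schouten_formal_def schouten_words_def sum
        pv_scale.abs_eq)
qed

lemma wedge_map_wedge:
  assumes "Vector_Spaces.linear scaleC scaleC f"
  shows "wedge_map f (wedge xs) = wedge (map f xs)"
  using assms by (simp add: wedge.abs_eq wedge_map.abs_eq)


section \<open>Invariant polyvector fields on \<open>M\<close>\<close>

definition exterior_power :: "nat \<Rightarrow> 'g::complex_lie_algebra set \<Rightarrow> 'g polyvector set" where
  "exterior_power p V = pv.span {wedge xs | xs. length xs = p \<and> set xs \<subseteq> V}"

text \<open>The bracket with \<open>wedge [x]\<close> is the derivation of the exterior algebra extending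
  \<open>lie_bracket x\<close>, i.e. the adjoint action of \<open>x\<close>.\<close>

definition invariant_polyvector_fields ::
    "nat \<Rightarrow> 'g::complex_lie_algebra set \<Rightarrow> ('g \<Rightarrow> complex) set \<Rightarrow> (('g \<Rightarrow> complex) \<Rightarrow> 'g)
       \<Rightarrow> ('g \<Rightarrow> complex) set \<Rightarrow> 'g polyvector set" where
  "invariant_polyvector_fields p h P E \<Gamma> =
     {A \<in> exterior_power p (m_space h P E \<Gamma>). \<forall>x \<in> levi_subalgebra h E \<Gamma>. schouten (wedge [x]) A = 0}"

definition schouten_M ::
    "'g::complex_lie_algebra set \<Rightarrow> ('g \<Rightarrow> complex) set \<Rightarrow> (('g \<Rightarrow> complex) \<Rightarrow> 'g)
       \<Rightarrow> ('g \<Rightarrow> complex) set \<Rightarrow> 'g polyvector \<Rightarrow> 'g polyvector \<Rightarrow> 'g polyvector" where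
  "schouten_M h P E \<Gamma> A B = wedge_map (m_proj h P E \<Gamma>) (schouten A B)"

definition r_matrix ::
    "('g::complex_lie_algebra \<Rightarrow> complex) set \<Rightarrow> (('g \<Rightarrow> complex) \<Rightarrow> 'g) \<Rightarrow> 'g polyvector" where
  "r_matrix P E = (\<Sum>\<alpha>\<in>P. wedge [E \<alpha>, E (- \<alpha>)])"

definition phi ::
    "('g::complex_lie_algebra \<Rightarrow> complex) set \<Rightarrow> (('g \<Rightarrow> complex) \<Rightarrow> 'g) \<Rightarrow> 'g polyvector" where
  "phi P E = schouten (r_matrix P E) (r_matrix P E)"

definition phi_M ::
    "'g::complex_lie_algebra set \<Rightarrow> ('g \<Rightarrow> complex) set \<Rightarrow> (('g \<Rightarrow> complex) \<Rightarrow> 'g)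
       \<Rightarrow> ('g \<Rightarrow> complex) set \<Rightarrow> 'g polyvector" where
  "phi_M h P E \<Gamma> = wedge_map (m_proj h P E \<Gamma>) (phi P E)"

definition bivector ::
    "'g::complex_lie_algebra set \<Rightarrow> ('g \<Rightarrow> complex) set \<Rightarrow> (('g \<Rightarrow> complex) \<Rightarrow> 'g)
       \<Rightarrow> ('g \<Rightarrow> complex) set \<Rightarrow> (('g \<Rightarrow> complex) \<Rightarrow> complex) \<Rightarrow> 'g polyvector" where
  "bivector h P E \<Gamma> c =
     (\<Sum>\<alpha>\<in>P - levi_roots (roots h) \<Gamma>. pv_scale (c (bar P \<Gamma> \<alpha>)) (wedge [E \<alpha>, E (- \<alpha>)]))"


section \<open>Poisson brackets on \<open>M\<close>\<close>

definition poisson_bivector_field ::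
    "'g::complex_lie_algebra set \<Rightarrow> ('g \<Rightarrow> complex) set \<Rightarrow> (('g \<Rightarrow> complex) \<Rightarrow> 'g)
       \<Rightarrow> ('g \<Rightarrow> complex) set \<Rightarrow> 'g polyvector \<Rightarrow> bool" where
  "poisson_bivector_field h P E \<Gamma> A \<longleftrightarrow>
     A \<in> invariant_polyvector_fields 2 h P E \<Gamma> \<and> schouten_M h P E \<Gamma> A A = 0"

text \<open>The bracket of functions. Functions on an open subset \<open>V\<close> of \<open>M = G/G\<^sub>\<Gamma>\<close> are functions on its
  preimage in \<open>G\<close> that are killed by the left-invariant vector fields from the Levi subalgebra
  (\<open>G\<^sub>\<Gamma>\<close> is connected). We abstract the algebra of functions on the preimage of \<open>V\<close> to an arbitrary
  commutative complex algebra, with structure map \<open>\<iota>\<close>, on which the Lie algebra acts by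
  derivations \<open>\<rho>\<close>. The \<open>G\<close>-invariant bivector field given by \<open>v\<close> is evaluated by letting
  \<open>E\<^sub>\<alpha>\<close> act as left-invariant vector field.\<close>

definition acts_by_derivations ::
    "(complex \<Rightarrow> 'a::comm_ring_1) \<Rightarrow> ('g::complex_lie_algebra \<Rightarrow> 'a \<Rightarrow> 'a) \<Rightarrow> bool" where
  "acts_by_derivations \<iota> \<rho> \<longleftrightarrow>
     \<iota> 1 = 1 \<and> (\<forall>a b. \<iota> (a + b) = \<iota> a + \<iota> b) \<and> (\<forall>a b. \<iota> (a * b) = \<iota> a * \<iota> b) \<and>
     (\<forall>x y f. \<rho> (x + y) f = \<rho> x f + \<rho> y f) \<and>
     (\<forall>a x f. \<rho> (scaleC a x) f = \<iota> a * \<rho> x f) \<and>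
     (\<forall>x y f. \<rho> (lie_bracket x y) f = \<rho> x (\<rho> y f) - \<rho> y (\<rho> x f)) \<and>
     (\<forall>x f g. \<rho> x (f + g) = \<rho> x f + \<rho> x g) \<and>
     (\<forall>x a. \<rho> x (\<iota> a) = 0) \<and>
     (\<forall>x f g. \<rho> x (f * g) = \<rho> x f * g + f * \<rho> x g)"

definition invariant_functions ::
    "('g::complex_lie_algebra \<Rightarrow> 'a::comm_ring_1 \<Rightarrow> 'a) \<Rightarrow> 'g set \<Rightarrow> 'a set" where
  "invariant_functions \<rho> S = {f. \<forall>x\<in>S. \<rho> x f = 0}"

definition function_bracket ::
    "(complex \<Rightarrow> 'a::comm_ring_1) \<Rightarrow> ('g::complex_lie_algebra \<Rightarrow> 'a \<Rightarrow> 'a)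
       \<Rightarrow> 'g set \<Rightarrow> ('g \<Rightarrow> complex) set \<Rightarrow> (('g \<Rightarrow> complex) \<Rightarrow> 'g) \<Rightarrow> ('g \<Rightarrow> complex) set
       \<Rightarrow> (('g \<Rightarrow> complex) \<Rightarrow> complex) \<Rightarrow> 'a \<Rightarrow> 'a \<Rightarrow> 'a" where
  "function_bracket \<iota> \<rho> h P E \<Gamma> c f g =
     (\<Sum>\<alpha>\<in>P - levi_roots (roots h) \<Gamma>.
        \<iota> (c (bar P \<Gamma> \<alpha>)) * (\<rho> (E \<alpha>) f * \<rho> (E (- \<alpha>)) g - \<rho> (E (- \<alpha>)) f * \<rho> (E \<alpha>) g))"

definition poisson_bracket_on ::
    "(complex \<Rightarrow> 'a::comm_ring_1) \<Rightarrow> 'a set \<Rightarrow> ('a \<Rightarrow> 'a \<Rightarrow> 'a) \<Rightarrow> bool" where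
  "poisson_bracket_on \<iota> A br \<longleftrightarrow>
     (\<forall>f\<in>A. \<forall>g\<in>A. br f g \<in> A \<and> br g f = - br f g) \<and>
     (\<forall>f\<in>A. \<forall>g\<in>A. \<forall>k\<in>A. br f (g + k) = br f g + br f k) \<and>
     (\<forall>a. \<forall>f\<in>A. \<forall>g\<in>A. br f (\<iota> a * g) = \<iota> a * br f g) \<and>
     (\<forall>f\<in>A. \<forall>g\<in>A. \<forall>k\<in>A. br f (g * k) = br f g * k + g * br f k) \<and>
     (\<forall>f\<in>A. \<forall>g\<in>A. \<forall>k\<in>A. br f (br g k) + br g (br k f) + br k (br f g) = 0)"


section \<open>The formula for the coefficients\<close>

text \<open>Elementary symmetric polynomials with an integer index: the value is 0 for \<open>i < 0\<close>.\<close>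

definition elem_sym :: "int \<Rightarrow> complex list \<Rightarrow> complex" where
  "elem_sym i cs = (\<Sum>I\<in>{I. I \<subseteq> {..<length cs} \<and> int (card I) = i}. \<Prod>j\<in>I. cs ! j)"

definition coeff_num :: "complex \<Rightarrow> complex list \<Rightarrow> complex" where
  "coeff_num K cs = (\<Sum>m\<le>length cs. K ^ (2 * m) * elem_sym (int (length cs) - 2 * int m) cs)"

definition coeff_denom :: "complex \<Rightarrow> complex list \<Rightarrow> complex" where
  "coeff_denom K cs = (\<Sum>m\<le>length cs. K ^ (2 * m) * elem_sym (int (length cs) - 1 - 2 * int m) cs)"

text \<open>\<open>js\<close> lists the simple roots \<open>\<alpha>\<^bsub>j\<^sub>1\<^esub>, \<dots>, \<alpha>\<^bsub>j\<^sub>l\<^esub>\<close> outside \<open>\<Gamma>\<close> in an expression of \<open>q\<close> as a sum of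
  simple quasiroots.\<close>

definition quasiroot_sum ::
    "('g \<Rightarrow> complex) set \<Rightarrow> ('g \<Rightarrow> complex) set \<Rightarrow> ('g \<Rightarrow> complex) list \<Rightarrow> ('g \<Rightarrow> complex) \<Rightarrow> bool" where
  "quasiroot_sum P \<Gamma> js q \<longleftrightarrow>
     set js \<subseteq> simple_roots P - \<Gamma> \<and> sum_list (map (bar P \<Gamma>) js) = q"

definition given_by_formula ::
    "('g \<Rightarrow> complex) set \<Rightarrow> ('g \<Rightarrow> complex) set \<Rightarrow> complex \<Rightarrow> (('g \<Rightarrow> complex) \<Rightarrow> complex)
       \<Rightarrow> (('g \<Rightarrow> complex) \<Rightarrow> complex) \<Rightarrow> bool" where
  "given_by_formula P \<Gamma> K c0 c \<longleftrightarrow>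
     (\<forall>q\<in>positive_quasiroots P \<Gamma>. \<forall>js. quasiroot_sum P \<Gamma> js q \<longrightarrow>
        c q = coeff_num K (map c0 js) / coeff_denom K (map c0 js))"

end

theory Submission
  imports Defs "HOL-Library.Multiset"
begin

text \<open>
  Extend the coefficients \<open>c\<close> to an odd function on all roots outside the Levi subalgebra. Then the
  Schouten bracket of \<open>v\<close> with itself, projected to \<open>m\<close>, is a sum over the triples of such roots with
  \<open>\<alpha> + \<beta> + \<gamma> = 0\<close>. The term of a triple is a fixed nonzero trivector, which is the structure constant
  times the exterior product of root vectors. Up to a common factor its coefficient is
  \<open>c \<alpha> c \<beta> + c \<beta> c \<gamma> + c \<gamma> c \<alpha>\<close>. For the bivector \<open>r\<close> the values of \<open>c\<close> are signs, not all equal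
  on a triple, and the coefficient is \<open>- 1\<close>. As the trivectors of different unordered triples are
  linearly independent, the equation for \<open>v\<close> means that the coefficient is \<open>- K\<^sup>2\<close> for every triple
  (\<open>schouten_M_bivector_iff\<close>). For positive roots this is the addition formula
  \<open>c (\<alpha> + \<beta>) (c \<alpha> + c \<beta>) = c \<alpha> c \<beta> + K\<^sup>2\<close> (\<open>pair_sum_signed_iff\<close>).

  The formula with the elementary symmetric polynomials solves it: its numerator \<open>N\<close> and denominator
  \<open>D\<close> satisfy \<open>N \<plusminus> K D = \<Prod>\<^sub>j (c\<^sub>j \<plusminus> K)\<close>, so that concatenation of lists multiplies \<open>N + K D\<close>, as in the
  addition theorem of the hyperbolic cotangent (\<open>formula_addition\<close>). The solution is unique because a
  positive root that is not simple is a sum of two positive roots, and \<open>c \<alpha> + c \<beta>\<close> is not 0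
  (\<open>formula_unique_solution\<close>). If \<open>K = 0\<close>, then \<open>D / N\<close> is the sum of the \<open>1 / c\<^sub>j\<close>, which is linear
  in the quasiroot. The Jacobi identity for functions leads to the same sum over triples, since
  the commutators of root vectors that occur in it act on invariant functions modulo the Levi
  subalgebra (\<open>function_bracket_jacobi\<close>).

  All this rests on the structure of the root system, which is derived from the definitions. The normalization of
  the root vectors makes the Killing form nonzero, hence nondegenerate, as the Lie algebra is simple.
  The rest is a matter of highest weight vectors for the \<open>sl\<^sub>2\<close> attached to a root
  (\<open>highest_weight\<close>): root spaces are one-dimensional, scalar products of roots are real and positive
  definite, the sum of two roots at an obtuse angle is a root or 0, and \<open>[E \<alpha>, E \<beta>]\<close> is not 0 if \<open>\<alpha> + \<beta>\<close> is a root
  (\<open>bracket_root_vectors_nonzero\<close>), which is what makes every triple count. A positive system is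
  defined by closure under sums that are roots. Its simple roots are linearly independent because of their
  obtuse angles and because of the positivity of the scalar products with the sum of all positive roots
  (\<open>sum_ip_simple\<close>, \<open>simple_roots_independent\<close>).
\<close>

section \<open>Linearity of the bracket\<close>

lemma linear_lie_bracket: "Vector_Spaces.linear scaleC scaleC (lie_bracket (x::'g::complex_lie_algebra))"
  by unfold_locales (simp_all add: lie_bracket_add_right lie_bracket_scale_right)

lemma linear_lie_bracket_left:
  "Vector_Spaces.linear scaleC scaleC (\<lambda>x. lie_bracket x (y::'g::complex_lie_algebra))"
  by unfold_locales (simp_all add: lie_bracket_add_left lie_bracket_scale_left)

interpretation ad: Vector_Spaces.linear scaleC scaleC "lie_bracket (x::'g::complex_lie_algebra)" for x
  by (rule linear_lie_bracket)

interpretation ad_left: Vector_Spaces.linear scaleC scaleC "\<lambda>x. lie_bracket x (y::'g::complex_lie_algebra)" for y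
  by (rule linear_lie_bracket_left)

lemma lie_bracket_anticomm: "lie_bracket y x = - lie_bracket x (y::'g::complex_lie_algebra)"
proof -
  have "lie_bracket x y + lie_bracket y x = lie_bracket (x + y) (x + y)"
    by (simp only: lie_bracket_add_left lie_bracket_add_right)
      (simp add: lie_bracket_self add.commute)
  then show ?thesis by (metis add_eq_0_iff lie_bracket_self)
qed

lemma lie_bracket_derivation:
  "lie_bracket x (lie_bracket y z) =
     lie_bracket (lie_bracket x y) z + lie_bracket y (lie_bracket x (z::'g::complex_lie_algebra))"
proof -
  have "lie_bracket y (lie_bracket z x) = - lie_bracket y (lie_bracket x z)"
    by (subst lie_bracket_anticomm) (simp add: ad.neg)
  moreover have "lie_bracket z (lie_bracket x y) = - lie_bracket (lie_bracket x y) z"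
    by (rule lie_bracket_anticomm)
  ultimately show ?thesis using jacobi[of x y z] by (simp add: algebra_simps)
qed

section \<open>Traces and the Killing form\<close>

definition finite_dim :: "'g::complex_lie_algebra itself \<Rightarrow> bool" where
  "finite_dim _ \<longleftrightarrow> (\<exists>B :: 'g set. finite B \<and> lie.span B = UNIV)"

lemma finite_independent:
  assumes "finite_dim TYPE('g::complex_lie_algebra)" "lie.independent (B :: 'g set)"
  shows "finite B"
  using assms lie.independent_span_bound[of _ B] unfolding finite_dim_def by auto

lemma extend_basis_empty:
  "lie.independent (lie.extend_basis {})" "lie.span (lie.extend_basis {}) = UNIV"
  using lie.independent_extend_basis[OF lie.independent_empty] lie.span_extend_basis[OF lie.independent_empty]
  by auto

text \<open>The trace is fixed in the definition by one arbitrary basis; it will be computed in a basis that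
  contains the root vectors.\<close>

lemma lie_trace_basis:
  fixes f :: "'g::complex_lie_algebra \<Rightarrow> 'g"
  assumes f: "Vector_Spaces.linear scaleC scaleC f"
    and C: "finite C" "lie.independent C" "lie.span C = UNIV"
  shows "lie_trace f = (\<Sum>c\<in>C. lie.representation C (f c) c)"
proof -
  interpret f: Vector_Spaces.linear scaleC scaleC f by (rule f)
  define B where "B = (lie.extend_basis {} :: 'g set)"
  have B: "lie.independent B" "lie.span B = UNIV"
    by (simp_all add: B_def extend_basis_empty)
  have finB: "finite B"
    using finite_independent[OF _ B(1)] C unfolding finite_dim_def by auto
  have expC: "(\<Sum>c\<in>C. scaleC (lie.representation C x c) c) = x" for x
    by (rule lie.sum_representation_eq) (use C in auto)
  have expB: "(\<Sum>b\<in>B. scaleC (lie.representation B x b) b) = x" for x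
    by (rule lie.sum_representation_eq) (use B finB in auto)
  have expf: "(\<Sum>c\<in>C. scaleC (lie.representation C x c) (f c)) = f x" for x
    using expC[of x, THEN arg_cong, of f] by (simp add: f.sum f.scale)
  have "lie_trace f = (\<Sum>b\<in>B. lie.representation B (f b) b)"
    by (simp add: lie_trace_def B_def Let_def)
  also have "\<dots> = (\<Sum>b\<in>B. lie.representation B (\<Sum>c\<in>C. scaleC (lie.representation C b c) (f c)) b)"
    by (simp only: expf)
  also have "\<dots> = (\<Sum>b\<in>B. \<Sum>c\<in>C. lie.representation C b c * lie.representation B (f c) b)"
    by (simp add: lie.representation_sum B lie.representation_scale)
  also have "\<dots> = (\<Sum>c\<in>C. \<Sum>b\<in>B. lie.representation B (f c) b * lie.representation C b c)"
    by (subst sum.swap) (simp add: mult.commute)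
  also have "\<dots> = (\<Sum>c\<in>C. lie.representation C (\<Sum>b\<in>B. scaleC (lie.representation B (f c) b) b) c)"
    by (simp add: lie.representation_sum C lie.representation_scale)
  also have "\<dots> = (\<Sum>c\<in>C. lie.representation C (f c) c)"
    by (simp only: expB)
  finally show ?thesis .
qed

lemma lie_trace_comm:
  fixes f g :: "'g::complex_lie_algebra \<Rightarrow> 'g"
  assumes fd: "finite_dim TYPE('g)"
    and f: "Vector_Spaces.linear scaleC scaleC f" and g: "Vector_Spaces.linear scaleC scaleC g"
  shows "lie_trace (f \<circ> g) = lie_trace (g \<circ> f)"
proof -
  define B where "B = (lie.extend_basis {} :: 'g set)"
  have B: "lie.independent B" "lie.span B = UNIV"
    by (simp_all add: B_def extend_basis_empty)
  have finB: "finite B" by (rule finite_independent[OF fd B(1)])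
  have expB: "(\<Sum>b\<in>B. scaleC (lie.representation B x b) b) = x" for x
    by (rule lie.sum_representation_eq) (use B finB in auto)
  have *: "lie_trace (f \<circ> g) =
      (\<Sum>b\<in>B. \<Sum>b'\<in>B. lie.representation B (g b) b' * lie.representation B (f b') b)"
    if f: "Vector_Spaces.linear scaleC scaleC f" for f g :: "'g \<Rightarrow> 'g"
  proof -
    interpret f: Vector_Spaces.linear scaleC scaleC f by (rule f)
    have "lie_trace (f \<circ> g) = (\<Sum>b\<in>B. lie.representation B (f (g b)) b)"
      by (simp add: lie_trace_def B_def Let_def)
    also have "\<dots> = (\<Sum>b\<in>B. lie.representation B (f (\<Sum>b'\<in>B. scaleC (lie.representation B (g b) b') b')) b)"
      by (simp only: expB)
    finally show ?thesis
      by (simp add: f.sum f.scale lie.representation_sum B lie.representation_scale)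
  qed
  show ?thesis unfolding *[OF f] *[OF g]
    by (subst sum.swap) (simp add: mult.commute)
qed

lemma lie_trace_add: "lie_trace (\<lambda>x. f x + g x) = lie_trace f + lie_trace g"
  by (simp add: lie_trace_def Let_def lie.representation_add extend_basis_empty sum.distrib)

lemma lie_trace_diff: "lie_trace (\<lambda>x. f x - g x) = lie_trace f - lie_trace g"
  by (simp add: lie_trace_def Let_def lie.representation_diff extend_basis_empty sum_subtractf)

lemma lie_trace_scale: "lie_trace (\<lambda>x. scaleC c (f x)) = c * lie_trace f"
  by (simp add: lie_trace_def Let_def lie.representation_scale extend_basis_empty sum_distrib_left)

lemma killing_add_left: "killing (x + y) z = killing x z + killing y z"
  by (simp add: killing_def o_def ad_left.add lie_trace_add)

lemma killing_add_right: "killing x (y + z) = killing x y + killing x z"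
  by (simp add: killing_def o_def ad_left.add ad.add lie_trace_add)

lemma killing_scale_left: "killing (scaleC c x) y = c * killing x y"
  by (simp add: killing_def o_def ad_left.scale lie_trace_scale)

lemma killing_scale_right: "killing x (scaleC c y) = c * killing x y"
  by (simp add: killing_def o_def ad_left.scale ad.scale lie_trace_scale)

lemma killing_zero [simp]: "killing 0 x = 0" "killing x 0 = 0"
  using killing_scale_left[of 0 0 x] killing_scale_right[of x 0 0] by simp_all

lemma killing_neg [simp]: "killing (- x) y = - killing x y" "killing x (- y) = - killing x y"
  using killing_scale_left[of "-1" x y] killing_scale_right[of x "-1" y] by simp_all

lemma killing_diff:
  "killing (x - y) z = killing x z - killing y z" "killing z (x - y) = killing z x - killing z y"
  by (simp_all only: diff_conv_add_uminus killing_add_left killing_add_right killing_neg)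

lemma killing_sum:
  "killing (\<Sum>i\<in>I. f i) z = (\<Sum>i\<in>I. killing (f i) z)"
  "killing z (\<Sum>i\<in>I. f i) = (\<Sum>i\<in>I. killing z (f i))"
  by (induction I rule: infinite_finite_induct) (simp_all add: killing_add_left killing_add_right)

lemma killing_commute:
  assumes "finite_dim TYPE('g::complex_lie_algebra)"
  shows "killing x y = killing y (x::'g)"
  unfolding killing_def by (rule lie_trace_comm[OF assms linear_lie_bracket linear_lie_bracket])

lemma killing_invariant:
  assumes "finite_dim TYPE('g::complex_lie_algebra)"
  shows "killing (lie_bracket x y) z = killing x (lie_bracket y (z::'g))"
proof -
  let ?X = "lie_bracket x" and ?Y = "lie_bracket y" and ?Z = "lie_bracket z"
  have ad_bracket: "lie_bracket (lie_bracket a b) w = lie_bracket a (lie_bracket b w) - lie_bracket b (lie_bracket a w)"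
    for a b w :: 'g
    using lie_bracket_derivation[of a b w] by simp
  have "killing (lie_bracket x y) z = lie_trace (?X \<circ> (?Y \<circ> ?Z)) - lie_trace (?Y \<circ> (?X \<circ> ?Z))"
    unfolding killing_def lie_trace_diff[symmetric] by (simp add: o_def ad_bracket)
  moreover have "killing x (lie_bracket y z) = lie_trace (?X \<circ> (?Y \<circ> ?Z)) - lie_trace (?X \<circ> ?Z \<circ> ?Y)"
    unfolding killing_def lie_trace_diff[symmetric] by (simp add: o_def ad_bracket ad.diff)
  moreover have "lie_trace (?Y \<circ> (?X \<circ> ?Z)) = lie_trace (?X \<circ> ?Z \<circ> ?Y)"
    by (rule lie_trace_comm[OF assms linear_lie_bracket])
      (rule Vector_Spaces.linear_compose[OF linear_lie_bracket linear_lie_bracket])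
  ultimately show ?thesis by simp
qed


section \<open>Simultaneous eigenvectors\<close>

lemma span_UN_subspaces:
  fixes V :: "'i \<Rightarrow> 'g::complex_lie_algebra set"
  assumes V: "\<And>i. lie.subspace (V i)" and x: "x \<in> lie.span (\<Union>i\<in>I. V i)"
  obtains F y where "finite F" "F \<subseteq> I" "\<And>i. y i \<in> V i" "x = (\<Sum>i\<in>F. y i)"
proof -
  have "\<exists>F y. finite F \<and> F \<subseteq> I \<and> (\<forall>i. y i \<in> V i) \<and> (\<forall>i. i \<notin> F \<longrightarrow> y i = 0) \<and> x = (\<Sum>i\<in>F. y i)"
    using x
  proof (induction rule: lie.span_induct_alt)
    case base
    show ?case by (rule exI[of _ "{}"], rule exI[of _ "\<lambda>_. 0"]) (simp add: lie.subspace_0 V)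
  next
    case (step c v z)
    then obtain i0 F y where i0: "i0 \<in> I" "v \<in> V i0" and F: "finite F" "F \<subseteq> I"
      and y: "\<And>i. y i \<in> V i" "\<And>i. i \<notin> F \<Longrightarrow> y i = 0" "z = (\<Sum>i\<in>F. y i)" by auto
    let ?y = "y(i0 := scaleC c v + y i0)"
    have z: "z = (\<Sum>i\<in>insert i0 F. y i)"
      using F y by (cases "i0 \<in> F") (auto simp: insert_absorb)
    have "(\<Sum>i\<in>insert i0 F. ?y i) = (\<Sum>i\<in>insert i0 F. (if i = i0 then scaleC c v else 0) + y i)"
      by (rule sum.cong) auto
    also have "\<dots> = scaleC c v + z"
      using F by (simp add: sum.distrib z)
    finally show ?case
      using i0 F y V
      by (intro exI[of _ "insert i0 F"] exI[of _ ?y]) (auto intro!: lie.subspace_add lie.subspace_scale)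
  qed
  then show thesis using that by blast
qed

text \<open>Joint eigenvectors with distinct systems of eigenvalues are linearly independent: if two of the
  systems differ at \<open>t\<close>, then \<open>ad t\<close> minus the eigenvalue of one of them removes this one from a
  vanishing sum and only rescales the others.\<close>

lemma joint_eigenvectors_sum_zero:
  fixes x :: "'i \<Rightarrow> 'g::complex_lie_algebra"
  assumes "finite F"
    and "\<And>i t. i \<in> F \<Longrightarrow> t \<in> T \<Longrightarrow> lie_bracket t (x i) = scaleC (w i t) (x i)"
    and "\<And>i j. i \<in> F \<Longrightarrow> j \<in> F \<Longrightarrow> i \<noteq> j \<Longrightarrow> \<exists>t\<in>T. w i t \<noteq> w j t"
    and "(\<Sum>i\<in>F. x i) = 0" and "i \<in> F"
  shows "x i = 0"
  using assms
proof (induction F arbitrary: x i rule: finite_induct)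
  case empty
  then show ?case by simp
next
  case (insert j F)
  have F0: "x i = 0" if "i \<in> F" for i
  proof -
    have "\<exists>t\<in>T. w i t \<noteq> w j t" using insert.prems(2)[of i j] insert.hyps that by auto
    then obtain t where t: "t \<in> T" "w i t \<noteq> w j t" by blast
    let ?y = "\<lambda>k. scaleC (w k t - w j t) (x k)"
    have "0 = lie_bracket t (\<Sum>k\<in>insert j F. x k) - scaleC (w j t) (\<Sum>k\<in>insert j F. x k)"
      unfolding insert.prems(3) by simp
    also have "\<dots> = (\<Sum>k\<in>insert j F. lie_bracket t (x k) - scaleC (w j t) (x k))"
      by (simp only: ad.sum lie.scale_sum_right sum_subtractf)
    also have "\<dots> = (\<Sum>k\<in>insert j F. ?y k)"
      by (rule sum.cong) (use insert.prems(1) t in \<open>auto simp: lie.scale_left_diff_distrib\<close>)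
    also have "\<dots> = (\<Sum>k\<in>F. ?y k)"
      using insert.hyps by simp
    finally have "?y i = 0"
      by (intro insert.IH[of ?y i]) (use insert.prems that in \<open>auto simp: ad.scale lie.scale_left_commute\<close>)
    then show ?thesis using t by simp
  qed
  then have "x j = 0" using insert.prems(3) insert.hyps by simp
  then show ?case using F0 insert.prems(4) by auto
qed

text \<open>A joint eigenvector of \<open>T\<close> is a sum of eigenvectors of \<open>ad t\<close>. These are again joint eigenvectors
  of \<open>T\<close>: the operators commute, so \<open>ad s\<close> minus its eigenvalue maps the summands to eigenvectors of
  \<open>ad t\<close> with the same distinct eigenvalues and with sum 0, hence to 0.\<close>

lemma simultaneous_diagonalization:
  fixes T :: "'g::complex_lie_algebra set"
  assumes "finite T" "\<And>t. t \<in> T \<Longrightarrow> diagonalizable (lie_bracket t)"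
    and "\<And>s t. s \<in> T \<Longrightarrow> t \<in> T \<Longrightarrow> lie_bracket s t = 0"
  shows "lie.span {x. \<forall>t\<in>T. \<exists>c. lie_bracket t x = scaleC c x} = UNIV"
  using assms
proof (induction T rule: finite_induct)
  case empty
  then show ?case by simp
next
  case (insert t T)
  let ?J = "\<lambda>T. {x. \<forall>t\<in>T. \<exists>c. lie_bracket t x = scaleC c x}"
  have "?J T \<subseteq> lie.span (?J (insert t T))"
  proof
    fix x assume x: "x \<in> ?J T"
    let ?V = "\<lambda>c. {y. lie_bracket t y = scaleC c y}"
    have V: "lie.subspace (?V c)" for c
      by (auto simp: lie.subspace_def ad.add ad.scale lie.scale_right_distrib lie.scale_left_commute)
    have "(\<Union>c\<in>UNIV. ?V c) = {x. \<exists>c. lie_bracket t x = scaleC c x}" by auto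
    then have "x \<in> lie.span (\<Union>c\<in>UNIV. ?V c)"
      using insert.prems(1)[of t] by (simp add: diagonalizable_def)
    from span_UN_subspaces[of ?V, OF V this]
    obtain F y where F: "finite F" and y: "\<And>c. y c \<in> ?V c" and xsum: "x = (\<Sum>c\<in>F. y c)" by blast
    have "y c \<in> ?J (insert t T)" if c: "c \<in> F" for c
    proof -
      have "\<exists>c'. lie_bracket s (y c) = scaleC c' (y c)" if s: "s \<in> T" for s
      proof -
        obtain d where d: "lie_bracket s x = scaleC d x" using x s by auto
        let ?z = "\<lambda>c. lie_bracket s (y c) - scaleC d (y c)"
        have "lie_bracket t s = 0" using insert.prems(2) s by blast
        then have comm: "lie_bracket t (lie_bracket s u) = lie_bracket s (lie_bracket t u)" for u
          using lie_bracket_derivation[of t s u] by simp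
        have "?z c = 0"
        proof (rule joint_eigenvectors_sum_zero[where F = F and T = "{t}" and w = "\<lambda>c _. c"])
          show "(\<Sum>c\<in>F. ?z c) = 0"
            using d by (simp add: xsum ad.sum lie.scale_sum_right sum_subtractf)
          show "lie_bracket u (?z i) = scaleC i (?z i)" if "u \<in> {t}" for i u
            using that y[of i]
            by (simp add: ad.diff ad.scale comm lie.scale_right_diff_distrib lie.scale_left_commute)
        qed (use F c in auto)
        then show ?thesis by auto
      qed
      then show ?thesis using y[of c] by auto
    qed
    then show "x \<in> lie.span (?J (insert t T))"
      unfolding xsum by (intro lie.span_sum lie.span_base)
  qed
  then have "lie.span (?J T) \<subseteq> lie.span (?J (insert t T))"
    by (rule lie.span_minimal) simp
  then show ?case using insert by auto
qed

section \<open>Root spaces\<close>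

lemma subspace_dual_space: "fun_space.subspace (dual_space h)"
  by (auto simp: fun_space.subspace_def dual_space_def linear_form_on_def fun_scale_def algebra_simps)

lemmas dual_space_0 = fun_space.subspace_0[OF subspace_dual_space]
  and dual_space_add = fun_space.subspace_add[OF subspace_dual_space]
  and dual_space_scale = fun_space.subspace_scale[OF subspace_dual_space]

lemma dual_space_eqI:
  assumes "\<alpha> \<in> dual_space h" "\<beta> \<in> dual_space h" "\<And>t. t \<in> h \<Longrightarrow> \<alpha> t = \<beta> t"
  shows "\<alpha> = \<beta>"
proof
  fix t show "\<alpha> t = \<beta> t" using assms by (cases "t \<in> h") (auto simp: dual_space_def)
qed

lemma root_spaceD: "x \<in> root_space h \<alpha> \<Longrightarrow> t \<in> h \<Longrightarrow> lie_bracket t x = scaleC (\<alpha> t) x"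
  by (simp add: root_space_def)

lemma subspace_root_space: "lie.subspace (root_space h \<alpha>)"
  by (auto simp: lie.subspace_def root_space_def ad.add ad.scale lie.scale_right_distrib
      lie.scale_left_commute)

lemma root_space_bracket:
  assumes "x \<in> root_space h \<alpha>" "y \<in> root_space h \<beta>"
  shows "lie_bracket x y \<in> root_space h (\<alpha> + \<beta>)"
  using assms
  by (auto simp: root_space_def lie_bracket_derivation[of _ x y] ad.scale ad_left.scale
      lie.scale_left_distrib)

locale lie_root_vectors =
  fixes h :: "'g::complex_lie_algebra set" and P :: "('g \<Rightarrow> complex) set" and E :: "('g \<Rightarrow> complex) \<Rightarrow> 'g"
  assumes simple: "simple_lie_algebra TYPE('g)"
    and cartan: "cartan_subalgebra h"
    and positive: "positive_system (roots h) P"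
    and root_vectors: "\<And>\<alpha>. \<alpha> \<in> roots h \<Longrightarrow> E \<alpha> \<in> root_space h \<alpha>"
    and normalized: "\<And>\<alpha>. \<alpha> \<in> P \<Longrightarrow> killing (E \<alpha>) (E (- \<alpha>)) = 1"
begin

abbreviation R :: "('g \<Rightarrow> complex) set" where "R \<equiv> roots h"

lemma finite_dim: "finite_dim TYPE('g)"
  using simple by (auto simp: simple_lie_algebra_def finite_dim_def)

lemmas killing_comm = killing_commute[OF finite_dim]
  and killing_inv = killing_invariant[OF finite_dim]

lemma h_subspace: "lie.subspace h" and h_abelian: "s \<in> h \<Longrightarrow> t \<in> h \<Longrightarrow> lie_bracket s t = 0"
  and h_maximal: "lie_subalgebra S \<Longrightarrow> abelian S \<Longrightarrow> h \<subseteq> S \<Longrightarrow> S = h"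
  and h_diagonalizable: "t \<in> h \<Longrightarrow> diagonalizable (lie_bracket t)"
  using cartan by (auto simp: cartan_subalgebra_def lie_subalgebra_def abelian_def)

text \<open>Otherwise \<open>h\<close> and \<open>x\<close> would span a larger abelian subalgebra.\<close>

lemma centralizer_h:
  assumes "\<And>t. t \<in> h \<Longrightarrow> lie_bracket t x = 0"
  shows "x \<in> h"
proof -
  let ?S = "{y. \<exists>t\<in>h. \<exists>c. y = t + scaleC c x}"
  have comm: "lie_bracket y z = 0" if yz: "y \<in> ?S" "z \<in> ?S" for y z
  proof -
    obtain s c t d where st: "s \<in> h" "t \<in> h" and y: "y = s + scaleC c x" and z: "z = t + scaleC d x"
      using yz by blast
    have "lie_bracket x t = 0" using assms[OF st(2)] lie_bracket_anticomm[of t x] by simp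
    then show ?thesis
      using assms st by (simp add: y z ad.add ad_left.add ad.scale ad_left.scale h_abelian lie_bracket_self)
  qed
  have "lie.subspace ?S"
  proof (rule lie.subspaceI)
    show "0 \<in> ?S" using lie.subspace_0[OF h_subspace] by (auto intro!: exI[of _ 0] bexI[of _ 0])
  next
    fix y z assume "y \<in> ?S" "z \<in> ?S"
    then obtain s c t d where st: "s \<in> h" "t \<in> h" and y: "y = s + scaleC c x" and z: "z = t + scaleC d x"
      by blast
    have "y + z = (s + t) + scaleC (c + d) x" by (simp add: y z lie.scale_left_distrib)
    then show "y + z \<in> ?S" using lie.subspace_add[OF h_subspace st] by blast
  next
    fix a y assume "y \<in> ?S"
    then obtain s c where s: "s \<in> h" and y: "y = s + scaleC c x" by blast
    have "scaleC a y = scaleC a s + scaleC (a * c) x" by (simp add: y lie.scale_right_distrib)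
    then show "scaleC a y \<in> ?S" using lie.subspace_scale[OF h_subspace s] by blast
  qed
  have "lie_bracket y z \<in> ?S" if "y \<in> ?S" "z \<in> ?S" for y z
    unfolding comm[OF that] by (rule lie.subspace_0) fact
  with \<open>lie.subspace ?S\<close> have "lie_subalgebra ?S"
    unfolding lie_subalgebra_def by (intro conjI ballI)
  moreover have "abelian ?S"
    unfolding abelian_def by (intro ballI comm)
  moreover have "h \<subseteq> ?S" by (auto intro!: exI[of _ 0])
  ultimately have "?S = h" by (rule h_maximal)
  moreover have "x \<in> ?S"
    using lie.subspace_0[OF h_subspace] by (auto intro!: bexI[of _ 0] exI[of _ 1])
  ultimately show ?thesis by blast
qed

lemma root_space_0: "root_space h 0 = h"
  by (auto simp: root_space_def h_abelian intro: centralizer_h)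

lemma roots_dual: "\<alpha> \<in> R \<Longrightarrow> \<alpha> \<in> dual_space h" and roots_nonzero: "\<alpha> \<in> R \<Longrightarrow> \<alpha> \<noteq> 0"
  by (auto simp: roots_def)

lemma rootI: "\<alpha> \<in> dual_space h \<Longrightarrow> \<alpha> \<noteq> 0 \<Longrightarrow> x \<in> root_space h \<alpha> \<Longrightarrow> x \<noteq> 0 \<Longrightarrow> \<alpha> \<in> R"
  unfolding roots_def by auto

lemma weights_separated:
  assumes "\<alpha> \<in> dual_space h" "\<beta> \<in> dual_space h" "\<alpha> \<noteq> \<beta>"
  shows "\<exists>t\<in>h. \<alpha> t \<noteq> \<beta> t"
  using assms dual_space_eqI by blast

text \<open>A basis of \<open>h\<close> is diagonalized simultaneously, and the eigenvalues on a nonzero joint eigenvector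
  form a linear function on \<open>h\<close>.\<close>

lemma weight_decomposition:
  "\<exists>F y. finite F \<and> F \<subseteq> dual_space h \<and> (\<forall>\<alpha>. y \<alpha> \<in> root_space h \<alpha>) \<and> x = (\<Sum>\<alpha>\<in>F. y \<alpha>)"
proof -
  obtain H where H: "H \<subseteq> h" "lie.independent H" "h \<subseteq> lie.span H"
    using lie.maximal_independent_subset[of h] by blast
  have finH: "finite H" by (rule finite_independent[OF finite_dim H(2)])
  have "{x. \<forall>t\<in>H. \<exists>c. lie_bracket t x = scaleC c x} \<subseteq> (\<Union>\<alpha>\<in>dual_space h. root_space h \<alpha>)"
  proof
    fix x assume x: "x \<in> {x. \<forall>t\<in>H. \<exists>c. lie_bracket t x = scaleC c x}"
    show "x \<in> (\<Union>\<alpha>\<in>dual_space h. root_space h \<alpha>)"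
    proof (cases "x = 0")
      case True
      have "0 \<in> dual_space h" by (simp add: dual_space_def linear_form_on_def)
      then show ?thesis using True lie.subspace_0[OF subspace_root_space[of h 0]] by blast
    next
      case False
      let ?U = "{t. \<exists>c. lie_bracket t x = scaleC c x}"
      have U: "lie.subspace ?U"
      proof (rule lie.subspaceI)
        show "0 \<in> ?U" by (auto intro!: exI[of _ 0])
        show "a + b \<in> ?U" if "a \<in> ?U" "b \<in> ?U" for a b
          using that by (auto simp: ad_left.add lie.scale_left_distrib[symmetric])
        show "scaleC c a \<in> ?U" if "a \<in> ?U" for c a
          using that by (auto simp: ad_left.scale)
      qed
      have "H \<subseteq> ?U" using x by auto
      then have "h \<subseteq> ?U" using H(3) lie.span_minimal[OF _ U] by blast
      then have "\<forall>t\<in>h. \<exists>c. lie_bracket t x = scaleC c x" by blast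
      then obtain w where w: "\<And>t. t \<in> h \<Longrightarrow> lie_bracket t x = scaleC (w t) x" by metis
      define \<alpha> where "\<alpha> = (\<lambda>t. if t \<in> h then w t else 0)"
      have \<alpha>: "lie_bracket t x = scaleC (\<alpha> t) x" if "t \<in> h" for t using w that by (simp add: \<alpha>_def)
      have "\<alpha> (s + t) = \<alpha> s + \<alpha> t" if "s \<in> h" "t \<in> h" for s t
      proof -
        have "scaleC (\<alpha> (s + t)) x = scaleC (\<alpha> s + \<alpha> t) x"
          using that lie.subspace_add[OF h_subspace that]
          by (simp add: \<alpha>[symmetric] ad_left.add lie.scale_left_distrib)
        then show ?thesis using False by simp
      qed
      moreover have "\<alpha> (scaleC c t) = c * \<alpha> t" if "t \<in> h" for c t
      proof -
        have "scaleC (\<alpha> (scaleC c t)) x = scaleC (c * \<alpha> t) x"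
          using that lie.subspace_scale[OF h_subspace that]
          by (simp only: \<alpha>[symmetric] ad_left.scale lie.scale_scale[symmetric])
        then show ?thesis using False by simp
      qed
      ultimately have "\<alpha> \<in> dual_space h"
        by (auto simp: dual_space_def linear_form_on_def) (simp add: \<alpha>_def)
      moreover have "x \<in> root_space h \<alpha>" using \<alpha> by (simp add: root_space_def)
      ultimately show ?thesis by blast
    qed
  qed
  then have "UNIV \<subseteq> lie.span (\<Union>\<alpha>\<in>dual_space h. root_space h \<alpha>)"
    using simultaneous_diagonalization[of H] finH H(1) h_diagonalizable h_abelian
      lie.span_mono by (metis (no_types, lifting) subset_iff)
  then have "x \<in> lie.span (\<Union>\<alpha>\<in>dual_space h. root_space h \<alpha>)" by blast
  from span_UN_subspaces[of "root_space h", OF subspace_root_space this] show ?thesis by metis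
qed

lemma R_union: "R = P \<union> uminus ` P" and P_disjoint: "P \<inter> uminus ` P = {}"
  and P_closed: "\<alpha> \<in> P \<Longrightarrow> \<beta> \<in> P \<Longrightarrow> \<alpha> + \<beta> \<in> R \<Longrightarrow> \<alpha> + \<beta> \<in> P"
  using positive by (auto simp: positive_system_def)

lemma P_subset: "\<alpha> \<in> P \<Longrightarrow> \<alpha> \<in> R" using R_union by blast

lemma R_neg: "\<alpha> \<in> R \<Longrightarrow> - \<alpha> \<in> R" using R_union by auto

lemma R_cases: "\<alpha> \<in> R \<Longrightarrow> \<alpha> \<in> P \<or> - \<alpha> \<in> P" using R_union by auto

lemma P_not_neg: "\<alpha> \<in> P \<Longrightarrow> - \<alpha> \<notin> P" using P_disjoint by force

lemma killing_E: "\<alpha> \<in> R \<Longrightarrow> killing (E \<alpha>) (E (- \<alpha>)) = 1"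
  using R_cases[of \<alpha>] normalized[of \<alpha>] normalized[of "- \<alpha>"] killing_comm by auto

lemma E_nonzero: "\<alpha> \<in> R \<Longrightarrow> E \<alpha> \<noteq> 0"
  using killing_E by force

lemma E_independent: "inj_on E R" "lie.independent (E ` R)"
proof -
  show inj: "inj_on E R"
  proof (rule inj_onI, rule ccontr)
    fix \<alpha> \<beta> assume ab: "\<alpha> \<in> R" "\<beta> \<in> R" "E \<alpha> = E \<beta>" "\<alpha> \<noteq> \<beta>"
    then obtain t where t: "t \<in> h" "\<alpha> t \<noteq> \<beta> t" using weights_separated roots_dual by blast
    have "scaleC (\<alpha> t) (E \<alpha>) = scaleC (\<beta> t) (E \<alpha>)"
      using ab t root_vectors by (metis root_spaceD)
    then show False using t E_nonzero ab by simp
  qed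
  show "lie.independent (E ` R)"
    unfolding lie.independent_explicit_finite_subsets
  proof (intro allI impI ballI)
    fix S u v assume S: "S \<subseteq> E ` R" "finite S" "(\<Sum>v\<in>S. scaleC (u v) v) = 0" "v \<in> S"
    then obtain F where F: "F \<subseteq> R" "S = E ` F" unfolding subset_image_iff by blast
    have injF: "inj_on E F" using inj F(1) inj_on_subset by blast
    have finF: "finite F" using S(2) F(2) finite_image_iff[OF injF] by simp
    have "scaleC (u (E \<alpha>)) (E \<alpha>) = 0" if "\<alpha> \<in> F" for \<alpha>
    proof (rule joint_eigenvectors_sum_zero[where F = F and T = h and w = "\<lambda>\<alpha>. \<alpha>"
          and x = "\<lambda>\<alpha>. scaleC (u (E \<alpha>)) (E \<alpha>)"])
      show "\<exists>t\<in>h. \<alpha> t \<noteq> \<beta> t" if "\<alpha> \<in> F" "\<beta> \<in> F" "\<alpha> \<noteq> \<beta>" for \<alpha> \<beta>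
        using that weights_separated roots_dual F by blast
      show "lie_bracket t (scaleC (u (E \<alpha>)) (E \<alpha>)) = scaleC (\<alpha> t) (scaleC (u (E \<alpha>)) (E \<alpha>))"
        if "\<alpha> \<in> F" "t \<in> h" for \<alpha> t
        using that F(1) root_spaceD[OF root_vectors, of \<alpha> t] by (auto simp: ad.scale lie.scale_left_commute)
      show "(\<Sum>\<alpha>\<in>F. scaleC (u (E \<alpha>)) (E \<alpha>)) = 0"
        using S(3) by (simp add: F(2) sum.reindex[OF injF])
    qed (use finF that in auto)
    then show "u v = 0" using S(4) F E_nonzero by auto
  qed
qed

lemma finite_R: "finite R"
  using finite_independent[OF finite_dim E_independent(2)] finite_image_iff[OF E_independent(1)] by simp

lemma finite_P: "finite P"
  using finite_R R_union by simp

lemma P_nonempty: "P \<noteq> {}"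
proof
  assume "P = {}"
  then have "R = {}" using R_union by simp
  have "x \<in> h" for x
  proof -
    obtain F y where F: "finite F" "F \<subseteq> dual_space h" "\<And>\<alpha>. y \<alpha> \<in> root_space h \<alpha>" "x = (\<Sum>\<alpha>\<in>F. y \<alpha>)"
      using weight_decomposition[of x] by metis
    have "y \<alpha> \<in> h" if "\<alpha> \<in> F" for \<alpha>
      using that F rootI[of \<alpha> "y \<alpha>"] \<open>R = {}\<close> root_space_0 lie.subspace_0[OF h_subspace]
      by (metis empty_iff subsetD)
    then show ?thesis unfolding F(4) by (intro lie.subspace_sum h_subspace)
  qed
  then have "abelian (UNIV :: 'g set)" using h_abelian by (simp add: abelian_def)
  then show False using simple by (simp add: simple_lie_algebra_def)
qed

text \<open>The radical of the Killing form is an ideal. It is not everything, because the normalization of the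
  root vectors makes the form nonzero. So it is 0.\<close>

lemma killing_nondegenerate:
  assumes "\<And>y. killing x y = 0"
  shows "x = (0 :: 'g)"
proof -
  let ?N = "{x::'g. \<forall>y. killing x y = 0}"
  have "lie_ideal ?N"
    unfolding lie_ideal_def
  proof (intro conjI allI ballI)
    show "lie.subspace ?N"
      by (auto simp: lie.subspace_def killing_add_left killing_scale_left)
    fix x y assume "y \<in> ?N"
    then have "killing (lie_bracket y x) z = 0" for z by (simp add: killing_inv)
    then show "lie_bracket x y \<in> ?N" by (subst lie_bracket_anticomm) simp
  qed
  moreover have "?N \<noteq> UNIV"
    using P_nonempty normalized zero_neq_one by (metis (mono_tags, lifting) UNIV_I all_not_in_conv mem_Collect_eq)
  ultimately have "?N = {0}"
    using simple unfolding simple_lie_algebra_def by blast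
  moreover have "x \<in> ?N" using assms by simp
  ultimately show ?thesis by (simp only: singleton_iff)
qed

lemma killing_orthogonal:
  assumes "x \<in> root_space h \<alpha>" "y \<in> root_space h \<beta>" "\<alpha> \<in> dual_space h" "\<beta> \<in> dual_space h" "\<alpha> + \<beta> \<noteq> 0"
  shows "killing x y = 0"
proof -
  obtain t where t: "t \<in> h" "(\<alpha> + \<beta>) t \<noteq> (0 :: 'g \<Rightarrow> complex) t"
    using weights_separated[of "\<alpha> + \<beta>" 0] dual_space_0 dual_space_add assms(3-5) by blast
  have "killing (lie_bracket t x) y = - killing (lie_bracket x t) y"
    by (subst lie_bracket_anticomm) simp
  then have "\<alpha> t * killing x y = - (\<beta> t * killing x y)"
    using t assms(1,2) by (simp add: killing_inv root_spaceD killing_scale_left killing_scale_right)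
  then have "(\<alpha> + \<beta>) t * killing x y = 0" by (simp add: algebra_simps)
  then show ?thesis using t by simp
qed

lemma killing_pairs_opposite_weights:
  assumes x: "x \<in> root_space h \<alpha>" "\<alpha> \<in> dual_space h" and "\<And>y. y \<in> root_space h (- \<alpha>) \<Longrightarrow> killing x y = 0"
  shows "x = 0"
proof (rule killing_nondegenerate)
  fix z
  obtain F y where F: "finite F" "F \<subseteq> dual_space h" "\<And>\<beta>. y \<beta> \<in> root_space h \<beta>" "z = (\<Sum>\<beta>\<in>F. y \<beta>)"
    using weight_decomposition[of z] by metis
  have "killing x (y \<beta>) = 0" if "\<beta> \<in> F" for \<beta>
  proof (cases "\<alpha> + \<beta> = 0")
    case True
    then have "\<beta> = - \<alpha>" by (simp add: eq_neg_iff_add_eq_0 add.commute)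
    then show ?thesis using assms(3)[of "y \<beta>"] F(3)[of \<beta>] by simp
  next
    case False
    then show ?thesis using killing_orthogonal[OF x(1) F(3)[of \<beta>] x(2)] F(2) that by blast
  qed
  then show "killing x z = 0" by (simp add: F(4) killing_sum)
qed

lemma h_nondegenerate:
  assumes "t \<in> h" "\<And>s. s \<in> h \<Longrightarrow> killing t s = 0"
  shows "t = 0"
  by (rule killing_pairs_opposite_weights[of t 0])
    (use assms root_space_0 in \<open>auto simp: dual_space_def linear_form_on_def\<close>)


section \<open>Strings of roots\<close>

text \<open>The element of \<open>h\<close> that represents \<open>\<alpha>\<close> with respect to the Killing form. So \<open>\<alpha> (T \<beta>)\<close> is the
  scalar product of \<open>\<alpha>\<close> and \<open>\<beta>\<close>.\<close>

definition T :: "('g \<Rightarrow> complex) \<Rightarrow> 'g" where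
  "T \<alpha> = lie_bracket (E \<alpha>) (E (- \<alpha>))"

lemma T_in_h: "\<alpha> \<in> R \<Longrightarrow> T \<alpha> \<in> h"
  using root_space_bracket[OF root_vectors root_vectors, of \<alpha> "- \<alpha>"] R_neg
  by (simp add: T_def root_space_0)

lemma killing_T: "\<alpha> \<in> R \<Longrightarrow> t \<in> h \<Longrightarrow> killing (T \<alpha>) t = \<alpha> t"
proof -
  assume a: "\<alpha> \<in> R" "t \<in> h"
  have "lie_bracket (E (- \<alpha>)) t = scaleC (\<alpha> t) (E (- \<alpha>))"
    using root_spaceD[OF root_vectors[OF R_neg[OF a(1)]] a(2)] lie_bracket_anticomm[of "E (- \<alpha>)" t]
    by (simp add: lie.scale_minus_left)
  then show ?thesis by (simp add: T_def killing_inv killing_scale_right killing_E a)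
qed

lemma T_symmetric: "\<alpha> \<in> R \<Longrightarrow> \<beta> \<in> R \<Longrightarrow> \<alpha> (T \<beta>) = \<beta> (T \<alpha>)"
  by (metis killing_T killing_comm T_in_h)

text \<open>There are only finitely many roots, so a string of weight vectors in the direction of a root
  cannot go on for ever.\<close>

lemma infinite_weights_absurd:
  assumes \<alpha>: "\<alpha> \<in> R" and \<mu>: "\<mu> \<in> dual_space h" and "s \<noteq> 0"
    and z: "\<And>k. z k \<in> root_space h (\<mu> + fun_scale (s * of_nat k) \<alpha>)" "\<And>k. z k \<noteq> 0"
  shows False
proof -
  let ?f = "\<lambda>k. \<mu> + fun_scale (s * of_nat k) \<alpha>"
  have "?f k \<in> insert 0 R" for k
    using rootI[OF dual_space_add[OF \<mu> dual_space_scale[OF roots_dual[OF \<alpha>]]] _ z] by blast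
  then have "range ?f \<subseteq> insert 0 R" by blast
  then have "finite (range ?f)" using finite_R by (meson finite_insert finite_subset)
  moreover have "inj ?f"
  proof (rule injI)
    fix k l assume "?f k = ?f l"
    then have "fun_scale (s * of_nat k) \<alpha> = fun_scale (s * of_nat l) \<alpha>" by simp
    then show "k = l" using roots_nonzero[OF \<alpha>] \<open>s \<noteq> 0\<close> by (simp del: of_nat_mult)
  qed
  ultimately show False using finite_imageD by blast
qed

text \<open>The highest weight of a finite-dimensional representation of \<open>sl\<^sub>2\<close> is a natural number:
  otherwise \<open>E (- \<alpha>)\<close> could be applied to \<open>u\<close> again and again without giving 0. In this form, without
  a division by \<open>\<alpha> (T \<alpha>)\<close>, the fact also serves to prove that \<open>\<alpha> (T \<alpha>)\<close> is not 0.\<close>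

lemma highest_weight:
  assumes \<alpha>: "\<alpha> \<in> R" and \<mu>: "\<mu> \<in> dual_space h" and u: "u \<in> root_space h \<mu>" "u \<noteq> 0"
    and top: "lie_bracket (E \<alpha>) u = 0"
  shows "\<exists>k::nat. 2 * \<mu> (T \<alpha>) = of_nat k * \<alpha> (T \<alpha>)"
proof (rule ccontr)
  assume neg: "\<not> ?thesis"
  define z where "z k = (lie_bracket (E (- \<alpha>)) ^^ k) u" for k
  have z_Suc: "z (Suc k) = lie_bracket (E (- \<alpha>)) (z k)" for k by (simp add: z_def)
  have z_weight: "z k \<in> root_space h (\<mu> + fun_scale (-1 * of_nat k) \<alpha>)" for k
  proof (induction k)
    case 0
    show ?case using u by (simp add: z_def)
  next
    case (Suc k)
    have "- \<alpha> + (\<mu> + fun_scale (-1 * of_nat k) \<alpha>) = \<mu> + fun_scale (-1 * of_nat (Suc k)) \<alpha>"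
      by (simp add: fun_eq_iff fun_scale_def algebra_simps)
    then show ?case
      using root_space_bracket[OF root_vectors[OF R_neg[OF \<alpha>]] Suc] by (simp only: z_Suc)
  qed
  let ?m = "\<mu> (T \<alpha>)" and ?a = "\<alpha> (T \<alpha>)"
  have raise: "lie_bracket (E \<alpha>) (z (Suc k)) =
      scaleC (of_nat (Suc k) * (?m - of_nat k / 2 * ?a)) (z k)" for k
  proof (induction k)
    case 0
    show ?case
      using root_spaceD[OF u(1) T_in_h[OF \<alpha>]] top
      by (simp add: z_def lie_bracket_derivation[of "E \<alpha>" "E (- \<alpha>)" u] flip: T_def)
  next
    case (Suc k)
    have "lie_bracket (T \<alpha>) (z (Suc k)) = scaleC (?m - of_nat (Suc k) * ?a) (z (Suc k))"
      using root_spaceD[OF z_weight T_in_h[OF \<alpha>], of "Suc k"]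
      by (simp add: fun_scale_def algebra_simps)
    moreover have "lie_bracket (E \<alpha>) (z (Suc (Suc k))) =
        lie_bracket (T \<alpha>) (z (Suc k)) + lie_bracket (E (- \<alpha>)) (lie_bracket (E \<alpha>) (z (Suc k)))"
      by (simp only: z_Suc[of "Suc k"] lie_bracket_derivation[of "E \<alpha>" "E (- \<alpha>)"] T_def)
    ultimately have "lie_bracket (E \<alpha>) (z (Suc (Suc k))) =
        scaleC ((?m - of_nat (Suc k) * ?a) + of_nat (Suc k) * (?m - of_nat k / 2 * ?a)) (z (Suc k))"
      by (simp only: Suc ad.scale z_Suc[of k, symmetric] lie.scale_left_distrib)
    also have "(?m - of_nat (Suc k) * ?a) + of_nat (Suc k) * (?m - of_nat k / 2 * ?a) =
        of_nat (Suc (Suc k)) * (?m - of_nat (Suc k) / 2 * ?a)"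
      by (simp add: field_simps)
    finally show ?case .
  qed
  have "z k \<noteq> 0" for k
  proof (induction k)
    case 0
    show ?case using u by (simp add: z_def)
  next
    case (Suc k)
    have "2 * ?m \<noteq> of_nat k * ?a" using neg by blast
    then have "?m - of_nat k / 2 * ?a \<noteq> 0" by (simp add: field_simps)
    then have "lie_bracket (E \<alpha>) (z (Suc k)) \<noteq> 0"
      unfolding raise using Suc by (simp del: of_nat_Suc)
    then show ?case by auto
  qed
  then show False using infinite_weights_absurd[OF \<alpha> \<mu> _ z_weight] by simp
qed

text \<open>The last nonzero vector among the \<open>(ad (E \<alpha>))^m u\<close> is a highest weight vector.\<close>

lemma weight_multiple:
  assumes \<alpha>: "\<alpha> \<in> R" and \<mu>: "\<mu> \<in> dual_space h" and u: "u \<in> root_space h \<mu>" "u \<noteq> 0"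
  shows "\<exists>q::real. \<mu> (T \<alpha>) = of_real q * \<alpha> (T \<alpha>)"
proof -
  define z where "z k = (lie_bracket (E \<alpha>) ^^ k) u" for k
  have z_Suc: "z (Suc k) = lie_bracket (E \<alpha>) (z k)" for k by (simp add: z_def)
  have z_weight: "z k \<in> root_space h (\<mu> + fun_scale (1 * of_nat k) \<alpha>)" for k
  proof (induction k)
    case 0
    show ?case using u by (simp add: z_def)
  next
    case (Suc k)
    have "\<alpha> + (\<mu> + fun_scale (1 * of_nat k) \<alpha>) = \<mu> + fun_scale (1 * of_nat (Suc k)) \<alpha>"
      by (simp add: fun_eq_iff fun_scale_def algebra_simps)
    then show ?case
      using root_space_bracket[OF root_vectors[OF \<alpha>] Suc] by (simp only: z_Suc)
  qed
  have "\<exists>k. z k \<noteq> 0 \<and> z (Suc k) = 0"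
  proof (rule ccontr)
    assume neg: "\<not> ?thesis"
    have "z k \<noteq> 0" for k
      by (induction k) (use u neg in \<open>auto simp: z_def\<close>)
    then show False using infinite_weights_absurd[OF \<alpha> \<mu> _ z_weight] by simp
  qed
  then obtain m where m: "z m \<noteq> 0" "z (Suc m) = 0" by blast
  have "\<mu> + fun_scale (1 * of_nat m) \<alpha> \<in> dual_space h"
    by (rule dual_space_add[OF \<mu> dual_space_scale[OF roots_dual[OF \<alpha>]]])
  from highest_weight[OF \<alpha> this z_weight m(1)] m(2)
  obtain k :: nat where "2 * (\<mu> (T \<alpha>) + of_nat m * \<alpha> (T \<alpha>)) = of_nat k * \<alpha> (T \<alpha>)"
    by (auto simp: z_Suc fun_scale_def)
  then have "\<mu> (T \<alpha>) = of_real (of_nat k / 2 - of_nat m) * \<alpha> (T \<alpha>)"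
    by (simp add: field_simps)
  then show ?thesis ..
qed

text \<open>If \<open>\<alpha> (T \<alpha>) = 0\<close>, then all weights vanish at \<open>T \<alpha>\<close>, and \<open>T \<alpha>\<close> is central.\<close>

lemma T_nonisotropic:
  assumes \<alpha>: "\<alpha> \<in> R"
  shows "\<alpha> (T \<alpha>) \<noteq> 0"
proof
  assume iso: "\<alpha> (T \<alpha>) = 0"
  have "lie_bracket (T \<alpha>) x = 0" for x
  proof -
    obtain F y where F: "finite F" "F \<subseteq> dual_space h" "\<And>\<beta>. y \<beta> \<in> root_space h \<beta>" "x = (\<Sum>\<beta>\<in>F. y \<beta>)"
      using weight_decomposition[of x] by metis
    have "lie_bracket (T \<alpha>) (y \<beta>) = 0" if "\<beta> \<in> F" for \<beta>
      using weight_multiple[OF \<alpha>, of \<beta> "y \<beta>"] F that iso root_spaceD[OF F(3) T_in_h[OF \<alpha>]] by fastforce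
    then show ?thesis by (simp add: F(4) ad.sum)
  qed
  then have "killing (T \<alpha>) y = 0" for y
    by (simp add: killing_def o_def lie_trace_def lie.representation_zero)
  then have "T \<alpha> = 0" by (rule killing_nondegenerate)
  then have "\<alpha> = 0"
    using killing_T[OF \<alpha>] by (intro dual_space_eqI[OF roots_dual[OF \<alpha>]])
      (auto simp: dual_space_def linear_form_on_def)
  then show False using roots_nonzero[OF \<alpha>] by simp
qed

text \<open>A vector of weight \<open>\<alpha>\<close> that is orthogonal to \<open>E (- \<alpha>)\<close> commutes with \<open>E (- \<alpha>)\<close>. It would be a
  highest weight vector for the root \<open>- \<alpha>\<close> with a negative weight.\<close>

lemma root_space_one_dim:
  assumes \<alpha>: "\<alpha> \<in> R" and z: "z \<in> root_space h \<alpha>"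
  shows "z = scaleC (killing z (E (- \<alpha>))) (E \<alpha>)"
proof (rule ccontr)
  assume ne: "\<not> ?thesis"
  define x where "x = z - scaleC (killing z (E (- \<alpha>))) (E \<alpha>)"
  have x: "x \<in> root_space h \<alpha>" "x \<noteq> 0" "killing x (E (- \<alpha>)) = 0"
    using ne z root_vectors[OF \<alpha>] unfolding x_def
    by (auto simp: killing_diff killing_scale_left killing_E[OF \<alpha>]
        intro!: lie.subspace_diff lie.subspace_scale subspace_root_space)
  have "lie_bracket (E (- \<alpha>)) x = 0"
  proof (rule h_nondegenerate)
    show "lie_bracket (E (- \<alpha>)) x \<in> h"
      using root_space_bracket[OF root_vectors[OF R_neg[OF \<alpha>]] x(1)] by (simp add: root_space_0)
    fix s assume s: "s \<in> h"
    have "lie_bracket x s = scaleC (- \<alpha> s) x"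
      using root_spaceD[OF x(1) s] lie_bracket_anticomm[of x s] by (simp add: lie.scale_minus_left)
    then show "killing (lie_bracket (E (- \<alpha>)) x) s = 0"
      using x(3) by (simp add: killing_inv killing_scale_right killing_comm[of "E (- \<alpha>)"])
  qed
  from highest_weight[OF R_neg[OF \<alpha>] roots_dual[OF \<alpha>] x(1,2) this]
  obtain k :: nat where "2 * \<alpha> (T (- \<alpha>)) = of_nat k * (- \<alpha>) (T (- \<alpha>))" by blast
  moreover have neg: "\<alpha> (T (- \<alpha>)) = - \<alpha> (T \<alpha>)"
    using T_symmetric[OF \<alpha> R_neg[OF \<alpha>]] by simp
  ultimately have "(2 + of_nat k) * \<alpha> (T \<alpha>) = 0"
    by (simp add: distrib_right) (metis add.right_inverse)
  moreover have "(2 + of_nat k :: complex) \<noteq> 0"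
    using of_nat_eq_0_iff[of "2 + k", where ?'a = complex] by simp
  ultimately show False using T_nonisotropic[OF \<alpha>] by simp
qed

lemma root_space_expansion:
  obtains t where "t \<in> h" "x = t + (\<Sum>\<alpha>\<in>R. scaleC (killing x (E (- \<alpha>))) (E \<alpha>))"
proof -
  let ?t = "x - (\<Sum>\<alpha>\<in>R. scaleC (killing x (E (- \<alpha>))) (E \<alpha>))"
  obtain F y where F: "finite F" "F \<subseteq> dual_space h" "\<And>\<beta>. y \<beta> \<in> root_space h \<beta>" "x = (\<Sum>\<beta>\<in>F. y \<beta>)"
    using weight_decomposition[of x] by metis
  have 1: "y \<beta> \<in> h" if "\<beta> \<in> F - R" for \<beta>
    using that F rootI[of \<beta> "y \<beta>"] root_space_0 lie.subspace_0[OF h_subspace]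
    by (metis Diff_iff subsetD)
  have 2: "killing x (E (- \<alpha>)) = (if \<alpha> \<in> F then killing (y \<alpha>) (E (- \<alpha>)) else 0)" if \<alpha>: "\<alpha> \<in> R" for \<alpha>
  proof -
    have "killing (y \<beta>) (E (- \<alpha>)) = 0" if "\<beta> \<in> F" "\<beta> \<noteq> \<alpha>" for \<beta>
      by (rule killing_orthogonal[OF F(3) root_vectors[OF R_neg[OF \<alpha>]]])
        (use that F(2) \<alpha> roots_dual R_neg in auto)
    then have "killing x (E (- \<alpha>)) = (\<Sum>\<beta>\<in>F. if \<beta> = \<alpha> then killing (y \<alpha>) (E (- \<alpha>)) else 0)"
      unfolding F(4) killing_sum by (intro sum.cong) auto
    then show ?thesis using F(1) by simp
  qed
  have "(\<Sum>\<alpha>\<in>R. scaleC (killing x (E (- \<alpha>))) (E \<alpha>)) = (\<Sum>\<alpha>\<in>R. if \<alpha> \<in> F then y \<alpha> else 0)"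
    by (rule sum.cong[OF refl]) (use 2 root_space_one_dim[OF _ F(3)] in auto)
  also have "\<dots> = (\<Sum>\<alpha>\<in>F \<inter> R. y \<alpha>)"
    using sum.inter_restrict[OF finite_R, of y F] by (simp add: Int_commute)
  finally have "?t = (\<Sum>\<alpha>\<in>F - R. y \<alpha>)"
    using F(1) sum.Int_Diff[OF F(1), of y R] by (simp add: F(4))
  moreover have "(\<Sum>\<alpha>\<in>F - R. y \<alpha>) \<in> h" by (rule lie.subspace_sum[OF h_subspace 1])
  ultimately have "?t \<in> h" by simp
  then show thesis using that[of ?t] by simp
qed

text \<open>This is the trace in a basis that consists of the root vectors and of elements of \<open>h\<close>; the
  latter contribute 0.\<close>

lemma killing_on_h:
  assumes "s \<in> h" "t \<in> h"
  shows "killing s t = (\<Sum>\<gamma>\<in>R. \<gamma> s * \<gamma> t)"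
proof -
  obtain C where C: "E ` R \<subseteq> C" "C \<subseteq> E ` R \<union> h" "lie.independent C" "E ` R \<union> h \<subseteq> lie.span C"
    using lie.maximal_independent_subset_extend[of "E ` R" "E ` R \<union> h"] E_independent(2) by blast
  have finC: "finite C" by (rule finite_independent[OF finite_dim C(3)])
  have "x \<in> lie.span C" for x
  proof -
    obtain t where t: "t \<in> h" "x = t + (\<Sum>\<alpha>\<in>R. scaleC (killing x (E (- \<alpha>))) (E \<alpha>))"
      by (rule root_space_expansion)
    have "t + (\<Sum>\<alpha>\<in>R. scaleC (killing x (E (- \<alpha>))) (E \<alpha>)) \<in> lie.span C"
      using t(1) C(4) by (intro lie.span_add lie.span_sum lie.span_scale) auto
    then show ?thesis by (simp only: t(2)[symmetric])
  qed
  then have spanC: "lie.span C = UNIV" by blast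
  let ?f = "lie_bracket s \<circ> lie_bracket t"
  have "killing s t = (\<Sum>c\<in>C. lie.representation C (?f c) c)"
    unfolding killing_def
    by (rule lie_trace_basis[OF Vector_Spaces.linear_compose[OF linear_lie_bracket linear_lie_bracket] finC C(3) spanC])
  also have "\<dots> = (\<Sum>c\<in>E ` R. lie.representation C (?f c) c)"
  proof (rule sum.mono_neutral_right[OF finC C(1)], intro ballI)
    fix c assume "c \<in> C - E ` R"
    then have "c \<in> h" using C(2) by blast
    then show "lie.representation C (?f c) c = 0"
      using assms by (simp add: h_abelian lie.representation_zero)
  qed
  also have "\<dots> = (\<Sum>\<gamma>\<in>R. lie.representation C (?f (E \<gamma>)) (E \<gamma>))"
    by (simp add: sum.reindex[OF E_independent(1)])
  also have "\<dots> = (\<Sum>\<gamma>\<in>R. \<gamma> s * \<gamma> t)"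
  proof (rule sum.cong[OF refl])
    fix \<gamma> assume \<gamma>: "\<gamma> \<in> R"
    have "?f (E \<gamma>) = scaleC (\<gamma> s * \<gamma> t) (E \<gamma>)"
      using root_spaceD[OF root_vectors[OF \<gamma>]] assms by (simp add: ad.scale mult.commute)
    then show "lie.representation C (?f (E \<gamma>)) (E \<gamma>) = \<gamma> s * \<gamma> t"
      using C \<gamma> spanC by (simp add: lie.representation_scale lie.representation_basis subset_iff)
  qed
  finally show ?thesis .
qed

text \<open>The scalar product. Its values on roots are real by \<open>ip_real\<close> below, so that the real part is the
  whole value.\<close>

definition ip :: "('g \<Rightarrow> complex) \<Rightarrow> ('g \<Rightarrow> complex) \<Rightarrow> real" where
  "ip \<alpha> \<beta> = Re (\<alpha> (T \<beta>))"

text \<open>All \<open>\<gamma> (T \<alpha>)\<close> are real multiples of \<open>a = \<alpha> (T \<alpha>)\<close>. So the trace formula for the square of \<open>T \<alpha>\<close>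
  reads \<open>a = s a\<^sup>2\<close> with \<open>s \<ge> 0\<close>.\<close>

lemma ip_self: assumes \<alpha>: "\<alpha> \<in> R" shows "\<alpha> (T \<alpha>) = of_real (ip \<alpha> \<alpha>)" "ip \<alpha> \<alpha> > 0"
proof -
  let ?a = "\<alpha> (T \<alpha>)"
  have "\<forall>\<gamma>\<in>R. \<exists>q::real. \<gamma> (T \<alpha>) = of_real q * ?a"
    using weight_multiple[OF \<alpha> roots_dual root_vectors E_nonzero] by blast
  then obtain q :: "('g \<Rightarrow> complex) \<Rightarrow> real" where q: "\<And>\<gamma>. \<gamma> \<in> R \<Longrightarrow> \<gamma> (T \<alpha>) = of_real (q \<gamma>) * ?a"
    by metis
  define s where "s = (\<Sum>\<gamma>\<in>R. (q \<gamma>)\<^sup>2)"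
  have "?a = (\<Sum>\<gamma>\<in>R. \<gamma> (T \<alpha>) * \<gamma> (T \<alpha>))"
    using killing_T[OF \<alpha> T_in_h[OF \<alpha>]] killing_on_h T_in_h[OF \<alpha>] by simp
  also have "\<dots> = (\<Sum>\<gamma>\<in>R. of_real ((q \<gamma>)\<^sup>2) * (?a * ?a))"
    by (rule sum.cong[OF refl]) (simp add: q power2_eq_square)
  also have "\<dots> = of_real s * (?a * ?a)"
    by (simp add: s_def sum_distrib_right)
  finally have "of_real s * ?a = 1"
    using T_nonisotropic[OF \<alpha>] by (metis mult.assoc mult_cancel_right2)
  moreover from this have s0: "s \<noteq> 0" by auto
  ultimately have a: "?a = of_real (1 / s)" by (simp add: field_simps)
  have "s > 0" using s0 by (simp add: s_def sum_nonneg less_le)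
  then show "\<alpha> (T \<alpha>) = of_real (ip \<alpha> \<alpha>)" "ip \<alpha> \<alpha> > 0" by (simp_all add: ip_def a)
qed

lemma ip_real: assumes "\<alpha> \<in> R" "\<beta> \<in> R" shows "\<alpha> (T \<beta>) = of_real (ip \<alpha> \<beta>)"
proof -
  obtain q :: real where "\<alpha> (T \<beta>) = of_real q * \<beta> (T \<beta>)"
    using weight_multiple[OF assms(2) roots_dual root_vectors E_nonzero] assms by blast
  then have "\<alpha> (T \<beta>) = of_real (q * ip \<beta> \<beta>)" using ip_self[OF assms(2)] by simp
  then show ?thesis by (simp add: ip_def)
qed

lemma ip_commute: "\<alpha> \<in> R \<Longrightarrow> \<beta> \<in> R \<Longrightarrow> ip \<alpha> \<beta> = ip \<beta> \<alpha>"
  by (simp add: ip_def T_symmetric)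

lemma ip_sum_squares: "\<alpha> \<in> R \<Longrightarrow> \<beta> \<in> R \<Longrightarrow> ip \<alpha> \<beta> = (\<Sum>\<gamma>\<in>R. ip \<alpha> \<gamma> * ip \<beta> \<gamma>)"
proof -
  assume ab: "\<alpha> \<in> R" "\<beta> \<in> R"
  have "\<alpha> (T \<beta>) = (\<Sum>\<gamma>\<in>R. \<gamma> (T \<alpha>) * \<gamma> (T \<beta>))"
    using killing_T[OF ab(1) T_in_h[OF ab(2)]] killing_on_h T_in_h ab by simp
  also have "\<dots> = of_real (\<Sum>\<gamma>\<in>R. ip \<alpha> \<gamma> * ip \<beta> \<gamma>)"
    using ab by (simp add: ip_real ip_commute)
  finally show ?thesis by (simp add: ip_def)
qed

text \<open>Otherwise \<open>E \<beta>\<close> would be a highest weight vector for \<open>\<alpha>\<close> with a negative weight.\<close>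

lemma ip_neg_add_root:
  assumes \<alpha>: "\<alpha> \<in> R" and \<beta>: "\<beta> \<in> R" and "ip \<beta> \<alpha> < 0" "\<alpha> + \<beta> \<noteq> 0"
  shows "\<alpha> + \<beta> \<in> R"
proof (rule ccontr)
  assume "\<alpha> + \<beta> \<notin> R"
  then have "lie_bracket (E \<alpha>) (E \<beta>) = 0"
    using root_space_bracket[OF root_vectors[OF \<alpha>] root_vectors[OF \<beta>]] assms(4)
      dual_space_add[OF roots_dual[OF \<alpha>] roots_dual[OF \<beta>]] rootI by blast
  from highest_weight[OF \<alpha> roots_dual[OF \<beta>] root_vectors[OF \<beta>] E_nonzero[OF \<beta>] this]
  obtain k :: nat where k: "2 * \<beta> (T \<alpha>) = of_nat k * \<alpha> (T \<alpha>)" by blast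
  have "2 * ip \<beta> \<alpha> = of_nat k * ip \<alpha> \<alpha>"
    using arg_cong[OF k, of Re] by (simp add: ip_def)
  moreover have "of_nat k * ip \<alpha> \<alpha> \<ge> 0" using ip_self(2)[OF \<alpha>] by simp
  ultimately have "ip \<beta> \<alpha> \<ge> 0" by linarith
  then show False using assms(3) by simp
qed

text \<open>If \<open>E \<alpha>\<close> and \<open>E \<beta>\<close> commute, then both \<open>E \<beta>\<close> and \<open>E (- \<alpha> - \<beta>)\<close> are highest weight vectors
  for \<open>\<alpha>\<close>; the weights \<open>\<langle>\<beta>, \<alpha>\<rangle>\<close> and \<open>\<langle>- \<alpha> - \<beta>, \<alpha>\<rangle>\<close> cannot both be nonnegative.\<close>

lemma bracket_root_vectors_nonzero:
  assumes \<alpha>: "\<alpha> \<in> R" and \<beta>: "\<beta> \<in> R" and \<gamma>: "\<alpha> + \<beta> \<in> R"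
  shows "lie_bracket (E \<alpha>) (E \<beta>) \<noteq> 0"
proof
  assume zero: "lie_bracket (E \<alpha>) (E \<beta>) = 0"
  let ?\<gamma> = "- (\<alpha> + \<beta>)"
  have g: "?\<gamma> \<in> R" by (rule R_neg[OF \<gamma>])
  have "killing (lie_bracket (E \<alpha>) (E ?\<gamma>)) (E \<beta>) = - killing (lie_bracket (E ?\<gamma>) (E \<alpha>)) (E \<beta>)"
    by (subst lie_bracket_anticomm) simp
  also have "\<dots> = 0" by (simp add: killing_inv zero)
  finally have k0: "killing (lie_bracket (E \<alpha>) (E ?\<gamma>)) (E \<beta>) = 0" .
  have "\<alpha> + ?\<gamma> = - \<beta>" by simp
  then have "lie_bracket (E \<alpha>) (E ?\<gamma>) \<in> root_space h (- \<beta>)"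
    using root_space_bracket[OF root_vectors[OF \<alpha>] root_vectors[OF g]] by simp
  from root_space_one_dim[OF R_neg[OF \<beta>] this] k0
  have zero': "lie_bracket (E \<alpha>) (E ?\<gamma>) = 0" by simp
  obtain k :: nat where k: "2 * \<beta> (T \<alpha>) = of_nat k * \<alpha> (T \<alpha>)"
    using highest_weight[OF \<alpha> roots_dual[OF \<beta>] root_vectors[OF \<beta>] E_nonzero[OF \<beta>] zero] by blast
  obtain l :: nat where l: "2 * ?\<gamma> (T \<alpha>) = of_nat l * \<alpha> (T \<alpha>)"
    using highest_weight[OF \<alpha> roots_dual[OF g] root_vectors[OF g] E_nonzero[OF g] zero'] by blast
  have "(of_nat k + of_nat l + 2) * \<alpha> (T \<alpha>) = 2 * \<beta> (T \<alpha>) + 2 * ?\<gamma> (T \<alpha>) + 2 * \<alpha> (T \<alpha>)"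
    unfolding k l by (simp add: algebra_simps)
  then have "(of_nat k + of_nat l + 2) * \<alpha> (T \<alpha>) = 0"
    by (simp add: algebra_simps)
  moreover have "(of_nat k + of_nat l + 2 :: complex) \<noteq> 0"
    using of_nat_eq_0_iff[of "k + l + 2", where ?'a = complex] by (simp add: add_ac)
  ultimately show False using T_nonisotropic[OF \<alpha>] by simp
qed

end

section \<open>Simple roots\<close>

lemma sum_fun_apply: "(\<Sum>a\<in>A. f a) x = (\<Sum>a\<in>A. (f a x :: 'b::comm_monoid_add))"
  by (induction A rule: infinite_finite_induct) simp_all

context lie_root_vectors
begin

lemma ip_add_left: "ip (\<alpha> + \<beta>) \<gamma> = ip \<alpha> \<gamma> + ip \<beta> \<gamma>"
  by (simp add: ip_def)

lemma ip_neg: "ip (- \<alpha>) \<beta> = - ip \<alpha> \<beta>"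
  by (simp add: ip_def)

lemma ip_zero: "ip 0 \<beta> = 0"
  by (simp add: ip_def)

lemma ip_sum_list: "ip (sum_list xs) \<beta> = sum_list (map (\<lambda>\<alpha>. ip \<alpha> \<beta>) xs)"
  by (induction xs) (simp_all only: sum_list.Nil sum_list.Cons list.map ip_add_left ip_zero)

text \<open>If a sum that contains \<open>\<beta>\<close> is 0, then some other term \<open>\<gamma>\<close> has a negative scalar product with \<open>\<beta>\<close>.
  So \<open>\<beta> + \<gamma>\<close> is a positive root, and there is a sum with one term less that is 0.\<close>

lemma sum_list_positive_nonzero:
  assumes "xs \<noteq> []" "set xs \<subseteq> P"
  shows "sum_list xs \<noteq> 0"
  using assms
proof (induction "length xs" arbitrary: xs rule: less_induct)
  case less
  show ?case
  proof
    assume zero: "sum_list xs = 0"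
    obtain \<beta> ys where xs: "xs = \<beta> # ys" using less.prems by (cases xs) auto
    have \<beta>: "\<beta> \<in> P" "\<beta> \<in> R" using less.prems P_subset by (auto simp: xs)
    have "ip (sum_list xs) \<beta> = 0" by (simp add: zero ip_zero)
    then have "sum_list (map (\<lambda>\<alpha>. ip \<alpha> \<beta>) ys) < 0"
      using ip_self(2)[OF \<beta>(2)] by (simp add: xs ip_add_left ip_sum_list)
    then obtain \<gamma> where \<gamma>: "\<gamma> \<in> set ys" "ip \<gamma> \<beta> < 0"
      using sum_list_nonneg[of "map (\<lambda>\<alpha>. ip \<alpha> \<beta>) ys"] by force
    then have \<gamma>P: "\<gamma> \<in> P" using less.prems by (auto simp: xs)
    have "\<beta> + \<gamma> \<noteq> 0" using P_not_neg[OF \<beta>(1)] \<gamma>P by (auto simp: add_eq_0_iff)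
    then have "\<beta> + \<gamma> \<in> P"
      using ip_neg_add_root[OF \<beta>(2) P_subset[OF \<gamma>P] \<gamma>(2)] P_closed \<beta> \<gamma>P by blast
    then have "sum_list ((\<beta> + \<gamma>) # remove1 \<gamma> ys) \<noteq> 0"
      using less.prems length_pos_if_in_set[OF \<gamma>(1)] \<gamma>(1) set_remove1_subset[of \<gamma> ys]
      by (intro less.hyps) (auto simp: xs length_remove1)
    moreover have "sum_list ((\<beta> + \<gamma>) # remove1 \<gamma> ys) = sum_list xs"
      using sum_list_map_remove1[OF \<gamma>(1), of "\<lambda>x. x"] by (simp add: xs add.assoc)
    ultimately show False using zero by simp
  qed
qed

text \<open>By the preceding lemma no root is a proper part of itself, so on the finite set of positive roots
  the relation of being a summand is well-founded.\<close>

lemma positive_root_induct [consumes 1, case_names sum]: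
  assumes "\<alpha> \<in> P"
    and "\<And>\<alpha>. \<alpha> \<in> P \<Longrightarrow> (\<And>\<beta> \<gamma>. \<beta> \<in> P \<Longrightarrow> \<gamma> \<in> P \<Longrightarrow> \<alpha> = \<beta> + \<gamma> \<Longrightarrow> Q \<beta> \<and> Q \<gamma>) \<Longrightarrow> Q \<alpha>"
  shows "Q \<alpha>"
proof -
  let ?r = "{(\<beta>, \<alpha>). \<beta> \<in> P \<and> \<alpha> \<in> P \<and> (\<exists>\<gamma>\<in>P. \<alpha> = \<beta> + \<gamma>)}"
  have chain: "\<exists>xs. xs \<noteq> [] \<and> set xs \<subseteq> P \<and> \<alpha> = \<beta> + sum_list xs" if "(\<beta>, \<alpha>) \<in> ?r\<^sup>+" for \<alpha> \<beta>
    using that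
  proof (induction rule: trancl_induct)
    case (base y)
    then obtain \<gamma> where "\<gamma> \<in> P" "y = \<beta> + \<gamma>" by blast
    then show ?case by (intro exI[of _ "[\<gamma>]"]) simp
  next
    case (step y z)
    then obtain xs \<gamma> where "xs \<noteq> []" "set xs \<subseteq> P" "y = \<beta> + sum_list xs" "\<gamma> \<in> P" "z = y + \<gamma>" by blast
    then show ?case by (intro exI[of _ "xs @ [\<gamma>]"]) (simp add: add.assoc)
  qed
  have "(\<alpha>, \<alpha>) \<notin> ?r\<^sup>+" for \<alpha>
    using chain[of \<alpha> \<alpha>] sum_list_positive_nonzero by force
  then have "acyclic ?r" by (simp add: acyclic_def)
  moreover have "finite ?r"
    by (rule finite_subset[of _ "P \<times> P"]) (use finite_P in auto)
  ultimately have "wf ?r" by (intro finite_acyclic_wf)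
  then have "\<alpha> \<in> P \<longrightarrow> Q \<alpha>"
  proof (induction \<alpha> rule: wf_induct_rule)
    case (less \<alpha>)
    show ?case
    proof
      assume \<alpha>: "\<alpha> \<in> P"
      show "Q \<alpha>"
      proof (rule assms(2)[OF \<alpha>])
        fix \<beta> \<gamma> assume *: "\<beta> \<in> P" "\<gamma> \<in> P" "\<alpha> = \<beta> + \<gamma>"
        moreover have "\<alpha> = \<gamma> + \<beta>" using * by (simp add: add.commute)
        ultimately have "(\<beta>, \<alpha>) \<in> ?r" "(\<gamma>, \<alpha>) \<in> ?r" using \<alpha> by blast+
        then show "Q \<beta> \<and> Q \<gamma>" using less * by blast
      qed
    qed
  qed
  then show ?thesis using assms(1) by blast
qed

lemma simple_P: "\<alpha> \<in> simple_roots P \<Longrightarrow> \<alpha> \<in> P"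
  by (simp add: simple_roots_def)

lemma simple_R: "\<alpha> \<in> simple_roots P \<Longrightarrow> \<alpha> \<in> R"
  using simple_P P_subset by blast

lemma finite_simple: "finite (simple_roots P)"
  using finite_subset[OF _ finite_P] simple_P by blast

lemma simple_not_sum: "\<alpha> \<in> simple_roots P \<Longrightarrow> \<beta> \<in> P \<Longrightarrow> \<gamma> \<in> P \<Longrightarrow> \<alpha> \<noteq> \<beta> + \<gamma>"
  unfolding simple_roots_def by blast

lemma positive_sum_simple:
  assumes "\<alpha> \<in> P"
  shows "\<exists>xs. xs \<noteq> [] \<and> set xs \<subseteq> simple_roots P \<and> sum_list xs = \<alpha>"
  using assms
proof (induction rule: positive_root_induct)
  case (sum \<alpha>)
  show ?case
  proof (cases "\<alpha> \<in> simple_roots P")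
    case True
    then show ?thesis by (intro exI[of _ "[\<alpha>]"]) simp
  next
    case False
    then obtain \<beta> \<gamma> where *: "\<beta> \<in> P" "\<gamma> \<in> P" "\<alpha> = \<beta> + \<gamma>"
      using sum(1) by (auto simp: simple_roots_def)
    from sum(2)[OF this] obtain xs ys where "xs \<noteq> []" "set xs \<subseteq> simple_roots P" "sum_list xs = \<beta>"
      "set ys \<subseteq> simple_roots P" "sum_list ys = \<gamma>" by blast
    then show ?thesis using * by (intro exI[of _ "xs @ ys"]) simp
  qed
qed

lemma positive_minus_simple:
  assumes \<alpha>: "\<alpha> \<in> simple_roots P" and \<beta>: "\<beta> \<in> P" and "\<beta> - \<alpha> \<in> R"
  shows "\<beta> - \<alpha> \<in> P"
proof (rule ccontr)
  assume "\<beta> - \<alpha> \<notin> P"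
  then have "- (\<beta> - \<alpha>) \<in> P" using R_cases[OF assms(3)] by blast
  then show False using simple_not_sum[OF \<alpha> \<beta>, of "- (\<beta> - \<alpha>)"] by simp
qed

lemma ip_pos_minus_root:
  assumes \<alpha>: "\<alpha> \<in> R" and \<beta>: "\<beta> \<in> R" and "ip \<beta> \<alpha> > 0" "\<beta> \<noteq> \<alpha>"
  shows "\<beta> - \<alpha> \<in> R"
  using ip_neg_add_root[OF \<beta> R_neg[OF \<alpha>]] assms by (simp add: ip_neg ip_commute)

lemma ip_simple_nonpos:
  assumes "\<alpha> \<in> simple_roots P" "\<beta> \<in> simple_roots P" "\<alpha> \<noteq> \<beta>"
  shows "ip \<alpha> \<beta> \<le> 0"
proof (rule ccontr)
  assume "\<not> ip \<alpha> \<beta> \<le> 0"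
  then have "\<alpha> - \<beta> \<in> R"
    using assms by (intro ip_pos_minus_root simple_R) auto
  then have "\<alpha> - \<beta> \<in> P" using positive_minus_simple[of \<beta> \<alpha>] assms simple_P by blast
  then show False using simple_not_sum[of \<alpha> \<beta> "\<alpha> - \<beta>"] assms simple_P by simp
qed

definition struct_const :: "('g \<Rightarrow> complex) \<Rightarrow> ('g \<Rightarrow> complex) \<Rightarrow> complex" where
  "struct_const \<alpha> \<beta> = killing (lie_bracket (E \<alpha>) (E \<beta>)) (E (- (\<alpha> + \<beta>)))"

lemma bracket_E:
  assumes "\<alpha> \<in> R" "\<beta> \<in> R" "\<alpha> + \<beta> \<in> R"
  shows "lie_bracket (E \<alpha>) (E \<beta>) = scaleC (struct_const \<alpha> \<beta>) (E (\<alpha> + \<beta>))"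
  unfolding struct_const_def
  by (rule root_space_one_dim[OF assms(3) root_space_bracket]) (use assms root_vectors in auto)

lemma bracket_E_0:
  assumes "\<alpha> \<in> R" "\<beta> \<in> R" "\<alpha> + \<beta> \<notin> R" "\<alpha> + \<beta> \<noteq> 0"
  shows "lie_bracket (E \<alpha>) (E \<beta>) = 0"
  using root_space_bracket[OF root_vectors[OF assms(1)] root_vectors[OF assms(2)]] assms(3,4)
    dual_space_add[OF roots_dual[OF assms(1)] roots_dual[OF assms(2)]] rootI by blast

text \<open>This is the computation that the trace of \<open>[E \<alpha>, E (- \<alpha>)]\<close> vanishes on the sum of the root
  spaces of the positive roots other than \<open>\<alpha>\<close>, which is invariant under both operators: the
  diagonal entries of the two products cancel after a shift by \<open>\<alpha>\<close>.\<close>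

lemma sum_ip_simple:
  assumes \<alpha>: "\<alpha> \<in> simple_roots P"
  shows "(\<Sum>\<beta>\<in>P. ip \<alpha> \<beta>) = ip \<alpha> \<alpha>"
proof -
  define down where "down \<beta> = (if \<beta> - \<alpha> \<in> R then struct_const (- \<alpha>) \<beta> * struct_const \<alpha> (\<beta> - \<alpha>) else 0)" for \<beta>
  define up where "up \<beta> = (if \<beta> + \<alpha> \<in> R then struct_const \<alpha> \<beta> * struct_const (- \<alpha>) (\<beta> + \<alpha>) else 0)" for \<beta>
  let ?Q = "P - {\<alpha>}"
  have a: "\<alpha> \<in> P" "\<alpha> \<in> R" "- \<alpha> \<in> R" using \<alpha> simple_P simple_R R_neg by auto
  have diag: "\<beta> (T \<alpha>) = down \<beta> - up \<beta>" if "\<beta> \<in> ?Q" for \<beta>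
  proof -
    have b: "\<beta> \<in> P" "\<beta> \<in> R" "\<beta> \<noteq> \<alpha>" using that P_subset by auto
    have "\<beta> \<noteq> - \<alpha>" using P_not_neg[OF a(1)] b(1) by blast
    then have ne: "\<alpha> + \<beta> \<noteq> 0" "- \<alpha> + \<beta> \<noteq> 0" using b(3) by (simp_all add: add_eq_0_iff)
    have lower: "lie_bracket (E \<alpha>) (lie_bracket (E (- \<alpha>)) (E \<beta>)) = scaleC (down \<beta>) (E \<beta>)"
    proof (cases "\<beta> - \<alpha> \<in> R")
      case True
      then show ?thesis
        using bracket_E[OF a(3) b(2)] bracket_E[OF a(2) True] b
        by (simp add: down_def ad.scale mult.commute)
    next
      case False
      then show ?thesis using bracket_E_0[OF a(3) b(2)] ne by (simp add: down_def)
    qed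
    have upper: "lie_bracket (E (- \<alpha>)) (lie_bracket (E \<alpha>) (E \<beta>)) = scaleC (up \<beta>) (E \<beta>)"
    proof (cases "\<beta> + \<alpha> \<in> R")
      case True
      then show ?thesis
        using bracket_E[OF a(2) b(2)] bracket_E[OF a(3) True] b
        by (simp add: up_def ad.scale mult.commute add.commute)
    next
      case False
      then show ?thesis using bracket_E_0[OF a(2) b(2)] ne by (simp add: up_def add.commute)
    qed
    have "scaleC (\<beta> (T \<alpha>)) (E \<beta>) = lie_bracket (T \<alpha>) (E \<beta>)"
      using root_spaceD[OF root_vectors[OF b(2)] T_in_h[OF a(2)]] by simp
    also have "\<dots> = scaleC (down \<beta> - up \<beta>) (E \<beta>)"
      using lie_bracket_derivation[of "E \<alpha>" "E (- \<alpha>)" "E \<beta>"] lower upper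
      by (simp add: T_def lie.scale_left_diff_distrib)
    finally show ?thesis using E_nonzero[OF b(2)] by simp
  qed
  have "(\<Sum>\<beta>\<in>?Q. \<beta> (T \<alpha>)) = (\<Sum>\<beta>\<in>?Q. down \<beta>) - (\<Sum>\<beta>\<in>?Q. up \<beta>)"
    unfolding sum_subtractf[symmetric] by (rule sum.cong[OF refl diag])
  moreover have "(\<Sum>\<beta>\<in>?Q. down \<beta>) = (\<Sum>\<beta>\<in>{\<beta> \<in> ?Q. \<beta> - \<alpha> \<in> R}. down \<beta>)"
    by (rule sum.mono_neutral_right) (auto simp: down_def finite_P)
  moreover have "(\<Sum>\<beta>\<in>?Q. up \<beta>) = (\<Sum>\<beta>\<in>{\<beta> \<in> ?Q. \<beta> + \<alpha> \<in> R}. up \<beta>)"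
    by (rule sum.mono_neutral_right) (auto simp: up_def finite_P)
  moreover have "(\<Sum>\<beta>\<in>{\<beta> \<in> ?Q. \<beta> - \<alpha> \<in> R}. down \<beta>) = (\<Sum>\<beta>\<in>{\<beta> \<in> ?Q. \<beta> + \<alpha> \<in> R}. up \<beta>)"
  proof (rule sum.reindex_bij_witness[where i = "\<lambda>\<beta>. \<beta> + \<alpha>" and j = "\<lambda>\<beta>. \<beta> - \<alpha>"])
    fix \<beta> assume b: "\<beta> \<in> {\<beta> \<in> ?Q. \<beta> - \<alpha> \<in> R}"
    have "\<beta> - \<alpha> \<noteq> \<alpha>"
    proof
      assume "\<beta> - \<alpha> = \<alpha>"
      then have "\<beta> = \<alpha> + \<alpha>" by (simp add: algebra_simps)
      moreover from this have "lie_bracket (E \<alpha>) (E \<alpha>) \<noteq> 0"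
        using bracket_root_vectors_nonzero[of \<alpha> \<alpha>] a(2) b P_subset by auto
      ultimately show False by (simp add: lie_bracket_self)
    qed
    then show "\<beta> - \<alpha> \<in> {\<beta> \<in> ?Q. \<beta> + \<alpha> \<in> R}"
      using b positive_minus_simple[OF \<alpha>] P_subset by auto
    show "up (\<beta> - \<alpha>) = down \<beta>" using b P_subset by (simp add: up_def down_def mult.commute)
  next
    fix \<beta> assume b: "\<beta> \<in> {\<beta> \<in> ?Q. \<beta> + \<alpha> \<in> R}"
    then have "\<beta> + \<alpha> \<noteq> \<alpha>" using P_subset roots_nonzero by auto
    then show "\<beta> + \<alpha> \<in> {\<beta> \<in> ?Q. \<beta> - \<alpha> \<in> R}"
      using b P_closed a(1) P_subset by auto
  qed auto
  ultimately have zero: "(\<Sum>\<beta>\<in>?Q. \<beta> (T \<alpha>)) = 0" by simp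
  have "(\<Sum>\<beta>\<in>?Q. ip \<alpha> \<beta>) = Re (\<Sum>\<beta>\<in>?Q. \<beta> (T \<alpha>))"
    using a P_subset by (auto simp: ip_def T_symmetric intro!: sum.cong)
  then show ?thesis
    using zero sum.remove[OF finite_P a(1), of "ip \<alpha>"] by simp
qed

text \<open>The scalar product with the sum of the positive roots. It is a linear function that is positive on
  the positive roots; that there is such a function is not part of the definition of a positive system.\<close>

definition height :: "('g \<Rightarrow> complex) \<Rightarrow> real" where
  "height \<alpha> = (\<Sum>\<beta>\<in>P. ip \<alpha> \<beta>)"

lemma height_add: "height (\<alpha> + \<beta>) = height \<alpha> + height \<beta>"
  by (simp add: height_def ip_add_left sum.distrib)

lemma height_pos:
  assumes "\<alpha> \<in> P" shows "height \<alpha> > 0"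
proof -
  have simple: "height \<alpha> > 0" if "\<alpha> \<in> simple_roots P" for \<alpha>
    using sum_ip_simple[OF that] ip_self(2)[OF simple_R[OF that]] by (simp add: height_def)
  have "height (sum_list xs) > 0" if "xs \<noteq> []" "set xs \<subseteq> simple_roots P" for xs
    using that by (induction xs rule: list_nonempty_induct) (auto simp: height_add simple add_pos_pos)
  then show ?thesis using positive_sum_simple[OF assms] by blast
qed

text \<open>Split a relation into the parts with positive and negative coefficients. Both parts are the
  same vector; its square is a sum of products with sign \<open>\<le> 0\<close>, so it is 0, and its height is a
  positive combination of positive heights.\<close>

lemma simple_roots_real_independent:
  fixes c :: "('g \<Rightarrow> complex) \<Rightarrow> real"
  assumes rel: "\<And>\<beta>. \<beta> \<in> R \<Longrightarrow> (\<Sum>\<alpha>\<in>simple_roots P. c \<alpha> * ip \<alpha> \<beta>) = 0"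
    and \<alpha>: "\<alpha> \<in> simple_roots P"
  shows "c \<alpha> = 0"
proof -
  let ?B = "simple_roots P"
  define p where "p \<alpha> = max (c \<alpha>) 0" for \<alpha>
  define n where "n \<alpha> = max (- c \<alpha>) 0" for \<alpha>
  define v where "v \<beta> = (\<Sum>\<alpha>\<in>?B. n \<alpha> * ip \<alpha> \<beta>)" for \<beta>
  have c: "c \<alpha> = p \<alpha> - n \<alpha>" and pn: "p \<alpha> \<ge> 0" "n \<alpha> \<ge> 0" "p \<alpha> * n \<alpha> = 0" for \<alpha>
    by (auto simp: p_def n_def max_def)
  have p_eq: "(\<Sum>\<alpha>\<in>?B. p \<alpha> * ip \<alpha> \<beta>) = v \<beta>" if "\<beta> \<in> R" for \<beta>
    using rel[OF that] by (simp add: c v_def left_diff_distrib sum_subtractf)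
  have "(\<Sum>\<gamma>\<in>R. (v \<gamma>)\<^sup>2) = (\<Sum>\<gamma>\<in>R. \<Sum>\<alpha>\<in>?B. \<Sum>\<beta>\<in>?B. n \<alpha> * n \<beta> * (ip \<alpha> \<gamma> * ip \<beta> \<gamma>))"
    by (simp add: v_def power2_eq_square sum_product mult_ac)
  also have "\<dots> = (\<Sum>\<alpha>\<in>?B. \<Sum>\<gamma>\<in>R. \<Sum>\<beta>\<in>?B. n \<alpha> * n \<beta> * (ip \<alpha> \<gamma> * ip \<beta> \<gamma>))"
    by (rule sum.swap)
  also have "\<dots> = (\<Sum>\<alpha>\<in>?B. \<Sum>\<beta>\<in>?B. \<Sum>\<gamma>\<in>R. n \<alpha> * n \<beta> * (ip \<alpha> \<gamma> * ip \<beta> \<gamma>))"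
    by (intro sum.cong[OF refl] sum.swap)
  also have "\<dots> = (\<Sum>\<alpha>\<in>?B. \<Sum>\<beta>\<in>?B. n \<alpha> * n \<beta> * ip \<alpha> \<beta>)"
    by (intro sum.cong[OF refl]) (simp only: sum_distrib_left[symmetric] ip_sum_squares[symmetric] simple_R)
  also have "\<dots> = (\<Sum>\<beta>\<in>?B. \<Sum>\<alpha>\<in>?B. n \<alpha> * n \<beta> * ip \<alpha> \<beta>)"
    by (rule sum.swap)
  also have "\<dots> = (\<Sum>\<beta>\<in>?B. n \<beta> * v \<beta>)"
    by (simp add: v_def sum_distrib_left mult_ac)
  also have "\<dots> = (\<Sum>\<beta>\<in>?B. \<Sum>\<alpha>\<in>?B. n \<beta> * p \<alpha> * ip \<alpha> \<beta>)"
    by (intro sum.cong[OF refl]) (simp add: p_eq[symmetric] simple_R sum_distrib_left mult_ac)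
  also have "\<dots> \<le> 0"
  proof (intro sum_nonpos)
    fix \<alpha> \<beta> assume ab: "\<alpha> \<in> ?B" "\<beta> \<in> ?B"
    show "n \<beta> * p \<alpha> * ip \<alpha> \<beta> \<le> 0"
    proof (cases "\<alpha> = \<beta>")
      case True
      then show ?thesis using pn(3)[of \<alpha>] by auto
    next
      case False
      then show ?thesis
        using ip_simple_nonpos[OF ab] pn by (intro mult_nonneg_nonpos mult_nonneg_nonneg) auto
    qed
  qed
  finally have "(\<Sum>\<gamma>\<in>R. (v \<gamma>)\<^sup>2) \<le> 0" .
  then have "(\<Sum>\<gamma>\<in>R. (v \<gamma>)\<^sup>2) = 0"
    using sum_nonneg[of R "\<lambda>\<gamma>. (v \<gamma>)\<^sup>2"] by fastforce
  then have v0: "v \<gamma> = 0" if "\<gamma> \<in> R" for \<gamma>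
    using that sum_nonneg_eq_0_iff[OF finite_R, of "\<lambda>\<gamma>. (v \<gamma>)\<^sup>2"] by simp
  have zero: "q \<alpha> = 0" if q: "\<And>\<alpha>. q \<alpha> \<ge> 0" "\<And>\<beta>. \<beta> \<in> R \<Longrightarrow> (\<Sum>\<alpha>\<in>?B. q \<alpha> * ip \<alpha> \<beta>) = 0" for q :: "_ \<Rightarrow> real"
  proof -
    have "(\<Sum>\<alpha>\<in>?B. q \<alpha> * height \<alpha>) = (\<Sum>\<beta>\<in>P. \<Sum>\<alpha>\<in>?B. q \<alpha> * ip \<alpha> \<beta>)"
      unfolding height_def sum_distrib_left by (rule sum.swap)
    also have "\<dots> = 0" using q(2) P_subset by simp
    finally have "q \<alpha> * height \<alpha> = 0"
      using sum_nonneg_eq_0_iff[OF finite_simple, of "\<lambda>\<alpha>. q \<alpha> * height \<alpha>"] q(1) height_pos[OF simple_P] \<alpha>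
      by (simp add: less_imp_le)
    then show ?thesis using height_pos[OF simple_P[OF \<alpha>]] by simp
  qed
  have "p \<alpha> = 0" by (rule zero) (use pn p_eq v0 in auto)
  moreover have "n \<alpha> = 0" by (rule zero) (use pn v0 in \<open>auto simp: v_def\<close>)
  ultimately show ?thesis by (simp add: c)
qed

text \<open>Scalar products of roots are real. So the real and imaginary parts of a complex relation give real
  relations between scalar products.\<close>

lemma simple_roots_independent: "fun_space.independent (simple_roots P)"
proof (rule fun_space.independent_if_scalars_zero[OF finite_simple])
  fix c \<alpha> assume rel: "(\<Sum>\<alpha>\<in>simple_roots P. fun_scale (c \<alpha>) \<alpha>) = 0" and \<alpha>: "\<alpha> \<in> simple_roots P"
  have "(\<Sum>\<alpha>\<in>simple_roots P. c \<alpha> * of_real (ip \<alpha> \<beta>)) = 0" if "\<beta> \<in> R" for \<beta>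
  proof -
    have "(\<Sum>\<alpha>\<in>simple_roots P. fun_scale (c \<alpha>) \<alpha>) (T \<beta>) = 0" by (simp add: rel)
    then have "(\<Sum>\<alpha>\<in>simple_roots P. c \<alpha> * \<alpha> (T \<beta>)) = 0"
      using sum_fun_apply[of "\<lambda>\<alpha>. fun_scale (c \<alpha>) \<alpha>"] by (simp add: fun_scale_def)
    then show ?thesis using that simple_R by (simp add: ip_real)
  qed
  from arg_cong[OF this, where f = Re] arg_cong[OF this, where f = Im]
  have re_im: "(\<Sum>\<alpha>\<in>simple_roots P. Re (c \<alpha>) * ip \<alpha> \<beta>) = 0"
    "(\<Sum>\<alpha>\<in>simple_roots P. Im (c \<alpha>) * ip \<alpha> \<beta>) = 0" if "\<beta> \<in> R" for \<beta>
    using that by (simp_all add: Re_sum Im_sum)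
  have "Re (c \<alpha>) = 0" "Im (c \<alpha>) = 0"
    by (rule simple_roots_real_independent[OF re_im(1) \<alpha>] simple_roots_real_independent[OF re_im(2) \<alpha>]; assumption)+
  then show "c \<alpha> = 0" by (simp add: complex_eq_iff)
qed

end

section \<open>The Levi subalgebra and its complement\<close>

lemma lie_subalgebra_span:
  assumes "\<And>x y. x \<in> A \<Longrightarrow> y \<in> A \<Longrightarrow> lie_bracket x y \<in> lie.span A"
  shows "lie_subalgebra (lie.span A)"
proof -
  have 1: "lie_bracket x y \<in> lie.span A" if "x \<in> A" "y \<in> lie.span A" for x y
    using that(2)
  proof (induction rule: lie.span_induct)
    case base
    show ?case by (auto simp: lie.subspace_def ad.add ad.scale lie.span_zero lie.span_add lie.span_scale)
  qed (use assms that(1) in auto)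
  have "lie_bracket x y \<in> lie.span A" if "x \<in> lie.span A" "y \<in> lie.span A" for x y
    using that(1)
  proof (induction rule: lie.span_induct)
    case base
    show ?case
      by (auto simp: lie.subspace_def ad_left.add ad_left.scale lie.span_zero lie.span_add lie.span_scale)
  qed (use 1 that(2) in auto)
  then show ?thesis by (simp add: lie_subalgebra_def)
qed

locale levi_subset = lie_root_vectors h P E
  for h :: "'g::complex_lie_algebra set" and P :: "('g \<Rightarrow> complex) set" and E :: "('g \<Rightarrow> complex) \<Rightarrow> 'g" +
  fixes \<Gamma> :: "('g \<Rightarrow> complex) set"
  assumes \<Gamma>_simple: "\<Gamma> \<subseteq> simple_roots P"
begin

abbreviation coord :: "('g \<Rightarrow> complex) \<Rightarrow> ('g \<Rightarrow> complex) \<Rightarrow> complex" where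
  "coord \<equiv> fun_space.representation (simple_roots P)"

abbreviation weight_span :: "('g \<Rightarrow> complex) set" where
  "weight_span \<equiv> fun_space.span (simple_roots P)"

lemma coord_sum_list:
  assumes "set xs \<subseteq> simple_roots P"
  shows "sum_list xs \<in> weight_span" "coord (sum_list xs) \<gamma> = of_nat (count_list xs \<gamma>)"
proof -
  have "sum_list xs \<in> weight_span \<and> coord (sum_list xs) \<gamma> = of_nat (count_list xs \<gamma>)"
    using assms
  proof (induction xs)
    case Nil
    show ?case
      by (simp only: sum_list.Nil fun_space.span_zero fun_space.representation_zero count_list.simps) simp
  next
    case (Cons \<beta> xs)
    then have b: "\<beta> \<in> weight_span" "sum_list xs \<in> weight_span" by (simp_all add: fun_space.span_base)
    have "coord (\<beta> + sum_list xs) \<gamma> = coord \<beta> \<gamma> + coord (sum_list xs) \<gamma>"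
      by (simp only: fun_space.representation_add[OF simple_roots_independent b(2,1)])
    moreover have "coord \<beta> \<gamma> = (if \<gamma> = \<beta> then 1 else 0)"
      using Cons by (subst fun_space.representation_basis[OF simple_roots_independent]) auto
    moreover have "coord (sum_list xs) \<gamma> = of_nat (count_list xs \<gamma>)" using Cons by simp
    ultimately have "coord (\<beta> + sum_list xs) \<gamma> = of_nat (count_list (\<beta> # xs) \<gamma>)" by simp
    then show ?case
      unfolding sum_list.Cons using fun_space.span_add[OF b] by (rule conjI[rotated])
  qed
  then show "sum_list xs \<in> weight_span" "coord (sum_list xs) \<gamma> = of_nat (count_list xs \<gamma>)" by auto
qed

lemma positive_weight_span: "\<alpha> \<in> P \<Longrightarrow> \<alpha> \<in> weight_span"
  using positive_sum_simple coord_sum_list(1) by blast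

lemma positive_coord: "\<alpha> \<in> P \<Longrightarrow> \<exists>n::nat. coord \<alpha> \<gamma> = of_nat n"
  using positive_sum_simple coord_sum_list(2) by blast

lemma root_weight_span: "\<alpha> \<in> R \<Longrightarrow> \<alpha> \<in> weight_span"
  using R_cases positive_weight_span fun_space.span_neg[of "- \<alpha>"] by fastforce

lemma coord_span:
  assumes "\<mu> \<in> fun_space.span A" "A \<subseteq> simple_roots P" "\<gamma> \<notin> A"
  shows "coord \<mu> \<gamma> = 0"
  using fun_space.representation_extend[OF simple_roots_independent assms(1,2)]
    fun_space.representation_ne_zero[of A \<mu> \<gamma>] assms(3) by auto

lemma coord_sum: "\<mu> \<in> weight_span \<Longrightarrow> (\<Sum>\<gamma>\<in>simple_roots P. fun_scale (coord \<mu> \<gamma>) \<gamma>) = \<mu>"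
  by (rule fun_space.sum_representation_eq[OF simple_roots_independent _ finite_simple order.refl])

lemma bar_eq:
  assumes \<mu>: "\<mu> \<in> weight_span"
  shows "bar P \<Gamma> \<mu> = (\<Sum>\<gamma>\<in>simple_roots P - \<Gamma>. fun_scale (coord \<mu> \<gamma>) \<gamma>)"
    and "\<mu> - bar P \<Gamma> \<mu> \<in> fun_space.span \<Gamma>"
proof -
  let ?\<nu> = "\<lambda>\<mu>. \<Sum>\<gamma>\<in>simple_roots P - \<Gamma>. fun_scale (coord \<mu> \<gamma>) \<gamma>"
  have diff: "\<mu> - ?\<nu> \<mu> = (\<Sum>\<gamma>\<in>\<Gamma>. fun_scale (coord \<mu> \<gamma>) \<gamma>)"
    using coord_sum[OF \<mu>] sum.subset_diff[OF \<Gamma>_simple finite_simple, of "\<lambda>\<gamma>. fun_scale (coord \<mu> \<gamma>) \<gamma>"]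
    by (simp add: algebra_simps)
  have in_\<Gamma>: "\<mu> - ?\<nu> \<mu> \<in> fun_space.span \<Gamma>"
    unfolding diff by (rule fun_space.span_sum) (rule fun_space.span_scale[OF fun_space.span_base])
  show eq: "bar P \<Gamma> \<mu> = ?\<nu> \<mu>"
    unfolding bar_def
  proof (rule the_equality)
    show "?\<nu> \<mu> \<in> fun_space.span (simple_roots P - \<Gamma>) \<and> \<mu> - ?\<nu> \<mu> \<in> fun_space.span \<Gamma>"
      by (intro conjI in_\<Gamma> fun_space.span_sum fun_space.span_scale[OF fun_space.span_base])
    fix \<nu> assume \<nu>: "\<nu> \<in> fun_space.span (simple_roots P - \<Gamma>) \<and> \<mu> - \<nu> \<in> fun_space.span \<Gamma>"
    then have \<nu>_span: "\<nu> \<in> weight_span"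
      using fun_space.span_mono[of "simple_roots P - \<Gamma>" "simple_roots P"] by blast
    have "coord \<nu> \<gamma> = coord \<mu> \<gamma>" if "\<gamma> \<in> simple_roots P - \<Gamma>" for \<gamma>
      using coord_span[OF _ \<Gamma>_simple, of "\<mu> - \<nu>" \<gamma>] \<nu> that
        fun_space.representation_diff[OF simple_roots_independent \<nu>_span \<mu>] by simp
    moreover have "coord \<nu> \<gamma> = 0" if "\<gamma> \<in> \<Gamma>" for \<gamma>
      using coord_span[of \<nu> "simple_roots P - \<Gamma>" \<gamma>] \<nu> that by simp
    moreover have "\<nu> = ?\<nu> \<nu> + (\<Sum>\<gamma>\<in>\<Gamma>. fun_scale (coord \<nu> \<gamma>) \<gamma>)"
      using coord_sum[OF \<nu>_span] sum.subset_diff[OF \<Gamma>_simple finite_simple, of "\<lambda>\<gamma>. fun_scale (coord \<nu> \<gamma>) \<gamma>"]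
      by simp
    ultimately show "\<nu> = ?\<nu> \<mu>" by simp
  qed
  show "\<mu> - bar P \<Gamma> \<mu> \<in> fun_space.span \<Gamma>" unfolding eq by (rule in_\<Gamma>)
qed

lemma bar_add: "\<mu> \<in> weight_span \<Longrightarrow> \<nu> \<in> weight_span \<Longrightarrow> bar P \<Gamma> (\<mu> + \<nu>) = bar P \<Gamma> \<mu> + bar P \<Gamma> \<nu>"
  by (simp add: bar_eq fun_space.span_add fun_space.representation_add[OF simple_roots_independent]
      fun_space.scale_left_distrib sum.distrib)

lemma bar_neg: "\<mu> \<in> weight_span \<Longrightarrow> bar P \<Gamma> (- \<mu>) = - bar P \<Gamma> \<mu>"
  by (simp add: bar_eq fun_space.span_neg fun_space.representation_neg[OF simple_roots_independent]
      sum_negf)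

lemma bar_zero_iff:
  assumes "\<mu> \<in> weight_span" shows "bar P \<Gamma> \<mu> = 0 \<longleftrightarrow> \<mu> \<in> fun_space.span \<Gamma>"
proof
  show "\<mu> \<in> fun_space.span \<Gamma>" if "bar P \<Gamma> \<mu> = 0" using bar_eq(2)[OF assms] that by simp
  show "bar P \<Gamma> \<mu> = 0" if "\<mu> \<in> fun_space.span \<Gamma>"
    unfolding bar_eq(1)[OF assms] using coord_span[OF that \<Gamma>_simple] by (intro sum.neutral) auto
qed

lemma bar_span_complement:
  assumes "\<mu> \<in> fun_space.span (simple_roots P - \<Gamma>)" shows "bar P \<Gamma> \<mu> = \<mu>"
proof -
  have \<mu>: "\<mu> \<in> weight_span"
    using assms fun_space.span_mono[of "simple_roots P - \<Gamma>" "simple_roots P"] by blast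
  have "(\<Sum>\<gamma>\<in>\<Gamma>. fun_scale (coord \<mu> \<gamma>) \<gamma>) = 0"
    using coord_span[OF assms] by (intro sum.neutral) auto
  then show ?thesis
    using coord_sum[OF \<mu>] sum.subset_diff[OF \<Gamma>_simple finite_simple, of "\<lambda>\<gamma>. fun_scale (coord \<mu> \<gamma>) \<gamma>"]
    by (simp add: bar_eq(1)[OF \<mu>])
qed

lemma bar_simple: "\<gamma> \<in> simple_roots P - \<Gamma> \<Longrightarrow> bar P \<Gamma> \<gamma> = \<gamma>"
  by (intro bar_span_complement fun_space.span_base)

lemma bar_\<Gamma>: "\<gamma> \<in> \<Gamma> \<Longrightarrow> bar P \<Gamma> \<gamma> = 0"
  using \<Gamma>_simple by (subst bar_zero_iff) (auto intro: fun_space.span_base)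

abbreviation L :: "('g \<Rightarrow> complex) set" where "L \<equiv> levi_roots R \<Gamma>"

lemma L_iff: "\<alpha> \<in> L \<longleftrightarrow> \<alpha> \<in> R \<and> bar P \<Gamma> \<alpha> = 0"
  by (auto simp: levi_roots_def bar_zero_iff root_weight_span)

text \<open>The roots of the complement \<open>m_space\<close>. In terms of the quasiroots they are the roots whose image is
  not 0, while \<open>L\<close> consists of the roots with image 0.\<close>

definition S :: "('g \<Rightarrow> complex) set" where "S = R - L"

lemma S_iff: "\<alpha> \<in> S \<longleftrightarrow> \<alpha> \<in> R \<and> bar P \<Gamma> \<alpha> \<noteq> 0"
  by (auto simp: S_def L_iff)

lemma L_R: "\<alpha> \<in> L \<Longrightarrow> \<alpha> \<in> R" and S_R: "\<alpha> \<in> S \<Longrightarrow> \<alpha> \<in> R"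
  by (simp_all add: L_iff S_iff)

lemma finite_S: "finite S"
  using finite_R by (simp add: S_def)

lemma bar_root_neg: "\<alpha> \<in> R \<Longrightarrow> bar P \<Gamma> (- \<alpha>) = - bar P \<Gamma> \<alpha>"
  by (simp add: bar_neg root_weight_span)

lemma bar_root_add: "\<alpha> \<in> R \<Longrightarrow> \<beta> \<in> R \<Longrightarrow> bar P \<Gamma> (\<alpha> + \<beta>) = bar P \<Gamma> \<alpha> + bar P \<Gamma> \<beta>"
  by (simp add: bar_add root_weight_span)

lemma S_neg: "\<alpha> \<in> S \<Longrightarrow> - \<alpha> \<in> S" and L_neg: "\<alpha> \<in> L \<Longrightarrow> - \<alpha> \<in> L"
  by (simp_all add: S_iff L_iff R_neg bar_root_neg)

lemma L_add: "\<alpha> \<in> L \<Longrightarrow> \<beta> \<in> L \<Longrightarrow> \<alpha> + \<beta> \<in> R \<Longrightarrow> \<alpha> + \<beta> \<in> L"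
  by (simp add: L_iff bar_root_add)

lemma S_eq: "S = (P - L) \<union> uminus ` (P - L)"
proof
  show "S \<subseteq> (P - L) \<union> uminus ` (P - L)"
  proof
    fix \<alpha> assume \<alpha>: "\<alpha> \<in> S"
    then have "\<alpha> \<notin> L" "- \<alpha> \<notin> L" using S_neg by (auto simp: S_def)
    moreover have "\<alpha> = - (- \<alpha>)" by simp
    ultimately show "\<alpha> \<in> (P - L) \<union> uminus ` (P - L)"
      using R_cases[of \<alpha>] \<alpha> S_R by blast
  qed
  have "P - L \<subseteq> S" using P_subset by (auto simp: S_def)
  then show "(P - L) \<union> uminus ` (P - L) \<subseteq> S" using S_neg by auto
qed

text \<open>Coordinates of positive roots are natural numbers, so they cannot cancel.\<close>

lemma bar_positive_add_zero:
  assumes "\<alpha> \<in> P" "\<beta> \<in> P" "bar P \<Gamma> \<alpha> + bar P \<Gamma> \<beta> = 0"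
  shows "bar P \<Gamma> \<alpha> = 0"
proof -
  have w: "\<alpha> \<in> weight_span" "\<beta> \<in> weight_span" using assms positive_weight_span by auto
  have "coord \<alpha> \<gamma> = 0" if "\<gamma> \<in> simple_roots P - \<Gamma>" for \<gamma>
  proof -
    have "\<alpha> + \<beta> \<in> fun_space.span \<Gamma>"
      using assms w by (simp add: bar_zero_iff[symmetric] fun_space.span_add bar_add)
    then have "coord (\<alpha> + \<beta>) \<gamma> = 0" using coord_span[OF _ \<Gamma>_simple] that by blast
    moreover obtain m n :: nat where "coord \<alpha> \<gamma> = of_nat m" "coord \<beta> \<gamma> = of_nat n"
      using positive_coord assms by metis
    ultimately show ?thesis
      using fun_space.representation_add[OF simple_roots_independent w(2,1)]
      by (simp add: of_nat_add[symmetric] del: of_nat_add)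
  qed
  then show ?thesis unfolding bar_eq(1)[OF w(1)] by (intro sum.neutral) auto
qed

text \<open>The span is a subalgebra because \<open>L\<close> is closed under sums that are roots. Conversely, a positive root
  in \<open>L\<close> that is not simple is a sum of two such roots, and its root vector is a multiple of the bracket
  of theirs.\<close>

lemma levi_subalgebra_eq: "levi_subalgebra h E \<Gamma> = lie.span (h \<union> E ` L)"
proof
  let ?A = "h \<union> E ` L" and ?X = "h \<union> E ` \<Gamma> \<union> E ` uminus ` \<Gamma>"
  have "lie_subalgebra (lie.span ?A)"
  proof (rule lie_subalgebra_span)
    fix x y assume xy: "x \<in> ?A" "y \<in> ?A"
    have hE: "lie_bracket t (E \<alpha>) \<in> lie.span ?A" if "t \<in> h" "\<alpha> \<in> L" for t \<alpha>
      using that by (simp add: root_spaceD[OF root_vectors[OF L_R]] lie.span_scale lie.span_base)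
    have EE: "lie_bracket (E \<alpha>) (E \<beta>) \<in> lie.span ?A" if ab: "\<alpha> \<in> L" "\<beta> \<in> L" for \<alpha> \<beta>
    proof -
      consider "\<alpha> + \<beta> = 0" | "\<alpha> + \<beta> \<in> R" | "\<alpha> + \<beta> \<noteq> 0" "\<alpha> + \<beta> \<notin> R" by blast
      then show ?thesis
      proof cases
        case 1
        then have "\<beta> = - \<alpha>" by (simp add: add_eq_0_iff)
        then show ?thesis using T_in_h[OF L_R[OF ab(1)]] by (auto simp: T_def intro: lie.span_base)
      next
        case 2
        then show ?thesis
          using bracket_E[OF L_R L_R, OF ab] L_add[OF ab] by (simp add: lie.span_scale lie.span_base)
      next
        case 3
        then show ?thesis using bracket_E_0[OF L_R L_R, OF ab] by (simp add: lie.span_zero)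
      qed
    qed
    from xy show "lie_bracket x y \<in> lie.span ?A"
    proof (elim UnE imageE)
      show ?thesis if "x \<in> h" "y \<in> h" using that by (simp add: h_abelian lie.span_zero)
      show ?thesis if "y \<in> h" "x = E \<alpha>" "\<alpha> \<in> L" for \<alpha>
        using lie.span_neg[OF hE[OF that(1,3)]] by (subst lie_bracket_anticomm) (simp add: that)
    qed (use hE EE in auto)
  qed
  moreover have "\<gamma> \<in> L \<and> - \<gamma> \<in> L" if "\<gamma> \<in> \<Gamma>" for \<gamma>
    using that \<Gamma>_simple simple_R L_neg by (auto simp: L_iff bar_\<Gamma>)
  then have "?X \<subseteq> lie.span ?A" by (auto intro!: lie.span_base)
  ultimately show "levi_subalgebra h E \<Gamma> \<subseteq> lie.span ?A"
    unfolding levi_subalgebra_def generated_subalgebra_def by blast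
  have sub: "lie.span ?A \<subseteq> G" if G: "lie_subalgebra G" "?X \<subseteq> G" for G
  proof (rule lie.span_minimal)
    have G_sub: "lie.subspace G" and G_br: "\<And>x y. x \<in> G \<Longrightarrow> y \<in> G \<Longrightarrow> lie_bracket x y \<in> G"
      using G by (auto simp: lie_subalgebra_def)
    have G_sum: "E (\<alpha> + \<beta>) \<in> G" if "E \<alpha> \<in> G" "E \<beta> \<in> G" "\<alpha> \<in> R" "\<beta> \<in> R" "\<alpha> + \<beta> \<in> R" for \<alpha> \<beta>
    proof -
      have "struct_const \<alpha> \<beta> \<noteq> 0"
        using bracket_root_vectors_nonzero[of \<alpha> \<beta>] bracket_E[of \<alpha> \<beta>] that by auto
      then have "E (\<alpha> + \<beta>) = scaleC (1 / struct_const \<alpha> \<beta>) (lie_bracket (E \<alpha>) (E \<beta>))"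
        using bracket_E[of \<alpha> \<beta>] that by simp
      then show ?thesis using lie.subspace_scale[OF G_sub G_br] that by simp
    qed
    define good where "good \<alpha> \<longleftrightarrow> E \<alpha> \<in> G \<and> E (- \<alpha>) \<in> G" for \<alpha>
    have pos: "good \<alpha>" if "\<alpha> \<in> P" "bar P \<Gamma> \<alpha> = 0" for \<alpha>
      using that
    proof (induction rule: positive_root_induct)
      case (sum \<alpha>)
      show ?case
      proof (cases "\<alpha> \<in> simple_roots P")
        case True
        have "\<alpha> \<in> \<Gamma>"
        proof (rule ccontr)
          assume "\<alpha> \<notin> \<Gamma>"
          then have "bar P \<Gamma> \<alpha> = \<alpha>" using True bar_simple by blast
          then show False using sum(3) roots_nonzero[OF P_subset[OF sum(1)]] by metis
        qed
        then show ?thesis using G(2) by (auto simp: good_def)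
      next
        case False
        then obtain \<beta> \<gamma> where bg: "\<beta> \<in> P" "\<gamma> \<in> P" "\<alpha> = \<beta> + \<gamma>"
          using sum(1) by (auto simp: simple_roots_def)
        have "bar P \<Gamma> \<beta> + bar P \<Gamma> \<gamma> = 0"
          using sum(3) bar_root_add[OF bg(1,2)[THEN P_subset]] unfolding bg(3) by metis
        then have "bar P \<Gamma> \<beta> = 0" "bar P \<Gamma> \<gamma> = 0"
          using bar_positive_add_zero bg by (auto simp: add.commute)
        then have "good \<beta>" "good \<gamma>" using sum(2)[OF bg] by auto
        then have "E \<beta> \<in> G" "E (- \<beta>) \<in> G" "E \<gamma> \<in> G" "E (- \<gamma>) \<in> G"
          by (auto simp: good_def)
        moreover have "\<beta> \<in> R" "\<gamma> \<in> R" "\<beta> + \<gamma> \<in> R" "- \<beta> \<in> R" "- \<gamma> \<in> R"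
          using bg sum(1) P_subset R_neg by auto
        moreover have "- \<alpha> \<in> R" using sum(1) P_subset R_neg by blast
        moreover have "- \<alpha> = - \<beta> + - \<gamma>" using bg by simp
        ultimately show ?thesis
          unfolding good_def using G_sum[of \<beta> \<gamma>] G_sum[of "- \<beta>" "- \<gamma>"] bg(3) by metis
      qed
    qed
    show "?A \<subseteq> G"
    proof
      fix x assume "x \<in> ?A"
      then consider "x \<in> h" | \<alpha> where "\<alpha> \<in> L" "x = E \<alpha>" by blast
      then show "x \<in> G"
      proof cases
        case 1
        then show ?thesis using G(2) by blast
      next
        case 2
        then have "\<alpha> \<in> R" "bar P \<Gamma> \<alpha> = 0" "bar P \<Gamma> (- \<alpha>) = 0" by (auto simp: L_iff bar_root_neg)
        then show ?thesis using R_cases[of \<alpha>] pos[of \<alpha>] pos[of "- \<alpha>"] 2 by (auto simp: good_def)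
      qed
    qed
    show "lie.subspace G" by (rule G_sub)
  qed
  show "lie.span ?A \<subseteq> levi_subalgebra h E \<Gamma>"
    unfolding levi_subalgebra_def generated_subalgebra_def using sub by blast
qed

lemma m_space_eq: "m_space h P E \<Gamma> = lie.span (E ` S)"
  unfolding m_space_def S_eq by (simp add: image_Un)

lemma killing_E_E:
  assumes "\<alpha> \<in> R" "\<beta> \<in> R"
  shows "killing (E \<alpha>) (E (- \<beta>)) = (if \<alpha> = \<beta> then 1 else 0)"
proof (cases "\<alpha> = \<beta>")
  case True
  then show ?thesis using killing_E assms by simp
next
  case False
  then show ?thesis
    using killing_orthogonal[OF root_vectors[OF assms(1)] root_vectors[OF R_neg[OF assms(2)]]]
      roots_dual assms R_neg by simp
qed

lemma killing_h_E: "t \<in> h \<Longrightarrow> \<beta> \<in> R \<Longrightarrow> killing t (E \<beta>) = 0"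
  by (rule killing_orthogonal[OF _ root_vectors dual_space_0 roots_dual])
    (simp_all add: root_space_0 roots_nonzero)

lemma m_proj_eq: "m_proj h P E \<Gamma> x = (\<Sum>\<alpha>\<in>S. scaleC (killing x (E (- \<alpha>))) (E \<alpha>))"
proof -
  let ?pr = "\<lambda>x. \<Sum>\<alpha>\<in>S. scaleC (killing x (E (- \<alpha>))) (E \<alpha>)"
  have levi: "killing y (E (- \<alpha>)) = 0" if "y \<in> lie.span (h \<union> E ` L)" "\<alpha> \<in> S" for y \<alpha>
    using that(1)
  proof (induction rule: lie.span_induct)
    case base
    show ?case by (simp add: lie.subspace_def killing_add_left killing_scale_left)
  next
    case (step x)
    have \<alpha>: "\<alpha> \<in> R" "- \<alpha> \<in> R" "\<alpha> \<notin> L" using that(2) R_neg by (auto simp: S_def)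
    from step show ?case
    proof
      assume "x \<in> E ` L"
      then obtain \<beta> where "\<beta> \<in> L" "x = E \<beta>" by blast
      moreover have "\<beta> \<noteq> \<alpha>" using \<open>\<beta> \<in> L\<close> \<alpha>(3) by blast
      ultimately show ?thesis using killing_E_E[OF L_R \<alpha>(1)] by metis
    qed (rule killing_h_E[OF _ \<alpha>(2)])
  qed
  have m: "?pr y = y" if "y \<in> lie.span (E ` S)" for y
    using that
  proof (induction rule: lie.span_induct)
    case base
    show ?case
      by (simp add: lie.subspace_def killing_add_left killing_scale_left lie.scale_left_distrib
          sum.distrib lie.scale_sum_right[symmetric] flip: lie.scale_scale)
  next
    case (step y)
    then obtain \<beta> where b: "\<beta> \<in> S" "y = E \<beta>" by blast
    have "?pr y = (\<Sum>\<alpha>\<in>S. if \<alpha> = \<beta> then E \<beta> else 0)"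
      by (rule sum.cong) (use b S_R killing_E_E in auto)
    then have "?pr y = y" using b finite_S by simp
    then show ?case .
  qed
  show ?thesis
    unfolding m_proj_def m_space_eq levi_subalgebra_eq
  proof (rule the_equality)
    obtain t where t: "t \<in> h" "x = t + (\<Sum>\<alpha>\<in>R. scaleC (killing x (E (- \<alpha>))) (E \<alpha>))"
      by (rule root_space_expansion)
    have "L \<subseteq> R" using L_R by blast
    then have "x - ?pr x = t + (\<Sum>\<alpha>\<in>L. scaleC (killing x (E (- \<alpha>))) (E \<alpha>))"
      using sum.subset_diff[of L R "\<lambda>\<alpha>. scaleC (killing x (E (- \<alpha>))) (E \<alpha>)"] finite_R t(2)
      by (simp add: S_def algebra_simps)
    moreover have "\<dots> \<in> lie.span (h \<union> E ` L)"
      using t(1) by (intro lie.span_add lie.span_sum lie.span_scale lie.span_base) auto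
    moreover have "?pr x \<in> lie.span (E ` S)"
      by (intro lie.span_sum lie.span_scale[OF lie.span_base] imageI)
    ultimately show "?pr x \<in> lie.span (E ` S) \<and> x - ?pr x \<in> lie.span (h \<union> E ` L)"
      by simp
    fix y assume y: "y \<in> lie.span (E ` S) \<and> x - y \<in> lie.span (h \<union> E ` L)"
    have "?pr y = ?pr x"
      by (rule sum.cong[OF refl]) (use levi y in \<open>force simp: killing_diff\<close>)
    then show "y = ?pr x" using m y by simp
  qed
qed

lemma linear_m_proj: "Vector_Spaces.linear scaleC scaleC (m_proj h P E \<Gamma>)"
  by unfold_locales
    (simp_all add: m_proj_eq killing_add_left killing_scale_left lie.scale_left_distrib
      sum.distrib lie.scale_sum_right)

lemma m_proj_h: "t \<in> h \<Longrightarrow> m_proj h P E \<Gamma> t = 0"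
  unfolding m_proj_eq by (rule sum.neutral) (use killing_h_E S_R S_neg in auto)

lemma m_proj_E:
  assumes "\<beta> \<in> R" shows "m_proj h P E \<Gamma> (E \<beta>) = (if \<beta> \<in> S then E \<beta> else 0)"
proof -
  have "m_proj h P E \<Gamma> (E \<beta>) = (\<Sum>\<alpha>\<in>S. if \<alpha> = \<beta> then E \<beta> else 0)"
    unfolding m_proj_eq by (rule sum.cong) (use assms S_R killing_E_E in auto)
  then show ?thesis using finite_S by simp
qed

lemma m_proj_bracket:
  assumes "\<alpha> \<in> R" "\<beta> \<in> R"
  shows "m_proj h P E \<Gamma> (lie_bracket (E \<alpha>) (E \<beta>)) =
    (if \<alpha> + \<beta> \<in> S then scaleC (struct_const \<alpha> \<beta>) (E (\<alpha> + \<beta>)) else 0)"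
proof -
  interpret pr: Vector_Spaces.linear scaleC scaleC "m_proj h P E \<Gamma>" by (rule linear_m_proj)
  consider "\<alpha> + \<beta> = 0" | "\<alpha> + \<beta> \<in> R" | "\<alpha> + \<beta> \<noteq> 0" "\<alpha> + \<beta> \<notin> R" by blast
  then show ?thesis
  proof cases
    case 1
    then have "\<beta> = - \<alpha>" by (simp add: add_eq_0_iff)
    moreover have "0 \<notin> S" using S_R roots_nonzero by blast
    ultimately show ?thesis using m_proj_h[OF T_in_h[OF assms(1)]] by (simp add: T_def)
  next
    case 2
    then show ?thesis using assms by (simp add: bracket_E pr.scale m_proj_E)
  next
    case 3
    then show ?thesis using assms S_R by (auto simp: bracket_E_0)
  qed
qed

end

section \<open>Multilinear algebra of polyvectors\<close>

lemma wedge_equiv_refl: "wedge_equiv A A"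
  by (rule equivp_reflp[OF equivp_wedge_equiv])

lemma wedge_add: "wedge (us @ (a + b) # ws) = wedge (us @ a # ws) + wedge (us @ b # ws)"
  by transfer (simp add: wedge_equiv_def wedge_relation_add flip: diff_diff_eq)

lemma wedge_scale: "wedge (us @ scaleC c a # ws) = pv_scale c (wedge (us @ a # ws))"
  by transfer (simp add: wedge_equiv_def wedge_relation_scale)

lemma wedge_alt: "wedge (us @ a # a # ws) = 0"
  by transfer (simp add: wedge_equiv_def wedge_relation_alt)

lemma wedge_zero: "wedge (us @ 0 # ws) = 0"
  using wedge_scale[of us 0 0 ws] by simp

lemma wedge_swap: "wedge (us @ a # b # ws) = - wedge (us @ b # a # ws)"
proof -
  have "0 = wedge (us @ (a + b) # (a + b) # ws)" by (simp only: wedge_alt)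
  also have "\<dots> = wedge (us @ a # b # ws) + wedge (us @ b # a # ws)"
    using wedge_add[of "us @ [a]" a b ws] wedge_add[of "us @ [b]" a b ws] wedge_add[of us a b "(a + b) # ws"]
    by (simp add: wedge_alt)
  finally show ?thesis by (simp add: eq_neg_iff_add_eq_0)
qed

lemma wedge_rotate: "wedge [x, y, z] = wedge [y, z, x]"
  using wedge_swap[of "[]" x y "[z]"] wedge_swap[of "[y]" x z "[]"] by simp

interpretation schouten_left: Vector_Spaces.linear pv_scale pv_scale
  "\<lambda>A. schouten A (B :: 'g::complex_lie_algebra polyvector)" for B
proof
  fix A A' :: "'g polyvector" and c
  show "schouten (A + A') B = schouten A B + schouten A' B"
    by transfer (simp add: schouten_formal_def formal_extend_add wedge_equiv_refl)
  show "schouten (pv_scale c A) B = pv_scale c (schouten A B)"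
    by transfer (simp add: schouten_formal_def formal_extend_scale wedge_equiv_refl)
qed

interpretation schouten_right: Vector_Spaces.linear pv_scale pv_scale
  "schouten (A :: 'g::complex_lie_algebra polyvector)" for A
proof
  have add: "formal_extend (\<lambda>xs. F xs + G xs) A = formal_extend F A + formal_extend G A"
    for F G :: "'g list \<Rightarrow> 'g formal" and A
    by (simp add: formal_extend_def formal.scale_right_distrib sum.distrib)
  fix B B' :: "'g polyvector" and c
  show "schouten A (B + B') = schouten A B + schouten A B'"
    by transfer (simp add: schouten_formal_def formal_extend_add add wedge_equiv_refl)
  show "schouten A (pv_scale c B) = pv_scale c (schouten A B)"
    by transfer (simp add: schouten_formal_def formal_extend_scale formal_extend_fun_scale wedge_equiv_refl)
qed

interpretation wedge_map: Vector_Spaces.linear pv_scale pv_scale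
  "wedge_map (f :: 'g::complex_lie_algebra \<Rightarrow> 'g)" for f
proof
  fix A B :: "'g polyvector" and c
  show "wedge_map f (A + B) = wedge_map f A + wedge_map f B"
    by transfer (simp add: formal_extend_add wedge_equiv_refl)
  show "wedge_map f (pv_scale c A) = pv_scale c (wedge_map f A)"
    by transfer (simp add: formal_extend_scale wedge_equiv_refl)
qed

lemma schouten_bivectors:
  "schouten (wedge [x1, x2]) (wedge [y1, y2]) =
     wedge [lie_bracket x1 y1, x2, y2] - wedge [lie_bracket x1 y2, x2, y1]
     - wedge [lie_bracket x2 y1, x1, y2] + wedge [lie_bracket x2 y2, x1, y1]"
  by (simp add: schouten_wedge del_nth_def numeral_2_eq_2 algebra_simps)

lemma schouten_vector_bivector:
  "schouten (wedge [x]) (wedge [y1, y2]) =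
     wedge [lie_bracket x y1, y2] - wedge [lie_bracket x y2, y1]"
  by (simp add: schouten_wedge del_nth_def numeral_2_eq_2 algebra_simps)

text \<open>An alternating form on words extends to polyvectors. This is how coefficients of a polyvector
  are read off in spite of the relations.\<close>

definition alternating :: "('g::complex_lie_algebra list \<Rightarrow> complex) \<Rightarrow> bool" where
  "alternating d \<longleftrightarrow>
     (\<forall>us a b ws. d (us @ (a + b) # ws) = d (us @ a # ws) + d (us @ b # ws)) \<and>
     (\<forall>us c a ws. d (us @ scaleC c a # ws) = c * d (us @ a # ws)) \<and>
     (\<forall>us a ws. d (us @ a # a # ws) = 0)"

lemma alternating_sum_zero:
  fixes a :: "'i \<Rightarrow> complex" and xs :: "'i \<Rightarrow> 'g::complex_lie_algebra list"
  assumes d: "alternating d" and I: "finite I"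
    and zero: "(\<Sum>i\<in>I. pv_scale (a i) (wedge (xs i))) = 0"
  shows "(\<Sum>i\<in>I. a i * d (xs i)) = 0"
proof -
  define ev where "ev A = (\<Sum>xs\<in>Poly_Mapping.keys A. Poly_Mapping.lookup A xs * d xs)" for A
  have ev_superset: "ev A = (\<Sum>xs\<in>X. Poly_Mapping.lookup A xs * d xs)"
    if "finite X" "Poly_Mapping.keys A \<subseteq> X" for A X
    unfolding ev_def by (rule sum.mono_neutral_left) (use that in \<open>auto simp: in_keys_iff\<close>)
  have ev_add: "ev (A + B) = ev A + ev B" for A B
  proof -
    let ?X = "Poly_Mapping.keys A \<union> Poly_Mapping.keys B"
    have "Poly_Mapping.keys (A + B) \<subseteq> ?X" by (rule Poly_Mapping.keys_add)
    then show ?thesis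
      by (simp add: ev_superset[of ?X] lookup_add distrib_right sum.distrib)
  qed
  have ev_scale: "ev (formal_scale c A) = c * ev A" for c A
  proof -
    have "Poly_Mapping.keys (formal_scale c A) \<subseteq> Poly_Mapping.keys A"
      by (auto simp: in_keys_iff)
    then show ?thesis
      by (simp add: ev_superset[of "Poly_Mapping.keys A"] sum_distrib_left mult.assoc)
  qed
  have ev_zero: "ev 0 = 0" and ev_word: "ev (word ys) = d ys" for ys by (simp_all add: ev_def)
  have ev_diff: "ev (A - B) = ev A - ev B" for A B
    using ev_add[of "A - B" B] by simp
  have relations: "ev A = 0" if "A \<in> wedge_relations" for A
    using that
  proof (induction rule: formal.span_induct_alt)
    case (step c x y)
    have "ev x = 0"
      using step.hyps d by (auto simp: wedge_relators_def alternating_def ev_diff ev_scale ev_word)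
    then show ?case using step.IH by (simp add: ev_add ev_scale)
  qed (rule ev_zero)
  define A where "A = (\<Sum>i\<in>I. formal_scale (a i) (word (xs i)))"
  have "abs_polyvector (\<Sum>i\<in>J. formal_scale (a i) (word (xs i))) = (\<Sum>i\<in>J. pv_scale (a i) (wedge (xs i)))" for J
    by (induction J rule: infinite_finite_induct)
      (simp_all add: wedge.abs_eq pv_scale.abs_eq plus_polyvector.abs_eq[symmetric] zero_polyvector.abs_eq[symmetric])
  then have "abs_polyvector A = abs_polyvector 0"
    using zero by (simp add: A_def zero_polyvector.abs_eq)
  then have "wedge_equiv A 0" by (simp add: polyvector.abs_eq_iff)
  then have "ev A = 0" by (intro relations) (simp add: wedge_equiv_def)
  moreover have "ev (\<Sum>i\<in>J. formal_scale (a i) (word (xs i))) = (\<Sum>i\<in>J. a i * d (xs i))" for J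
    by (induction J rule: infinite_finite_induct) (simp_all add: ev_zero ev_add ev_scale ev_word)
  ultimately show ?thesis by (simp add: A_def)
qed

definition det3 :: "('g \<Rightarrow> complex) \<Rightarrow> ('g \<Rightarrow> complex) \<Rightarrow> ('g \<Rightarrow> complex) \<Rightarrow> 'g list \<Rightarrow> complex" where
  "det3 f g k xs = (if length xs = 3 then
       f (xs ! 0) * (g (xs ! 1) * k (xs ! 2) - g (xs ! 2) * k (xs ! 1))
     + f (xs ! 1) * (g (xs ! 2) * k (xs ! 0) - g (xs ! 0) * k (xs ! 2))
     + f (xs ! 2) * (g (xs ! 0) * k (xs ! 1) - g (xs ! 1) * k (xs ! 0)) else 0)"

lemma alternating_det3:
  assumes add: "\<And>x y. f (x + y) = f x + f y" "\<And>x y. g (x + y) = g x + g y" "\<And>x y. k (x + y) = k x + k y"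
    and scale: "\<And>c x. f (scaleC c x) = c * f x" "\<And>c x. g (scaleC c x) = c * g x" "\<And>c x. k (scaleC c x) = c * k x"
  shows "alternating (det3 f g (k :: 'g::complex_lie_algebra \<Rightarrow> complex))"
proof -
  have cases: "length us + length ws \<noteq> 2 \<or> (\<exists>p q. us = [] \<and> ws = [p, q]) \<or>
      (\<exists>p q. us = [p] \<and> ws = [q]) \<or> (\<exists>p q. us = [p, q] \<and> ws = [])" for us ws :: "'g list"
    by (cases us; cases "tl us"; cases ws; cases "tl ws") auto
  have "det3 f g k (us @ (a + b) # ws) = det3 f g k (us @ a # ws) + det3 f g k (us @ b # ws)" for us a b ws
    using cases[of us ws] by (auto simp: det3_def add algebra_simps)
  moreover have "det3 f g k (us @ scaleC c a # ws) = c * det3 f g k (us @ a # ws)" for us c a ws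
    using cases[of us ws] by (auto simp: det3_def scale algebra_simps)
  moreover have "det3 f g k (us @ a # a # ws) = 0" for us a ws
    using cases[of us "a # ws"] by (auto simp: det3_def algebra_simps)
  ultimately show ?thesis unfolding alternating_def by blast
qed

lemma sum_odd_involution:
  fixes g :: "'i \<Rightarrow> 'g::complex_lie_algebra polyvector"
  assumes "\<And>i. i \<in> I \<Longrightarrow> \<tau> i \<in> I" "\<And>i. i \<in> I \<Longrightarrow> \<tau> (\<tau> i) = i" "\<And>i. i \<in> I \<Longrightarrow> g (\<tau> i) = - g i"
  shows "(\<Sum>i\<in>I. g i) = 0"
proof -
  have "(\<Sum>i\<in>I. g i) = (\<Sum>i\<in>I. - g i)"
    by (rule sum.reindex_bij_witness[where i = \<tau> and j = \<tau>]) (use assms in auto)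
  then have "(\<Sum>i\<in>I. g i) + (\<Sum>i\<in>I. g i) = 0"
    unfolding sum_negf by (simp only: eq_neg_iff_add_eq_0)
  then have "pv_scale (1 + 1) (\<Sum>i\<in>I. g i) = 0" by (simp only: pv.scale_left_distrib pv.scale_one)
  then show ?thesis by simp
qed

lemma sum_symmetric:
  fixes f :: "'i::ab_group_add \<Rightarrow> 'a::comm_monoid_add"
  assumes "finite A" "A \<inter> uminus ` A = {}"
  shows "(\<Sum>\<alpha>\<in>A \<union> uminus ` A. f \<alpha>) = (\<Sum>\<alpha>\<in>A. f \<alpha> + f (- \<alpha>))"
  using assms by (simp add: sum.union_disjoint sum.reindex sum.distrib)

text \<open>If the coefficients are an odd function of the root, then the signs disappear: the four terms in the
  bracket of two bivectors are one expression, summed over the choices of \<open>\<plusminus> \<alpha>\<close> and \<open>\<plusminus> \<beta>\<close>.\<close>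

lemma schouten_symmetric_bivector:
  fixes c :: "('g::complex_lie_algebra \<Rightarrow> complex) \<Rightarrow> complex"
  assumes A: "finite A" "A \<inter> uminus ` A = {}" and odd: "\<And>\<alpha>. \<alpha> \<in> A \<Longrightarrow> c (- \<alpha>) = - c \<alpha>"
    and v: "v = (\<Sum>\<alpha>\<in>A. pv_scale (c \<alpha>) (wedge [E \<alpha>, E (- \<alpha>)]))"
  shows "schouten v v = (\<Sum>\<alpha>\<in>A \<union> uminus ` A. \<Sum>\<beta>\<in>A \<union> uminus ` A.
      pv_scale (c \<alpha> * c \<beta>) (wedge [lie_bracket (E \<alpha>) (E \<beta>), E (- \<alpha>), E (- \<beta>)]))"
    and "schouten (wedge [x]) v =
      (\<Sum>\<alpha>\<in>A \<union> uminus ` A. pv_scale (c \<alpha>) (wedge [lie_bracket x (E \<alpha>), E (- \<alpha>)]))"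
proof -
  show "schouten v v = (\<Sum>\<alpha>\<in>A \<union> uminus ` A. \<Sum>\<beta>\<in>A \<union> uminus ` A.
      pv_scale (c \<alpha> * c \<beta>) (wedge [lie_bracket (E \<alpha>) (E \<beta>), E (- \<alpha>), E (- \<beta>)]))"
    unfolding v unfolding schouten_left.sum schouten_left.scale
    unfolding schouten_right.sum schouten_right.scale pv.scale_sum_right pv.scale_scale
      sum_symmetric[OF A] sum.distrib[symmetric] schouten_bivectors
    by (intro sum.cong[OF refl]) (simp add: odd pv.scale_right_distrib pv.scale_right_diff_distrib)
  show "schouten (wedge [x]) v =
      (\<Sum>\<alpha>\<in>A \<union> uminus ` A. pv_scale (c \<alpha>) (wedge [lie_bracket x (E \<alpha>), E (- \<alpha>)]))"
    unfolding v schouten_right.sum schouten_right.scale sum_symmetric[OF A] schouten_vector_bivector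
    by (intro sum.cong[OF refl]) (simp add: odd pv.scale_right_diff_distrib)
qed

section \<open>The Schouten bracket of an invariant bivector\<close>

lemmas wedge_scale_head = wedge_scale[of "[]", unfolded append_Nil]
  and wedge_zero_head = wedge_zero[of "[]", unfolded append_Nil]
  and wedge_add_head = wedge_add[of "[]", unfolded append_Nil]

lemma wedge_neg_head: "wedge (- a # ws) = - wedge (a # ws)"
  using wedge_scale_head[of "- 1" a ws] by simp

lemma wedge_zero_entry: "wedge [x, 0, z] = 0" "wedge [x, y, 0] = 0"
  using wedge_zero[of "[x]" "[z]"] wedge_zero[of "[x, y]" "[]"] by simp_all

lemma wedge_pair_swap: "wedge [u, w] = - wedge [w, u]"
  using wedge_swap[of "[]" u w "[]"] by simp

context levi_subset
begin

definition triples :: "(('g \<Rightarrow> complex) \<times> ('g \<Rightarrow> complex) \<times> ('g \<Rightarrow> complex)) set" where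
  "triples = {(\<alpha>, \<beta>, \<gamma>). \<alpha> \<in> S \<and> \<beta> \<in> S \<and> \<gamma> \<in> S \<and> \<alpha> + \<beta> + \<gamma> = 0}"

text \<open>The structure constant in symmetric form. By the invariance of the Killing form it is totally
  antisymmetric in the three roots. So is the exterior product in \<open>triple_vector\<close>, and \<open>triple_vector\<close>
  is symmetric.\<close>

definition triple_const :: "('g \<Rightarrow> complex) \<Rightarrow> ('g \<Rightarrow> complex) \<Rightarrow> ('g \<Rightarrow> complex) \<Rightarrow> complex" where
  "triple_const \<alpha> \<beta> \<gamma> = killing (lie_bracket (E \<alpha>) (E \<beta>)) (E \<gamma>)"

definition triple_vector :: "('g \<Rightarrow> complex) \<Rightarrow> ('g \<Rightarrow> complex) \<Rightarrow> ('g \<Rightarrow> complex) \<Rightarrow> 'g polyvector" where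
  "triple_vector \<alpha> \<beta> \<gamma> = pv_scale (triple_const \<alpha> \<beta> \<gamma>) (wedge [E (- \<gamma>), E (- \<alpha>), E (- \<beta>)])"

lemma finite_triples: "finite triples"
  by (rule finite_subset[of _ "S \<times> S \<times> S"]) (auto simp: triples_def finite_S)

lemma triplesD:
  assumes "(\<alpha>, \<beta>, \<gamma>) \<in> triples"
  shows "\<alpha> \<in> S" "\<beta> \<in> S" "\<gamma> \<in> S" "\<alpha> + \<beta> + \<gamma> = 0" "\<gamma> = - (\<alpha> + \<beta>)" "\<alpha> + \<beta> = - \<gamma>"
    "(\<beta>, \<gamma>, \<alpha>) \<in> triples" "(\<beta>, \<alpha>, \<gamma>) \<in> triples"
proof -
  show 1: "\<alpha> \<in> S" "\<beta> \<in> S" "\<gamma> \<in> S" and 2: "\<alpha> + \<beta> + \<gamma> = 0" using assms by (auto simp: triples_def)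
  show 3: "\<alpha> + \<beta> = - \<gamma>" using 2 by (simp only: eq_neg_iff_add_eq_0)
  show "\<gamma> = - (\<alpha> + \<beta>)" by (simp only: 3 minus_minus)
  show "(\<beta>, \<gamma>, \<alpha>) \<in> triples" "(\<beta>, \<alpha>, \<gamma>) \<in> triples"
    using 1 2 by (simp_all add: triples_def add_ac)
qed

lemma triples_neg:
  assumes "(\<alpha>, \<beta>, \<gamma>) \<in> triples" shows "(- \<alpha>, - \<beta>, - \<gamma>) \<in> triples"
proof -
  have "- \<alpha> + - \<beta> + - \<gamma> = - (\<alpha> + \<beta> + \<gamma>)" by simp
  also have "\<dots> = 0" by (simp only: triplesD(4)[OF assms] minus_zero)
  finally show ?thesis unfolding triples_def using triplesD(1-3)[OF assms, THEN S_neg] by blast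
qed

lemma triple_const_cyclic: "triple_const \<beta> \<gamma> \<alpha> = triple_const \<alpha> \<beta> \<gamma>"
  unfolding triple_const_def by (subst killing_comm) (simp only: killing_inv)

lemma triple_const_swap: "triple_const \<beta> \<alpha> \<gamma> = - triple_const \<alpha> \<beta> \<gamma>"
  unfolding triple_const_def by (subst lie_bracket_anticomm) simp

lemma triple_vector_cyclic: "triple_vector \<beta> \<gamma> \<alpha> = triple_vector \<alpha> \<beta> \<gamma>"
  by (simp only: triple_vector_def triple_const_cyclic[of \<beta> \<gamma> \<alpha>]
      wedge_rotate[of "E (- \<gamma>)" "E (- \<alpha>)" "E (- \<beta>)"])

lemma struct_const_triple: "struct_const \<alpha> \<beta> = triple_const \<alpha> \<beta> (- (\<alpha> + \<beta>))"
  by (simp add: struct_const_def triple_const_def)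

lemma struct_const_shift: "struct_const \<gamma> (- (\<gamma> + \<alpha>)) = - struct_const \<gamma> \<alpha>"
proof -
  let ?\<beta> = "- (\<gamma> + \<alpha>)"
  have eq: "\<gamma> + ?\<beta> = - \<alpha>" by simp
  have "struct_const \<gamma> ?\<beta> = triple_const \<gamma> ?\<beta> \<alpha>" by (simp only: struct_const_triple eq minus_minus)
  also have "\<dots> = - triple_const \<gamma> \<alpha> ?\<beta>"
    by (simp only: triple_const_cyclic[of \<gamma> ?\<beta> \<alpha>] triple_const_swap[of \<alpha> \<gamma> ?\<beta>])
  also have "\<dots> = - struct_const \<gamma> \<alpha>" by (simp only: struct_const_triple)
  finally show ?thesis .
qed

lemma triple_const_nonzero:
  assumes "(\<alpha>, \<beta>, \<gamma>) \<in> triples" shows "triple_const \<alpha> \<beta> \<gamma> \<noteq> 0"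
proof -
  note t = triplesD[OF assms]
  have R: "\<alpha> \<in> R" "\<beta> \<in> R" "\<alpha> + \<beta> \<in> R"
    using t(1-3) S_R S_neg unfolding t(6) by blast+
  then have "struct_const \<alpha> \<beta> \<noteq> 0"
    using bracket_root_vectors_nonzero[OF R] bracket_E[OF R] by auto
  then show ?thesis by (simp only: struct_const_triple t(5) not_False_eq_True)
qed

lemma sum_triples:
  fixes g :: "_ \<Rightarrow> _ \<Rightarrow> _ \<Rightarrow> 'b::comm_monoid_add"
  shows "(\<Sum>\<alpha>\<in>S. \<Sum>\<beta>\<in>S. if \<alpha> + \<beta> \<in> S then g \<alpha> \<beta> (- (\<alpha> + \<beta>)) else 0) =
    (\<Sum>(\<alpha>, \<beta>, \<gamma>)\<in>triples. g \<alpha> \<beta> \<gamma>)"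
proof -
  have "(\<Sum>\<alpha>\<in>S. \<Sum>\<beta>\<in>S. if \<alpha> + \<beta> \<in> S then g \<alpha> \<beta> (- (\<alpha> + \<beta>)) else 0) =
      (\<Sum>(\<alpha>, \<beta>)\<in>S \<times> S. if \<alpha> + \<beta> \<in> S then g \<alpha> \<beta> (- (\<alpha> + \<beta>)) else 0)"
    by (rule sum.cartesian_product)
  also have "\<dots> = (\<Sum>(\<alpha>, \<beta>)\<in>{(\<alpha>, \<beta>) \<in> S \<times> S. \<alpha> + \<beta> \<in> S}. g \<alpha> \<beta> (- (\<alpha> + \<beta>)))"
    by (rule sum.mono_neutral_cong_right) (auto simp: finite_S split: if_splits)
  also have "\<dots> = (\<Sum>(\<alpha>, \<beta>, \<gamma>)\<in>triples. g \<alpha> \<beta> \<gamma>)"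
  proof (rule sum.reindex_bij_witness[where i = "\<lambda>(\<alpha>, \<beta>, \<gamma>). (\<alpha>, \<beta>)" and j = "\<lambda>(\<alpha>, \<beta>). (\<alpha>, \<beta>, - (\<alpha> + \<beta>))"])
    fix p assume p: "p \<in> {(\<alpha>, \<beta>) \<in> S \<times> S. \<alpha> + \<beta> \<in> S}"
    then obtain \<alpha> \<beta> where ab: "p = (\<alpha>, \<beta>)" "\<alpha> \<in> S" "\<beta> \<in> S" "\<alpha> + \<beta> \<in> S" by blast
    then have "(\<alpha>, \<beta>, - (\<alpha> + \<beta>)) \<in> triples"
      unfolding triples_def using S_neg[OF ab(4)] right_minus[of "\<alpha> + \<beta>"] by blast
    then show "(case p of (\<alpha>, \<beta>) \<Rightarrow> (\<alpha>, \<beta>, - (\<alpha> + \<beta>))) \<in> triples" by (simp only: ab(1) prod.case)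
  next
    fix t assume "t \<in> triples"
    then obtain \<alpha> \<beta> \<gamma> where t: "t = (\<alpha>, \<beta>, \<gamma>)" "(\<alpha>, \<beta>, \<gamma>) \<in> triples" by (cases t) auto
    note T = triplesD[OF t(2)]
    show "(case case t of (\<alpha>, \<beta>, \<gamma>) \<Rightarrow> (\<alpha>, \<beta>) of (\<alpha>, \<beta>) \<Rightarrow> (\<alpha>, \<beta>, - (\<alpha> + \<beta>))) = t"
      by (simp only: t(1) prod.case T(5)[symmetric])
    show "(case t of (\<alpha>, \<beta>, \<gamma>) \<Rightarrow> (\<alpha>, \<beta>)) \<in> {(\<alpha>, \<beta>) \<in> S \<times> S. \<alpha> + \<beta> \<in> S}"
      using T(1,2,6) S_neg[OF T(3)] by (simp only: t(1) prod.case mem_Collect_eq mem_Sigma_iff simp_thms)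
  qed auto
  finally show ?thesis .
qed

lemma sum_triples_cyclic:
  fixes g :: "_ \<Rightarrow> _ \<Rightarrow> _ \<Rightarrow> 'b::comm_monoid_add"
  shows "(\<Sum>(\<alpha>, \<beta>, \<gamma>)\<in>triples. g \<alpha> \<beta> \<gamma>) = (\<Sum>(\<alpha>, \<beta>, \<gamma>)\<in>triples. g \<beta> \<gamma> \<alpha>)"
  by (rule sum.reindex_bij_witness[where i = "\<lambda>(\<alpha>, \<beta>, \<gamma>). (\<beta>, \<gamma>, \<alpha>)" and j = "\<lambda>(\<alpha>, \<beta>, \<gamma>). (\<gamma>, \<alpha>, \<beta>)"])
    (auto simp: triples_def add_ac)

definition pair_sum :: "(('g \<Rightarrow> complex) \<Rightarrow> complex) \<Rightarrow> ('g \<Rightarrow> complex) \<Rightarrow> ('g \<Rightarrow> complex) \<Rightarrow> ('g \<Rightarrow> complex) \<Rightarrow> complex" where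
  "pair_sum c \<alpha> \<beta> \<gamma> = c \<alpha> * c \<beta> + c \<beta> * c \<gamma> + c \<gamma> * c \<alpha>"

text \<open>The projection kills all terms except those in which \<open>\<alpha>\<close>, \<open>\<beta>\<close> and \<open>\<alpha> + \<beta>\<close> are roots of the complement.
  The factor 3 comes from averaging over the cyclic permutations of the triples.\<close>

lemma schouten_M_triples:
  assumes A: "finite A" "A \<inter> uminus ` A = {}" "S \<subseteq> A \<union> uminus ` A" "A \<union> uminus ` A \<subseteq> R"
    and odd: "\<And>\<alpha>. \<alpha> \<in> A \<Longrightarrow> c (- \<alpha>) = - c \<alpha>"
    and v: "v = (\<Sum>\<alpha>\<in>A. pv_scale (c \<alpha>) (wedge [E \<alpha>, E (- \<alpha>)]))"
  shows "pv_scale 3 (schouten_M h P E \<Gamma> v v) =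
    (\<Sum>(\<alpha>, \<beta>, \<gamma>)\<in>triples. pv_scale (pair_sum c \<alpha> \<beta> \<gamma>) (triple_vector \<alpha> \<beta> \<gamma>))"
proof -
  let ?A = "A \<union> uminus ` A" and ?pr = "m_proj h P E \<Gamma>"
  define t where "t \<alpha> \<beta> = wedge [?pr (lie_bracket (E \<alpha>) (E \<beta>)), ?pr (E (- \<alpha>)), ?pr (E (- \<beta>))]" for \<alpha> \<beta>
  have t: "t \<alpha> \<beta> = (if \<alpha> + \<beta> \<in> S then triple_vector \<alpha> \<beta> (- (\<alpha> + \<beta>)) else 0)"
    if "\<alpha> \<in> S" "\<beta> \<in> S" for \<alpha> \<beta>
    using that S_R S_neg
    by (simp add: t_def m_proj_bracket m_proj_E R_neg triple_vector_def struct_const_triple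
        wedge_scale_head wedge_zero_head del: minus_add_distrib)
  then have scaled: "pv_scale k (t \<alpha> \<beta>) =
      (if \<alpha> + \<beta> \<in> S then pv_scale k (triple_vector \<alpha> \<beta> (- (\<alpha> + \<beta>))) else 0)"
    if "\<alpha> \<in> S" "\<beta> \<in> S" for k \<alpha> \<beta>
    using that by (cases "\<alpha> + \<beta> \<in> S") (simp_all only: if_True if_False pv.scale_zero_right)
  have t0: "t \<alpha> \<beta> = 0" if "\<alpha> \<notin> S \<or> \<beta> \<notin> S" "\<alpha> \<in> R" "\<beta> \<in> R" for \<alpha> \<beta>
  proof -
    have "- \<alpha> \<notin> S \<or> - \<beta> \<notin> S" using that(1) S_neg by (metis minus_minus)
    then show ?thesis
      using that(2,3) by (auto simp: t_def m_proj_E R_neg wedge_zero_entry)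
  qed
  have finA: "finite ?A" using A(1) by simp
  have inner: "(\<Sum>\<beta>\<in>?A. pv_scale (c \<alpha> * c \<beta>) (t \<alpha> \<beta>)) = (\<Sum>\<beta>\<in>S. pv_scale (c \<alpha> * c \<beta>) (t \<alpha> \<beta>))"
    if "\<alpha> \<in> S" for \<alpha>
    by (rule sum.mono_neutral_right[OF finA A(3)])
      (intro ballI, subst t0, use that S_R subsetD[OF A(4)] in \<open>simp_all only: Diff_iff simp_thms pv.scale_zero_right\<close>)
  have outer: "(\<Sum>\<beta>\<in>?A. pv_scale (c \<alpha> * c \<beta>) (t \<alpha> \<beta>)) = 0" if "\<alpha> \<in> ?A - S" for \<alpha>
    by (intro sum.neutral ballI, subst t0, use that subsetD[OF A(4)] in \<open>simp_all only: Diff_iff simp_thms pv.scale_zero_right\<close>)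
  have "schouten_M h P E \<Gamma> v v = (\<Sum>\<alpha>\<in>?A. \<Sum>\<beta>\<in>?A. pv_scale (c \<alpha> * c \<beta>) (t \<alpha> \<beta>))"
    by (simp add: schouten_M_def schouten_symmetric_bivector(1)[OF A(1,2) odd v] wedge_map.sum
        wedge_map.scale wedge_map_wedge[OF linear_m_proj] t_def)
  also have "\<dots> = (\<Sum>\<alpha>\<in>S. \<Sum>\<beta>\<in>?A. pv_scale (c \<alpha> * c \<beta>) (t \<alpha> \<beta>))"
    by (rule sum.mono_neutral_right[OF finA A(3)]) (use outer in blast)
  also have "\<dots> = (\<Sum>\<alpha>\<in>S. \<Sum>\<beta>\<in>S. if \<alpha> + \<beta> \<in> S then pv_scale (c \<alpha> * c \<beta>) (triple_vector \<alpha> \<beta> (- (\<alpha> + \<beta>))) else 0)"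
  proof (rule sum.cong[OF refl])
    fix \<alpha> assume \<alpha>: "\<alpha> \<in> S"
    show "(\<Sum>\<beta>\<in>?A. pv_scale (c \<alpha> * c \<beta>) (t \<alpha> \<beta>)) =
        (\<Sum>\<beta>\<in>S. if \<alpha> + \<beta> \<in> S then pv_scale (c \<alpha> * c \<beta>) (triple_vector \<alpha> \<beta> (- (\<alpha> + \<beta>))) else 0)"
      unfolding inner[OF \<alpha>] by (rule sum.cong[OF refl scaled[OF \<alpha>]])
  qed
  also have "\<dots> = (\<Sum>(\<alpha>, \<beta>, \<gamma>)\<in>triples. pv_scale (c \<alpha> * c \<beta>) (triple_vector \<alpha> \<beta> \<gamma>))"
    by (rule sum_triples[of "\<lambda>\<alpha> \<beta> \<gamma>. pv_scale (c \<alpha> * c \<beta>) (triple_vector \<alpha> \<beta> \<gamma>)"])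
  finally have 1: "schouten_M h P E \<Gamma> v v = (\<Sum>(\<alpha>, \<beta>, \<gamma>)\<in>triples. pv_scale (c \<alpha> * c \<beta>) (triple_vector \<alpha> \<beta> \<gamma>))" .
  also have "\<dots> = (\<Sum>(\<alpha>, \<beta>, \<gamma>)\<in>triples. pv_scale (c \<beta> * c \<gamma>) (triple_vector \<beta> \<gamma> \<alpha>))"
    by (rule sum_triples_cyclic)
  also have 2: "\<dots> = (\<Sum>(\<alpha>, \<beta>, \<gamma>)\<in>triples. pv_scale (c \<beta> * c \<gamma>) (triple_vector \<alpha> \<beta> \<gamma>))"
    by (simp only: triple_vector_cyclic)
  finally have 2: "schouten_M h P E \<Gamma> v v = (\<Sum>(\<alpha>, \<beta>, \<gamma>)\<in>triples. pv_scale (c \<beta> * c \<gamma>) (triple_vector \<alpha> \<beta> \<gamma>))" .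
  also have "\<dots> = (\<Sum>(\<alpha>, \<beta>, \<gamma>)\<in>triples. pv_scale (c \<gamma> * c \<alpha>) (triple_vector \<beta> \<gamma> \<alpha>))"
    by (rule sum_triples_cyclic)
  also have "\<dots> = (\<Sum>(\<alpha>, \<beta>, \<gamma>)\<in>triples. pv_scale (c \<gamma> * c \<alpha>) (triple_vector \<alpha> \<beta> \<gamma>))"
    by (simp only: triple_vector_cyclic)
  finally have 3: "schouten_M h P E \<Gamma> v v = (\<Sum>(\<alpha>, \<beta>, \<gamma>)\<in>triples. pv_scale (c \<gamma> * c \<alpha>) (triple_vector \<alpha> \<beta> \<gamma>))" .
  have "pv_scale 3 x = x + x + x" for x :: "'g polyvector"
    using pv.scale_left_distrib[of 1 1 x] pv.scale_left_distrib[of 2 1 x] by simp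
  then have "pv_scale 3 (schouten_M h P E \<Gamma> v v) =
      schouten_M h P E \<Gamma> v v + schouten_M h P E \<Gamma> v v + schouten_M h P E \<Gamma> v v" .
  also have "\<dots> = (\<Sum>(\<alpha>, \<beta>, \<gamma>)\<in>triples. pv_scale (pair_sum c \<alpha> \<beta> \<gamma>) (triple_vector \<alpha> \<beta> \<gamma>))"
    by (subst (1) 1, subst (1) 2, subst 3)
      (simp add: sum.distrib[symmetric] case_prod_unfold pair_sum_def pv.scale_left_distrib)
  finally show ?thesis .
qed

text \<open>The bivector \<open>r\<close> has the coefficients \<open>\<plusminus> 1\<close>. The signs of three roots with sum 0 are not all equal,
  and then the three products of two of them have the sum \<open>- 1\<close>.\<close>

lemma three_phi_M:
  "pv_scale 3 (phi_M h P E \<Gamma>) = (\<Sum>(\<alpha>, \<beta>, \<gamma>)\<in>triples. pv_scale (- 1) (triple_vector \<alpha> \<beta> \<gamma>))"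
proof -
  define s where "s \<alpha> = (if \<alpha> \<in> P then 1 else -1 :: complex)" for \<alpha> :: "'g \<Rightarrow> complex"
  have s_neg: "s (- \<alpha>) = - s \<alpha>" if "\<alpha> \<in> R" for \<alpha>
    using R_cases[OF that] P_not_neg[of \<alpha>] by (auto simp: s_def)
  have r: "r_matrix P E = (\<Sum>\<alpha>\<in>P. pv_scale (s \<alpha>) (wedge [E \<alpha>, E (- \<alpha>)]))"
    by (simp add: r_matrix_def s_def)
  have "phi_M h P E \<Gamma> = schouten_M h P E \<Gamma> (r_matrix P E) (r_matrix P E)"
    by (simp add: phi_M_def phi_def schouten_M_def)
  also have "pv_scale 3 \<dots> = (\<Sum>(\<alpha>, \<beta>, \<gamma>)\<in>triples. pv_scale (pair_sum s \<alpha> \<beta> \<gamma>) (triple_vector \<alpha> \<beta> \<gamma>))"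
    by (rule schouten_M_triples[OF finite_P P_disjoint _ _ _ r])
      (use S_R R_union s_neg P_subset in auto)
  also have "\<dots> = (\<Sum>(\<alpha>, \<beta>, \<gamma>)\<in>triples. pv_scale (- 1) (triple_vector \<alpha> \<beta> \<gamma>))"
  proof (rule sum.cong[OF refl], clarify)
    fix \<alpha> \<beta> \<gamma> assume t: "(\<alpha>, \<beta>, \<gamma>) \<in> triples"
    note T = triplesD[OF t]
    have no_pos: False if "\<alpha> \<in> P" "\<beta> \<in> P" "\<gamma> \<in> P" "(\<alpha>, \<beta>, \<gamma>) \<in> triples" for \<alpha> \<beta> \<gamma>
    proof -
      have "\<alpha> + \<beta> \<in> P" using P_closed[OF that(1,2)] triplesD(3,6)[OF that(4)] S_R S_neg by simp
      then show False using triplesD(6)[OF that(4)] P_not_neg[OF that(3)] by simp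
    qed
    have neg: "(- \<alpha>, - \<beta>, - \<gamma>) \<in> triples" by (rule triples_neg[OF t])
    have "\<alpha> \<in> P \<or> - \<alpha> \<in> P" "\<beta> \<in> P \<or> - \<beta> \<in> P" "\<gamma> \<in> P \<or> - \<gamma> \<in> P"
      using T(1-3)[THEN S_R, THEN R_cases] by auto
    then have "pair_sum s \<alpha> \<beta> \<gamma> = - 1"
      using no_pos[OF _ _ _ t] no_pos[OF _ _ _ neg] P_not_neg
      by (auto simp: pair_sum_def s_def)
    then show "pv_scale (pair_sum s \<alpha> \<beta> \<gamma>) (triple_vector \<alpha> \<beta> \<gamma>) = pv_scale (- 1) (triple_vector \<alpha> \<beta> \<gamma>)"
      by simp
  qed
  finally show ?thesis .
qed

text \<open>The odd extension of the coefficients from positive to all roots.\<close>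

definition signed :: "(('g \<Rightarrow> complex) \<Rightarrow> complex) \<Rightarrow> ('g \<Rightarrow> complex) \<Rightarrow> complex" where
  "signed c \<alpha> = (if \<alpha> \<in> P then c (bar P \<Gamma> \<alpha>) else - c (bar P \<Gamma> (- \<alpha>)))"

lemma signed_neg: "\<alpha> \<in> R \<Longrightarrow> signed c (- \<alpha>) = - signed c \<alpha>"
  using R_cases[of \<alpha>] P_not_neg[of \<alpha>] by (auto simp: signed_def)

lemma Delta: "finite (P - L)" "(P - L) \<inter> uminus ` (P - L) = {}"
  using finite_P P_disjoint by auto

lemma bivector_signed:
  "bivector h P E \<Gamma> c = (\<Sum>\<alpha>\<in>P - L. pv_scale (signed c \<alpha>) (wedge [E \<alpha>, E (- \<alpha>)]))"
  unfolding bivector_def by (rule sum.cong) (auto simp: signed_def)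

lemma three_schouten_M_bivector:
  "pv_scale 3 (schouten_M h P E \<Gamma> (bivector h P E \<Gamma> c) (bivector h P E \<Gamma> c)) =
    (\<Sum>(\<alpha>, \<beta>, \<gamma>)\<in>triples. pv_scale (pair_sum (signed c) \<alpha> \<beta> \<gamma>) (triple_vector \<alpha> \<beta> \<gamma>))"
  by (rule schouten_M_triples[OF Delta _ _ _ bivector_signed])
    (use S_eq S_R signed_neg P_subset in auto)

text \<open>The six permutations of a triple have the same vector, so only symmetric coefficients can be
  recovered. The determinant of the linear forms dual to the three vectors of one triple picks
  out its coefficient six times.\<close>

lemma triple_vectors_independent:
  assumes zero: "(\<Sum>(\<alpha>, \<beta>, \<gamma>)\<in>triples. pv_scale (a \<alpha> \<beta> \<gamma>) (triple_vector \<alpha> \<beta> \<gamma>)) = 0"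
    and a: "\<And>\<alpha> \<beta> \<gamma>. a \<beta> \<gamma> \<alpha> = a \<alpha> \<beta> \<gamma>" "\<And>\<alpha> \<beta> \<gamma>. a \<beta> \<alpha> \<gamma> = a \<alpha> \<beta> \<gamma>"
    and t: "(\<alpha>, \<beta>, \<gamma>) \<in> triples"
  shows "a \<alpha> \<beta> \<gamma> = 0"
proof -
  define G where "G \<alpha> \<beta> \<gamma> = a \<alpha> \<beta> \<gamma> * triple_const \<alpha> \<beta> \<gamma>" for \<alpha> \<beta> \<gamma>
  have G: "G q r p = G p q r" "G q p r = - G p q r" for p q r
    by (simp_all add: G_def a(1)[of q r p] a(2)[of q p r] triple_const_cyclic[of q r p] triple_const_swap[of q p r])
  define d where "d = det3 (\<lambda>x. killing x (E \<alpha>)) (\<lambda>x. killing x (E \<beta>)) (\<lambda>x. killing x (E \<gamma>))"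
  have alt: "alternating d"
    unfolding d_def by (rule alternating_det3) (simp_all add: killing_add_left killing_scale_left)
  have "(\<Sum>t\<in>triples. pv_scale (case t of (p, q, r) \<Rightarrow> G p q r) (wedge (case t of (p, q, r) \<Rightarrow> [E (- r), E (- p), E (- q)]))) = 0"
    using zero by (simp add: triple_vector_def G_def case_prod_unfold)
  from alternating_sum_zero[OF alt finite_triples this]
  have sum0: "(\<Sum>(p, q, r)\<in>triples. G p q r * d [E (- r), E (- p), E (- q)]) = 0"
    by (simp add: case_prod_unfold)
  define e where "e x y = (if x = y then 1 else 0 :: complex)" for x y :: "'g \<Rightarrow> complex"
  define \<delta> where "\<delta> x y = (if x = y then 1 else 0 :: complex)" for x y :: "('g \<Rightarrow> complex) \<times> ('g \<Rightarrow> complex) \<times> ('g \<Rightarrow> complex)"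
  have pick: "(\<Sum>(p, q, r)\<in>triples. G p q r * \<delta> (p, q, r) (x, y, z)) = G x y z" if "(x, y, z) \<in> triples" for x y z
  proof -
    have "(\<Sum>(p, q, r)\<in>triples. G p q r * \<delta> (p, q, r) (x, y, z)) =
        (\<Sum>t\<in>triples. if t = (x, y, z) then G x y z else 0)"
      by (rule sum.cong) (auto simp: \<delta>_def split: if_splits)
    then show ?thesis using that finite_triples by simp
  qed
  have \<delta>: "\<delta> (p, q, r) (x, y, z) = e p x * e q y * e r z" for p q r x y z
    by (simp add: \<delta>_def e_def)
  have kd: "killing (E (- p)) (E x) = e p x" if "p \<in> R" "x \<in> R" for p x
    using killing_E_E[OF that(2,1)] killing_comm[of "E (- p)"] by (auto simp: e_def)
  have T: "\<alpha> \<in> R" "\<beta> \<in> R" "\<gamma> \<in> R" using triplesD(1-3)[OF t] S_R by auto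
  have "(\<Sum>(p, q, r)\<in>triples. G p q r * d [E (- r), E (- p), E (- q)]) =
      (\<Sum>(p, q, r)\<in>triples. G p q r * \<delta> (p, q, r) (\<alpha>, \<beta>, \<gamma>) + G p q r * \<delta> (p, q, r) (\<beta>, \<gamma>, \<alpha>)
        + G p q r * \<delta> (p, q, r) (\<gamma>, \<alpha>, \<beta>) - G p q r * \<delta> (p, q, r) (\<beta>, \<alpha>, \<gamma>)
        - G p q r * \<delta> (p, q, r) (\<alpha>, \<gamma>, \<beta>) - G p q r * \<delta> (p, q, r) (\<gamma>, \<beta>, \<alpha>))"
  proof (rule sum.cong[OF refl], clarify)
    fix p q r assume pqr: "(p, q, r) \<in> triples"
    have R: "p \<in> R" "q \<in> R" "r \<in> R" using triplesD(1-3)[OF pqr] S_R by auto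
    have "d [E (- r), E (- p), E (- q)] =
        \<delta> (p, q, r) (\<alpha>, \<beta>, \<gamma>) + \<delta> (p, q, r) (\<beta>, \<gamma>, \<alpha>) + \<delta> (p, q, r) (\<gamma>, \<alpha>, \<beta>)
        - \<delta> (p, q, r) (\<beta>, \<alpha>, \<gamma>) - \<delta> (p, q, r) (\<alpha>, \<gamma>, \<beta>) - \<delta> (p, q, r) (\<gamma>, \<beta>, \<alpha>)"
      unfolding d_def det3_def \<delta> using R T by (simp add: kd algebra_simps)
    then show "G p q r * d [E (- r), E (- p), E (- q)] =
        G p q r * \<delta> (p, q, r) (\<alpha>, \<beta>, \<gamma>) + G p q r * \<delta> (p, q, r) (\<beta>, \<gamma>, \<alpha>)
        + G p q r * \<delta> (p, q, r) (\<gamma>, \<alpha>, \<beta>) - G p q r * \<delta> (p, q, r) (\<beta>, \<alpha>, \<gamma>)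
        - G p q r * \<delta> (p, q, r) (\<alpha>, \<gamma>, \<beta>) - G p q r * \<delta> (p, q, r) (\<gamma>, \<beta>, \<alpha>)"
      by (simp only: ring_distribs)
  qed
  also have "\<dots> = G \<alpha> \<beta> \<gamma> + G \<beta> \<gamma> \<alpha> + G \<gamma> \<alpha> \<beta> - G \<beta> \<alpha> \<gamma> - G \<alpha> \<gamma> \<beta> - G \<gamma> \<beta> \<alpha>"
  proof -
    have t2: "(\<beta>, \<gamma>, \<alpha>) \<in> triples" "(\<gamma>, \<alpha>, \<beta>) \<in> triples" "(\<beta>, \<alpha>, \<gamma>) \<in> triples"
      "(\<alpha>, \<gamma>, \<beta>) \<in> triples" "(\<gamma>, \<beta>, \<alpha>) \<in> triples"
      using t triplesD(7,8) by blast+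
    show ?thesis
      using pick[OF t] pick[OF t2(1)] pick[OF t2(2)] pick[OF t2(3)] pick[OF t2(4)] pick[OF t2(5)]
      by (simp add: case_prod_unfold sum.distrib sum_subtractf)
  qed
  also have "\<dots> = 6 * G \<alpha> \<beta> \<gamma>"
    using G(1)[of \<beta> \<gamma> \<alpha>] G(1)[of \<gamma> \<alpha> \<beta>] G(2)[of \<beta> \<alpha> \<gamma>] G(1)[of \<alpha> \<gamma> \<beta>] G(1)[of \<gamma> \<beta> \<alpha>] by simp
  finally have "G \<alpha> \<beta> \<gamma> = 0" using sum0 by simp
  then show ?thesis using triple_const_nonzero[OF t] by (simp add: G_def)
qed

text \<open>Both sides are combinations of the vectors of the triples with symmetric coefficients, so they are
  compared coefficient by coefficient.\<close>

theorem schouten_M_bivector_iff: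
  "schouten_M h P E \<Gamma> (bivector h P E \<Gamma> c) (bivector h P E \<Gamma> c) = pv_scale (K\<^sup>2) (phi_M h P E \<Gamma>) \<longleftrightarrow>
    (\<forall>(\<alpha>, \<beta>, \<gamma>)\<in>triples. pair_sum (signed c) \<alpha> \<beta> \<gamma> = - K\<^sup>2)"
proof -
  let ?v = "bivector h P E \<Gamma> c"
  have diff: "pv_scale 3 (schouten_M h P E \<Gamma> ?v ?v) - pv_scale 3 (pv_scale (K\<^sup>2) (phi_M h P E \<Gamma>)) =
      (\<Sum>(\<alpha>, \<beta>, \<gamma>)\<in>triples. pv_scale (pair_sum (signed c) \<alpha> \<beta> \<gamma> + K\<^sup>2) (triple_vector \<alpha> \<beta> \<gamma>))"
    unfolding three_schouten_M_bivector pv.scale_left_commute[of 3] three_phi_M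
    by (simp add: pv.scale_sum_right sum_subtractf[symmetric] case_prod_unfold pv.scale_left_distrib)
  have "schouten_M h P E \<Gamma> ?v ?v = pv_scale (K\<^sup>2) (phi_M h P E \<Gamma>) \<longleftrightarrow>
      pv_scale 3 (schouten_M h P E \<Gamma> ?v ?v) - pv_scale 3 (pv_scale (K\<^sup>2) (phi_M h P E \<Gamma>)) = 0"
    unfolding right_minus_eq pv.scale_cancel_left by simp
  also have "\<dots> \<longleftrightarrow> (\<forall>(\<alpha>, \<beta>, \<gamma>)\<in>triples. pair_sum (signed c) \<alpha> \<beta> \<gamma> = - K\<^sup>2)"
    unfolding diff
  proof
    assume zero: "(\<Sum>(\<alpha>, \<beta>, \<gamma>)\<in>triples. pv_scale (pair_sum (signed c) \<alpha> \<beta> \<gamma> + K\<^sup>2) (triple_vector \<alpha> \<beta> \<gamma>)) = 0"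
    have "pair_sum (signed c) \<alpha> \<beta> \<gamma> + K\<^sup>2 = 0" if "(\<alpha>, \<beta>, \<gamma>) \<in> triples" for \<alpha> \<beta> \<gamma>
      by (rule triple_vectors_independent[OF zero _ _ that]) (simp_all add: pair_sum_def algebra_simps)
    then show "\<forall>(\<alpha>, \<beta>, \<gamma>)\<in>triples. pair_sum (signed c) \<alpha> \<beta> \<gamma> = - K\<^sup>2"
      by (auto simp: eq_neg_iff_add_eq_0)
  qed (auto intro!: sum.neutral)
  finally show ?thesis .
qed

section \<open>Invariance\<close>

text \<open>Otherwise the two positive roots \<open>\<alpha>\<close> and \<open>- (\<gamma> + \<alpha>)\<close> would have opposite images, hence image 0.\<close>

lemma levi_shift_positive:
  assumes \<gamma>: "\<gamma> \<in> L" and \<alpha>: "\<alpha> \<in> S" "\<alpha> \<in> P" and sum: "\<gamma> + \<alpha> \<in> R"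
  shows "\<gamma> + \<alpha> \<in> P"
proof (rule ccontr)
  assume "\<gamma> + \<alpha> \<notin> P"
  then have neg: "- (\<gamma> + \<alpha>) \<in> P" using R_cases[OF sum] by blast
  have "bar P \<Gamma> (- (\<gamma> + \<alpha>)) = - bar P \<Gamma> \<alpha>"
    using \<gamma> \<alpha> sum S_R by (simp only: bar_root_neg bar_root_add L_iff) simp
  then have "bar P \<Gamma> \<alpha> = 0"
    using bar_positive_add_zero[OF \<alpha>(2) neg] by simp
  then show False using \<alpha>(1) by (simp add: S_iff)
qed

lemma signed_levi_shift:
  assumes \<gamma>: "\<gamma> \<in> L" and \<alpha>: "\<alpha> \<in> S" and sum: "\<gamma> + \<alpha> \<in> R"
  shows "\<gamma> + \<alpha> \<in> S" "signed c (\<gamma> + \<alpha>) = signed c \<alpha>"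
proof -
  have R: "\<gamma> \<in> R" "\<alpha> \<in> R" "bar P \<Gamma> \<gamma> = 0" using \<gamma> \<alpha> by (auto simp: L_iff S_iff)
  have bar: "bar P \<Gamma> (\<gamma> + \<alpha>) = bar P \<Gamma> \<alpha>" using R by (simp add: bar_root_add)
  then show "\<gamma> + \<alpha> \<in> S" using \<alpha> sum by (simp add: S_iff)
  have bar': "bar P \<Gamma> (- (\<gamma> + \<alpha>)) = bar P \<Gamma> (- \<alpha>)"
    using bar sum R by (simp only: bar_root_neg)
  show "signed c (\<gamma> + \<alpha>) = signed c \<alpha>"
  proof (cases "\<alpha> \<in> P")
    case True
    then show ?thesis using levi_shift_positive[OF \<gamma> \<alpha> True sum] bar by (simp add: signed_def)
  next
    case False
    then have "- \<alpha> \<in> P" using R_cases[OF R(2)] by blast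
    moreover have "- \<gamma> + - \<alpha> = - (\<gamma> + \<alpha>)" by simp
    ultimately have "- (\<gamma> + \<alpha>) \<in> P"
      using levi_shift_positive[OF L_neg[OF \<gamma>] S_neg[OF \<alpha>]] R_neg[OF sum] by metis
    then have "\<gamma> + \<alpha> \<notin> P" using P_not_neg by fastforce
    then show ?thesis using False bar' by (simp add: signed_def)
  qed
qed

text \<open>The term of \<open>\<alpha>\<close> is cancelled by that of \<open>- \<alpha>\<close> under the action of \<open>h\<close>, and by that of \<open>- (\<gamma> + \<alpha>)\<close> under
  the action of \<open>E \<gamma>\<close>: the coefficients depend on the quasiroot only, and \<open>\<alpha>\<close> and \<open>\<gamma> + \<alpha>\<close> have the same.\<close>

lemma bivector_invariant:
  assumes x: "x \<in> levi_subalgebra h E \<Gamma>"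
  shows "schouten (wedge [x]) (bivector h P E \<Gamma> c) = 0"
  using x unfolding levi_subalgebra_eq
proof (induction rule: lie.span_induct)
  case base
  show ?case
    by (simp add: lie.subspace_def wedge_add_head wedge_scale_head wedge_zero_head
        schouten_left.add schouten_left.scale)
next
  case (step x)
  have eq: "schouten (wedge [x]) (bivector h P E \<Gamma> c) =
      (\<Sum>\<alpha>\<in>S. pv_scale (signed c \<alpha>) (wedge [lie_bracket x (E \<alpha>), E (- \<alpha>)]))"
    unfolding S_eq
    by (rule schouten_symmetric_bivector(2)[OF Delta _ bivector_signed])
      (use signed_neg P_subset in auto)
  from step consider "x \<in> h" | \<gamma> where "\<gamma> \<in> L" "x = E \<gamma>" by blast
  then show ?case
  proof cases
    case 1
    show ?thesis unfolding eq
    proof (rule sum_odd_involution[where \<tau> = uminus])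
      fix \<alpha> assume \<alpha>: "\<alpha> \<in> S"
      have br: "lie_bracket x (E \<beta>) = scaleC (\<beta> x) (E \<beta>)" if "\<beta> \<in> S" for \<beta>
        using root_spaceD[OF root_vectors 1] S_R that by blast
      show "pv_scale (signed c (- \<alpha>)) (wedge [lie_bracket x (E (- \<alpha>)), E (- (- \<alpha>))]) =
          - pv_scale (signed c \<alpha>) (wedge [lie_bracket x (E \<alpha>), E (- \<alpha>)])"
        using \<alpha> S_neg[OF \<alpha>] S_R
        by (simp add: br signed_neg wedge_scale_head wedge_neg_head wedge_pair_swap[of "E (- \<alpha>)" "E \<alpha>"])
    qed (use S_neg in auto)
  next
    case 2
    define S' where "S' = {\<alpha> \<in> S. \<gamma> + \<alpha> \<in> R}"
    let ?g = "\<lambda>\<alpha>. pv_scale (signed c \<alpha>) (wedge [lie_bracket x (E \<alpha>), E (- \<alpha>)])"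
    have \<gamma>: "\<gamma> \<in> R" using 2 L_R by blast
    have "?g \<alpha> = 0" if "\<alpha> \<in> S - S'" for \<alpha>
    proof -
      have "\<gamma> + \<alpha> \<noteq> 0" using that 2 L_neg[of \<gamma>] by (auto simp: add_eq_0_iff S_def)
      then show ?thesis
        using that S_R \<gamma> by (auto simp: 2(2) S'_def bracket_E_0 wedge_zero_head)
    qed
    then have "(\<Sum>\<alpha>\<in>S. ?g \<alpha>) = (\<Sum>\<alpha>\<in>S'. ?g \<alpha>)"
      by (intro sum.mono_neutral_right finite_S) (auto simp: S'_def)
    also have "\<dots> = 0"
    proof (rule sum_odd_involution[where \<tau> = "\<lambda>\<alpha>. - (\<gamma> + \<alpha>)"])
      fix \<alpha> assume "\<alpha> \<in> S'"
      then have \<alpha>: "\<alpha> \<in> S" "\<alpha> \<in> R" "\<gamma> + \<alpha> \<in> R" using S_R by (auto simp: S'_def)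
      let ?\<beta> = "- (\<gamma> + \<alpha>)"
      note shift = signed_levi_shift[OF 2(1) \<alpha>(1,3)]
      have \<beta>: "?\<beta> \<in> S" "?\<beta> \<in> R" "\<gamma> + ?\<beta> = - \<alpha>"
        using S_neg[OF shift(1)] R_neg[OF \<alpha>(3)] by (blast, blast, simp)
      show "?\<beta> \<in> S'" unfolding S'_def using \<beta> R_neg[OF \<alpha>(2)] by (simp del: minus_add_distrib)
      show "- (\<gamma> + ?\<beta>) = \<alpha>" unfolding \<beta>(3) by simp
      note st = struct_const_shift[of \<gamma> \<alpha>]
      have "?g ?\<beta> = pv_scale (signed c ?\<beta>) (wedge [scaleC (struct_const \<gamma> ?\<beta>) (E (- \<alpha>)), E (\<gamma> + \<alpha>)])"
        using bracket_E[OF \<gamma> \<beta>(2)] R_neg[OF \<alpha>(2)] by (simp only: 2(2) \<beta>(3) minus_minus)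
      also have "\<dots> = pv_scale (signed c \<alpha> * struct_const \<gamma> \<alpha>) (wedge [E (- \<alpha>), E (\<gamma> + \<alpha>)])"
        by (simp add: wedge_scale_head wedge_neg_head st signed_neg \<alpha>(3) shift(2) del: minus_add_distrib)
      also have "\<dots> = - pv_scale (signed c \<alpha>) (wedge [scaleC (struct_const \<gamma> \<alpha>) (E (\<gamma> + \<alpha>)), E (- \<alpha>)])"
        by (simp add: wedge_scale_head wedge_pair_swap[of "E (- \<alpha>)" "E (\<gamma> + \<alpha>)"])
      finally show "?g ?\<beta> = - ?g \<alpha>"
        using bracket_E[OF \<gamma> \<alpha>(2,3)] by (simp only: 2(2))
    qed
    finally show ?thesis unfolding eq .
  qed
qed

lemma bivector_invariant_field: "bivector h P E \<Gamma> c \<in> invariant_polyvector_fields 2 h P E \<Gamma>"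
proof -
  have "wedge [E \<alpha>, E (- \<alpha>)] \<in> exterior_power 2 (m_space h P E \<Gamma>)" if "\<alpha> \<in> P - L" for \<alpha>
    unfolding exterior_power_def m_space_eq
    using that S_eq by (intro pv.span_base) (auto intro!: exI[of _ "[E \<alpha>, E (- \<alpha>)]"] lie.span_base)
  then have "bivector h P E \<Gamma> c \<in> exterior_power 2 (m_space h P E \<Gamma>)"
    unfolding bivector_def exterior_power_def by (intro pv.span_sum pv.span_scale) auto
  then show ?thesis
    unfolding invariant_polyvector_fields_def using bivector_invariant by blast
qed

end

section \<open>The coefficient formula\<close>

lemma elem_sym_zero:
  assumes "i < 0 \<or> i > int (length cs)" shows "elem_sym i cs = 0"
proof -
  have "int (card I) \<noteq> i" if "I \<subseteq> {..<length cs}" for I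
    using card_mono[OF _ that] assms by auto
  then have "{I. I \<subseteq> {..<length cs} \<and> int (card I) = i} = {}" by blast
  then show ?thesis by (simp only: elem_sym_def sum.empty)
qed

lemma elem_sym_Nil: "elem_sym i [] = (if i = 0 then 1 else 0)"
proof -
  have "{I. I \<subseteq> {..<length ([] :: complex list)} \<and> int (card I) = i} = (if i = 0 then {{}} else {})" by auto
  then show ?thesis unfolding elem_sym_def by (simp only:) simp
qed

lemma elem_sym_Cons: "elem_sym i (c # cs) = elem_sym i cs + c * elem_sym (i - 1) cs"
proof -
  let ?A = "\<lambda>i. {I. I \<subseteq> {..<length cs} \<and> int (card I) = i}"
  let ?g = "\<lambda>I. insert 0 (Suc ` I)"
  have fin: "finite (?A i)" for i by (rule finite_subset[of _ "Pow {..<length cs}"]) auto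
  have card: "card (Suc ` I) = card I" for I by (simp add: card_image)
  have card': "card (?g I) = Suc (card I)" if "I \<subseteq> {..<length cs}" for I
    using finite_subset[OF that] card[of I] by simp
  have "{I. I \<subseteq> {..<length (c # cs)} \<and> int (card I) = i} = (`) Suc ` ?A i \<union> ?g ` ?A (i - 1)"
  proof (intro equalityI subsetI)
    fix I assume I: "I \<in> {I. I \<subseteq> {..<length (c # cs)} \<and> int (card I) = i}"
    define J where "J = {j. Suc j \<in> I}"
    have J: "J \<subseteq> {..<length cs}" using I by (auto simp: J_def)
    show "I \<in> (`) Suc ` ?A i \<union> ?g ` ?A (i - 1)"
    proof (cases "0 \<in> I")
      case True
      have "I = ?g J"
      proof (intro equalityI subsetI)
        show "x \<in> ?g J" if "x \<in> I" for x using that by (cases x) (auto simp: J_def)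
      qed (use True in \<open>auto simp: J_def\<close>)
      then show ?thesis using I J card'[OF J] by auto
    next
      case False
      have "I = Suc ` J"
      proof (intro equalityI subsetI)
        show "x \<in> Suc ` J" if "x \<in> I" for x using that False by (cases x) (auto simp: J_def)
      qed (auto simp: J_def)
      then show ?thesis using I J card[of J] by auto
    qed
  next
    fix I assume "I \<in> (`) Suc ` ?A i \<union> ?g ` ?A (i - 1)"
    then show "I \<in> {I. I \<subseteq> {..<length (c # cs)} \<and> int (card I) = i}"
      using card card' by auto
  qed
  then have "elem_sym i (c # cs) = (\<Sum>I\<in>(`) Suc ` ?A i \<union> ?g ` ?A (i - 1). \<Prod>j\<in>I. (c # cs) ! j)"
    by (simp only: elem_sym_def)
  also have "\<dots> = (\<Sum>I\<in>(`) Suc ` ?A i. \<Prod>j\<in>I. (c # cs) ! j) + (\<Sum>I\<in>?g ` ?A (i - 1). \<Prod>j\<in>I. (c # cs) ! j)"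
    by (rule sum.union_disjoint) (use fin in auto)
  also have "(\<Sum>I\<in>(`) Suc ` ?A i. \<Prod>j\<in>I. (c # cs) ! j) = elem_sym i cs"
  proof -
    have "inj_on ((`) Suc) (?A i)" by (rule inj_on_subset[OF inj_on_image[of Suc UNIV]]) auto
    then show ?thesis by (simp add: sum.reindex prod.reindex elem_sym_def)
  qed
  also have "(\<Sum>I\<in>?g ` ?A (i - 1). \<Prod>j\<in>I. (c # cs) ! j) = c * elem_sym (i - 1) cs"
  proof -
    have "inj_on ?g (?A (i - 1))"
    proof (rule inj_onI)
      fix I J assume "?g I = ?g J"
      then have "?g I - {0} = ?g J - {0}" by simp
      then have "Suc ` I = Suc ` J" by auto
      then show "I = J" by (simp add: inj_image_eq_iff)
    qed
    moreover have "(\<Prod>j\<in>?g I. (c # cs) ! j) = c * (\<Prod>j\<in>I. cs ! j)" if "I \<in> ?A (i - 1)" for I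
    proof -
      have "finite I" using that finite_subset[of I] by auto
      then show ?thesis by (simp add: prod.reindex)
    qed
    ultimately show ?thesis by (simp add: sum.reindex elem_sym_def sum_distrib_left)
  qed
  finally show ?thesis .
qed

text \<open>With \<open>N\<close> and \<open>D\<close> for numerator and denominator, \<open>N + K D\<close> is the product of all
  \<open>c\<^sub>j + K\<close>; the recursion multiplies it by one more factor.\<close>

lemma coeff_Nil: "coeff_num K [] = 1" "coeff_denom K [] = 0"
  by (simp_all add: coeff_num_def coeff_denom_def elem_sym_Nil)

lemma coeff_Cons:
  "coeff_num K (c # cs) = c * coeff_num K cs + K\<^sup>2 * coeff_denom K cs"
  "coeff_denom K (c # cs) = coeff_num K cs + c * coeff_denom K cs"
proof -
  let ?l = "length cs"
  have last: "elem_sym (int ?l - 2 * int (Suc ?l)) cs = 0" "elem_sym (int ?l - 1 - 2 * int (Suc ?l)) cs = 0"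
    by (auto intro!: elem_sym_zero)
  have first: "elem_sym (1 + int ?l) cs = 0" by (auto intro!: elem_sym_zero)
  have num: "(\<Sum>m\<le>Suc ?l. K ^ (2 * m) * elem_sym (int ?l - 2 * int m) cs) = coeff_num K cs"
    by (simp only: sum.atMost_Suc last coeff_num_def) simp
  have denom: "(\<Sum>m\<le>Suc ?l. K ^ (2 * m) * elem_sym (int ?l - 1 - 2 * int m) cs) = coeff_denom K cs"
    by (simp only: sum.atMost_Suc last coeff_denom_def) simp
  have shift: "(\<Sum>m\<le>Suc ?l. K ^ (2 * m) * elem_sym (1 + int ?l - 2 * int m) cs) = K\<^sup>2 * coeff_denom K cs"
    unfolding sum.atMost_Suc_shift coeff_denom_def
    by (simp add: first sum_distrib_left power2_eq_square mult.assoc algebra_simps)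
  have "coeff_num K (c # cs) = (\<Sum>m\<le>Suc ?l. K ^ (2 * m) * elem_sym (1 + int ?l - 2 * int m) cs)
      + c * (\<Sum>m\<le>Suc ?l. K ^ (2 * m) * elem_sym (int ?l - 2 * int m) cs)"
    unfolding coeff_num_def sum_distrib_left sum.distrib[symmetric] length_Cons
    by (intro sum.cong[OF refl]) (simp add: elem_sym_Cons algebra_simps)
  then show "coeff_num K (c # cs) = c * coeff_num K cs + K\<^sup>2 * coeff_denom K cs"
    unfolding num shift by simp
  have "coeff_denom K (c # cs) = (\<Sum>m\<le>Suc ?l. K ^ (2 * m) * elem_sym (int ?l - 2 * int m) cs)
      + c * (\<Sum>m\<le>Suc ?l. K ^ (2 * m) * elem_sym (int ?l - 1 - 2 * int m) cs)"
    unfolding coeff_denom_def sum_distrib_left sum.distrib[symmetric] length_Cons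
    by (intro sum.cong[OF refl]) (simp add: elem_sym_Cons algebra_simps)
  then show "coeff_denom K (c # cs) = coeff_num K cs + c * coeff_denom K cs"
    unfolding num denom by simp
qed

lemma coeff_append:
  "coeff_num K (xs @ ys) = coeff_num K xs * coeff_num K ys + K\<^sup>2 * coeff_denom K xs * coeff_denom K ys"
  "coeff_denom K (xs @ ys) = coeff_num K xs * coeff_denom K ys + coeff_denom K xs * coeff_num K ys"
proof -
  have "coeff_num K (xs @ ys) = coeff_num K xs * coeff_num K ys + K\<^sup>2 * coeff_denom K xs * coeff_denom K ys \<and>
    coeff_denom K (xs @ ys) = coeff_num K xs * coeff_denom K ys + coeff_denom K xs * coeff_num K ys"
    by (induction xs) (simp_all add: coeff_Nil coeff_Cons algebra_simps)
  then show "coeff_num K (xs @ ys) = coeff_num K xs * coeff_num K ys + K\<^sup>2 * coeff_denom K xs * coeff_denom K ys"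
    "coeff_denom K (xs @ ys) = coeff_num K xs * coeff_denom K ys + coeff_denom K xs * coeff_num K ys" by auto
qed

lemma coeff_mset_cong:
  assumes "mset xs = mset ys"
  shows "coeff_num K (map f xs) = coeff_num K (map f ys)" "coeff_denom K (map f xs) = coeff_denom K (map f ys)"
proof -
  have "coeff_num K (map f xs) = coeff_num K (map f ys) \<and> coeff_denom K (map f xs) = coeff_denom K (map f ys)"
    using assms
  proof (induction xs arbitrary: ys)
    case (Cons x xs)
    then have "x \<in> set ys" by (metis list.set_intros(1) set_mset_mset)
    then obtain us vs where ys: "ys = us @ x # vs" by (meson split_list)
    have "mset xs = mset (us @ vs)" using Cons.prems by (simp add: ys)
    from Cons.IH[OF this] show ?case
      by (simp add: ys coeff_Cons coeff_append algebra_simps)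
  qed simp
  then show "coeff_num K (map f xs) = coeff_num K (map f ys)" "coeff_denom K (map f xs) = coeff_denom K (map f ys)"
    by auto
qed

lemma coeff_zero_K:
  assumes "0 \<notin> set cs"
  shows "coeff_num 0 cs \<noteq> 0" "coeff_denom 0 cs = coeff_num 0 cs * (\<Sum>c\<leftarrow>cs. 1 / c)"
proof -
  have "coeff_num 0 cs \<noteq> 0 \<and> coeff_denom 0 cs = coeff_num 0 cs * (\<Sum>c\<leftarrow>cs. 1 / c)"
    using assms by (induction cs) (auto simp: coeff_Nil coeff_Cons field_simps)
  then show "coeff_num 0 cs \<noteq> 0" "coeff_denom 0 cs = coeff_num 0 cs * (\<Sum>c\<leftarrow>cs. 1 / c)" by auto
qed

context levi_subset
begin

lemma quasiroot_sum_iff: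
  "quasiroot_sum P \<Gamma> js q \<longleftrightarrow> set js \<subseteq> simple_roots P - \<Gamma> \<and> sum_list js = q"
proof -
  have "map (bar P \<Gamma>) js = js" if "set js \<subseteq> simple_roots P - \<Gamma>"
    using that bar_simple by (intro map_idI) blast
  then show ?thesis by (auto simp: quasiroot_sum_def)
qed

text \<open>The multiplicities of the list are the coordinates of the quasiroot.\<close>

lemma quasiroot_sum_mset:
  assumes "quasiroot_sum P \<Gamma> js q" "quasiroot_sum P \<Gamma> js' q"
  shows "mset js = mset js'"
proof (rule multiset_eqI)
  fix \<gamma>
  have js: "set js \<subseteq> simple_roots P" "set js' \<subseteq> simple_roots P" "sum_list js = sum_list js'"
    using assms unfolding quasiroot_sum_iff by auto
  have "(of_nat (count_list js \<gamma>) :: complex) = of_nat (count_list js' \<gamma>)"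
    unfolding coord_sum_list(2)[OF js(1), symmetric] coord_sum_list(2)[OF js(2), symmetric] js(3) ..
  then show "count (mset js) \<gamma> = count (mset js') \<gamma>" by (simp add: count_mset)
qed

lemma bar_sum_list:
  assumes "set xs \<subseteq> simple_roots P"
  shows "bar P \<Gamma> (sum_list xs) = sum_list (filter (\<lambda>\<gamma>. \<gamma> \<notin> \<Gamma>) xs)"
  using assms
proof (induction xs)
  case Nil
  have "bar P \<Gamma> 0 = 0" by (subst bar_zero_iff) (simp_all add: fun_space.span_zero)
  then show ?case by (simp only: sum_list.Nil filter.simps)
next
  case (Cons \<gamma> xs)
  then have IH: "bar P \<Gamma> (sum_list xs) = sum_list (filter (\<lambda>\<gamma>. \<gamma> \<notin> \<Gamma>) xs)" by simp
  have "\<gamma> \<in> weight_span" "sum_list xs \<in> weight_span"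
    using Cons.prems coord_sum_list(1)[of xs] by (auto intro: fun_space.span_base)
  then have add: "bar P \<Gamma> (\<gamma> + sum_list xs) = bar P \<Gamma> \<gamma> + sum_list (filter (\<lambda>\<gamma>. \<gamma> \<notin> \<Gamma>) xs)"
    by (simp only: bar_add IH)
  show ?case
  proof (cases "\<gamma> \<in> \<Gamma>")
    case True
    then show ?thesis by (simp only: sum_list.Cons add bar_\<Gamma> filter.simps not_not not_True_eq_False if_False add_0_left)
  next
    case False
    then have "bar P \<Gamma> \<gamma> = \<gamma>" using Cons.prems by (intro bar_simple) auto
    then show ?thesis using False by (simp only: sum_list.Cons add filter.simps if_True not_False_eq_True)
  qed
qed

lemma quasiroot_sum_exists:
  assumes "\<alpha> \<in> P" shows "\<exists>js. quasiroot_sum P \<Gamma> js (bar P \<Gamma> \<alpha>)"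
proof -
  obtain xs where xs: "set xs \<subseteq> simple_roots P" "sum_list xs = \<alpha>"
    using positive_sum_simple[OF assms] by blast
  have "quasiroot_sum P \<Gamma> (filter (\<lambda>\<gamma>. \<gamma> \<notin> \<Gamma>) xs) (bar P \<Gamma> \<alpha>)"
    unfolding quasiroot_sum_iff bar_sum_list[OF xs(1), symmetric] xs(2) using xs(1) by auto
  then show ?thesis ..
qed

lemma positive_quasiroots_iff: "q \<in> positive_quasiroots P \<Gamma> \<longleftrightarrow> (\<exists>\<alpha>\<in>P - L. q = bar P \<Gamma> \<alpha>)"
  unfolding positive_quasiroots_def using P_subset by (auto simp: L_iff)

lemma positive_Delta_add:
  assumes "\<alpha> \<in> P - L" "\<beta> \<in> P" "\<alpha> + \<beta> \<in> R" shows "\<alpha> + \<beta> \<in> P - L"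
proof -
  have "bar P \<Gamma> \<alpha> + bar P \<Gamma> \<beta> \<noteq> 0"
    using bar_positive_add_zero[of \<alpha> \<beta>] assms P_subset by (auto simp: L_iff)
  then show ?thesis
    using assms P_closed P_subset by (simp add: L_iff bar_root_add)
qed

text \<open>Up to signs and cyclic permutations there is only the case of two positive roots and the
  negative of their sum.\<close>

lemma pair_sum_signed_iff:
  "(\<forall>(\<alpha>, \<beta>, \<gamma>)\<in>triples. pair_sum (signed c) \<alpha> \<beta> \<gamma> = - K\<^sup>2) \<longleftrightarrow>
    (\<forall>\<alpha>\<in>P - L. \<forall>\<beta>\<in>P - L. \<alpha> + \<beta> \<in> R \<longrightarrow>
      c (bar P \<Gamma> (\<alpha> + \<beta>)) * (c (bar P \<Gamma> \<alpha>) + c (bar P \<Gamma> \<beta>)) = c (bar P \<Gamma> \<alpha>) * c (bar P \<Gamma> \<beta>) + K\<^sup>2)"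
    (is "?triples \<longleftrightarrow> ?positive")
proof -
  have val: "pair_sum (signed c) \<alpha> \<beta> (- (\<alpha> + \<beta>)) =
      c (bar P \<Gamma> \<alpha>) * c (bar P \<Gamma> \<beta>) - c (bar P \<Gamma> (\<alpha> + \<beta>)) * (c (bar P \<Gamma> \<alpha>) + c (bar P \<Gamma> \<beta>))"
    if "\<alpha> \<in> P" "\<beta> \<in> P" "\<alpha> + \<beta> \<in> P" for \<alpha> \<beta>
    using that P_not_neg[OF that(3)] by (simp add: pair_sum_def signed_def algebra_simps del: minus_add_distrib)
  show ?thesis
  proof
    assume tri: ?triples
    show ?positive
    proof (intro ballI impI)
      fix \<alpha> \<beta> assume ab: "\<alpha> \<in> P - L" "\<beta> \<in> P - L" "\<alpha> + \<beta> \<in> R"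
      then have sum: "\<alpha> + \<beta> \<in> P - L" using positive_Delta_add by blast
      have "(\<alpha>, \<beta>, - (\<alpha> + \<beta>)) \<in> triples"
        unfolding triples_def using ab sum S_eq right_minus[of "\<alpha> + \<beta>"] by blast
      then have "pair_sum (signed c) \<alpha> \<beta> (- (\<alpha> + \<beta>)) = - K\<^sup>2" using tri by blast
      then show "c (bar P \<Gamma> (\<alpha> + \<beta>)) * (c (bar P \<Gamma> \<alpha>) + c (bar P \<Gamma> \<beta>)) = c (bar P \<Gamma> \<alpha>) * c (bar P \<Gamma> \<beta>) + K\<^sup>2"
        using val[of \<alpha> \<beta>] ab sum by (simp add: algebra_simps)
    qed
  next
    assume pos: ?positive
    have pp: "pair_sum (signed c) \<alpha> \<beta> \<gamma> = - K\<^sup>2" if "\<alpha> \<in> P" "\<beta> \<in> P" "(\<alpha>, \<beta>, \<gamma>) \<in> triples" for \<alpha> \<beta> \<gamma>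
    proof -
      have R: "\<alpha> + \<beta> \<in> R" unfolding triplesD(6)[OF that(3)] using triplesD(3)[OF that(3)] S_R S_neg by blast
      have D: "\<alpha> \<in> P - L" "\<beta> \<in> P - L" using that triplesD(1,2)[OF that(3)] by (auto simp: S_def)
      have "c (bar P \<Gamma> (\<alpha> + \<beta>)) * (c (bar P \<Gamma> \<alpha>) + c (bar P \<Gamma> \<beta>)) = c (bar P \<Gamma> \<alpha>) * c (bar P \<Gamma> \<beta>) + K\<^sup>2"
        using pos D R by blast
      then show ?thesis
        unfolding triplesD(5)[OF that(3)] val[OF that(1,2) P_closed[OF that(1,2) R]] by simp
    qed
    have cyc: "pair_sum d \<beta> \<gamma> \<alpha> = pair_sum d \<alpha> \<beta> \<gamma>" for d \<alpha> \<beta> \<gamma> by (simp add: pair_sum_def)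
    have two: "pair_sum (signed c) \<alpha> \<beta> \<gamma> = - K\<^sup>2"
      if "(\<alpha>, \<beta>, \<gamma>) \<in> triples" "\<alpha> \<in> P \<and> \<beta> \<in> P \<or> \<beta> \<in> P \<and> \<gamma> \<in> P \<or> \<gamma> \<in> P \<and> \<alpha> \<in> P" for \<alpha> \<beta> \<gamma>
      using that(2) pp[OF _ _ that(1)] pp[OF _ _ triplesD(7)[OF that(1)]]
        pp[OF _ _ triplesD(7)[OF triplesD(7)[OF that(1)]]] cyc by metis
    show ?triples
    proof (clarify)
      fix \<alpha> \<beta> \<gamma> assume t: "(\<alpha>, \<beta>, \<gamma>) \<in> triples"
      note T = triplesD(1-3)[OF t]
      note neg = triples_neg[OF t]
      have "pair_sum (signed c) (- \<alpha>) (- \<beta>) (- \<gamma>) = pair_sum (signed c) \<alpha> \<beta> \<gamma>"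
        using T[THEN S_R] by (simp add: pair_sum_def signed_neg)
      then show "pair_sum (signed c) \<alpha> \<beta> \<gamma> = - K\<^sup>2"
        using two[OF t] two[OF neg] T[THEN S_R, THEN R_cases] by metis
    qed
  qed
qed

context
  fixes K :: complex and c0 c :: "('g \<Rightarrow> complex) \<Rightarrow> complex"
  assumes denominators: "\<And>q js. q \<in> positive_quasiroots P \<Gamma> \<Longrightarrow> quasiroot_sum P \<Gamma> js q \<Longrightarrow>
      coeff_denom K (map c0 js) \<noteq> 0"
    and formula: "given_by_formula P \<Gamma> K c0 c"
begin

lemma formula_value:
  assumes "\<alpha> \<in> P - L" "quasiroot_sum P \<Gamma> js (bar P \<Gamma> \<alpha>)"
  shows "c (bar P \<Gamma> \<alpha>) = coeff_num K (map c0 js) / coeff_denom K (map c0 js)"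
    and "coeff_denom K (map c0 js) \<noteq> 0"
proof -
  have "bar P \<Gamma> \<alpha> \<in> positive_quasiroots P \<Gamma>" using assms(1) positive_quasiroots_iff by blast
  then show "c (bar P \<Gamma> \<alpha>) = coeff_num K (map c0 js) / coeff_denom K (map c0 js)"
    "coeff_denom K (map c0 js) \<noteq> 0"
    using formula assms(2) denominators unfolding given_by_formula_def by simp_all
qed

lemma formula_simple: assumes "\<gamma> \<in> simple_roots P - \<Gamma>" shows "c (bar P \<Gamma> \<gamma>) = c0 \<gamma>"
proof -
  have "bar P \<Gamma> \<gamma> \<noteq> 0" using assms bar_simple roots_nonzero simple_R by force
  then have "\<gamma> \<in> P - L" using assms simple_P by (simp add: L_iff)
  moreover have "quasiroot_sum P \<Gamma> [\<gamma>] (bar P \<Gamma> \<gamma>)"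
    using assms by (simp add: quasiroot_sum_def)
  ultimately show ?thesis using formula_value(1) by (simp add: coeff_Nil coeff_Cons)
qed

text \<open>Concatenation of the lists multiplies \<open>N + K D\<close>. For the quotients this is the addition
  theorem of the hyperbolic cotangent.\<close>

lemma formula_addition:
  assumes ab: "\<alpha> \<in> P - L" "\<beta> \<in> P - L" "\<alpha> + \<beta> \<in> R"
  shows "c (bar P \<Gamma> \<alpha>) + c (bar P \<Gamma> \<beta>) \<noteq> 0"
    and "c (bar P \<Gamma> (\<alpha> + \<beta>)) * (c (bar P \<Gamma> \<alpha>) + c (bar P \<Gamma> \<beta>)) = c (bar P \<Gamma> \<alpha>) * c (bar P \<Gamma> \<beta>) + K\<^sup>2"
proof -
  obtain xs ys where xs: "quasiroot_sum P \<Gamma> xs (bar P \<Gamma> \<alpha>)" and ys: "quasiroot_sum P \<Gamma> ys (bar P \<Gamma> \<beta>)"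
    using quasiroot_sum_exists ab by blast
  have sum: "\<alpha> + \<beta> \<in> P - L" using positive_Delta_add ab by blast
  have bar: "bar P \<Gamma> (\<alpha> + \<beta>) = bar P \<Gamma> \<alpha> + bar P \<Gamma> \<beta>" using ab P_subset by (simp add: bar_root_add)
  have "quasiroot_sum P \<Gamma> (xs @ ys) (bar P \<Gamma> (\<alpha> + \<beta>))"
    unfolding bar using xs ys by (simp add: quasiroot_sum_def)
  note val = formula_value[OF sum this, unfolded map_append coeff_append]
  note vx = formula_value[OF ab(1) xs] and vy = formula_value[OF ab(2) ys]
  let ?a = "coeff_num K (map c0 xs)" and ?b = "coeff_denom K (map c0 xs)"
  let ?d = "coeff_num K (map c0 ys)" and ?e = "coeff_denom K (map c0 ys)"
  have add: "c (bar P \<Gamma> \<alpha>) + c (bar P \<Gamma> \<beta>) = (?a * ?e + ?b * ?d) / (?b * ?e)"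
    using vx vy by (simp add: field_simps)
  then show "c (bar P \<Gamma> \<alpha>) + c (bar P \<Gamma> \<beta>) \<noteq> 0" using val(2) vx(2) vy(2) by simp
  have "c (bar P \<Gamma> (\<alpha> + \<beta>)) * (c (bar P \<Gamma> \<alpha>) + c (bar P \<Gamma> \<beta>)) = (?a * ?d + K\<^sup>2 * ?b * ?e) / (?b * ?e)"
    unfolding add val(1) using val(2) by simp
  also have "\<dots> = c (bar P \<Gamma> \<alpha>) * c (bar P \<Gamma> \<beta>) + K\<^sup>2"
    unfolding vx(1) vy(1) using vx(2) vy(2) by (simp add: field_simps)
  finally show "c (bar P \<Gamma> (\<alpha> + \<beta>)) * (c (bar P \<Gamma> \<alpha>) + c (bar P \<Gamma> \<beta>)) = c (bar P \<Gamma> \<alpha>) * c (bar P \<Gamma> \<beta>) + K\<^sup>2" .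
qed

lemma formula_pair_sum: "\<forall>(\<alpha>, \<beta>, \<gamma>)\<in>triples. pair_sum (signed c) \<alpha> \<beta> \<gamma> = - K\<^sup>2"
  unfolding pair_sum_signed_iff using formula_addition(2) by blast

lemma formula_schouten:
  "schouten_M h P E \<Gamma> (bivector h P E \<Gamma> c) (bivector h P E \<Gamma> c) = pv_scale (K\<^sup>2) (phi_M h P E \<Gamma>)"
  unfolding schouten_M_bivector_iff by (rule formula_pair_sum)

text \<open>A positive root that is not simple is a sum of two positive roots. If one of them lies in \<open>L\<close>, the
  quasiroot is that of the other one; if not, the addition formula determines the coefficient, because
  the factor on its left hand side is not 0.\<close>

lemma formula_unique_solution:
  assumes c': "\<And>\<gamma>. \<gamma> \<in> simple_roots P - \<Gamma> \<Longrightarrow> c' (bar P \<Gamma> \<gamma>) = c0 \<gamma>"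
    and "schouten_M h P E \<Gamma> (bivector h P E \<Gamma> c') (bivector h P E \<Gamma> c') = pv_scale (K\<^sup>2) (phi_M h P E \<Gamma>)"
    and q: "q \<in> positive_quasiroots P \<Gamma>"
  shows "c' q = c q"
proof -
  have rel: "c' (bar P \<Gamma> (\<alpha> + \<beta>)) * (c' (bar P \<Gamma> \<alpha>) + c' (bar P \<Gamma> \<beta>)) = c' (bar P \<Gamma> \<alpha>) * c' (bar P \<Gamma> \<beta>) + K\<^sup>2"
    if "\<alpha> \<in> P - L" "\<beta> \<in> P - L" "\<alpha> + \<beta> \<in> R" for \<alpha> \<beta>
    using assms(2) that unfolding schouten_M_bivector_iff pair_sum_signed_iff by blast
  define agree where "agree \<alpha> \<longleftrightarrow> (\<alpha> \<notin> L \<longrightarrow> c' (bar P \<Gamma> \<alpha>) = c (bar P \<Gamma> \<alpha>))" for \<alpha>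
  have "agree \<alpha>" if "\<alpha> \<in> P" for \<alpha>
    using that
  proof (induction rule: positive_root_induct)
    case (sum \<alpha>)
    show ?case
    proof (cases "\<alpha> \<in> simple_roots P")
      case True
      then show ?thesis
        using c'[of \<alpha>] formula_simple[of \<alpha>] bar_\<Gamma>[of \<alpha>] P_subset[OF sum(1)]
        by (cases "\<alpha> \<in> \<Gamma>") (auto simp: agree_def L_iff)
    next
      case False
      then obtain \<beta> \<gamma> where bg: "\<beta> \<in> P" "\<gamma> \<in> P" "\<alpha> = \<beta> + \<gamma>"
        using sum(1) by (auto simp: simple_roots_def)
      have IH: "agree \<beta>" "agree \<gamma>" using sum(2)[OF bg] by auto
      have R: "\<beta> \<in> R" "\<gamma> \<in> R" "\<beta> + \<gamma> \<in> R" using bg sum(1) P_subset by auto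
      have bar: "bar P \<Gamma> \<alpha> = bar P \<Gamma> \<beta> + bar P \<Gamma> \<gamma>" unfolding bg(3) by (rule bar_root_add[OF R(1,2)])
      show ?thesis
      proof (cases "\<beta> \<in> L \<or> \<gamma> \<in> L")
        case True
        then have "bar P \<Gamma> \<alpha> = bar P \<Gamma> \<gamma> \<or> bar P \<Gamma> \<alpha> = bar P \<Gamma> \<beta>" unfolding bar by (auto simp: L_iff)
        then show ?thesis using IH R sum(1) P_subset unfolding agree_def L_iff by metis
      next
        case no: False
        then have D: "\<beta> \<in> P - L" "\<gamma> \<in> P - L" using bg by auto
        have "c' (bar P \<Gamma> \<beta>) = c (bar P \<Gamma> \<beta>)" "c' (bar P \<Gamma> \<gamma>) = c (bar P \<Gamma> \<gamma>)"
          using IH no by (auto simp: agree_def)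
        then have "c' (bar P \<Gamma> \<alpha>) * (c (bar P \<Gamma> \<beta>) + c (bar P \<Gamma> \<gamma>)) =
            c (bar P \<Gamma> \<alpha>) * (c (bar P \<Gamma> \<beta>) + c (bar P \<Gamma> \<gamma>))"
          using rel[OF D R(3)] formula_addition(2)[OF D R(3)] unfolding bg(3) by metis
        then show ?thesis
          using formula_addition(1)[OF D R(3)] by (simp add: agree_def)
      qed
    qed
  qed
  then show ?thesis using q unfolding positive_quasiroots_iff agree_def by blast
qed

end

lemma formula_exists: "\<exists>c. given_by_formula P \<Gamma> K c0 c"
proof
  let ?js = "\<lambda>q. SOME js. quasiroot_sum P \<Gamma> js q"
  show "given_by_formula P \<Gamma> K c0 (\<lambda>q. coeff_num K (map c0 (?js q)) / coeff_denom K (map c0 (?js q)))"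
    unfolding given_by_formula_def
  proof (intro ballI allI impI)
    fix q js assume js: "quasiroot_sum P \<Gamma> js q"
    have "mset (?js q) = mset js" by (rule quasiroot_sum_mset[OF someI[of _ js] js]) (rule js)
    from coeff_mset_cong[OF this]
    show "coeff_num K (map c0 (?js q)) / coeff_denom K (map c0 (?js q)) =
        coeff_num K (map c0 js) / coeff_denom K (map c0 js)"
      by (simp only:)
  qed
qed

lemma formula_unique:
  assumes "given_by_formula P \<Gamma> K c0 c" "given_by_formula P \<Gamma> K c0 c'" "q \<in> positive_quasiroots P \<Gamma>"
  shows "c' q = c q"
proof -
  obtain js where "quasiroot_sum P \<Gamma> js q"
    using assms(3) quasiroot_sum_exists unfolding positive_quasiroots_iff by blast
  then show ?thesis using assms unfolding given_by_formula_def by metis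
qed

text \<open>For \<open>K = 0\<close> the denominator divided by the numerator is the sum of the inverses of the
  \<open>c\<^sub>j\<close>, which is additive in the quasiroot.\<close>

lemma formula_linear_form:
  assumes formula: "given_by_formula P \<Gamma> 0 c0 c"
    and nonzero: "\<And>\<gamma>. \<gamma> \<in> simple_roots P - \<Gamma> \<Longrightarrow> c0 \<gamma> \<noteq> 0"
    and denominators: "\<And>q js. q \<in> positive_quasiroots P \<Gamma> \<Longrightarrow> quasiroot_sum P \<Gamma> js q \<Longrightarrow>
      coeff_denom 0 (map c0 js) \<noteq> 0"
  shows "\<exists>lam. linear_form_on fun_scale (fun_space.span (simple_roots P - \<Gamma>)) lam \<and>
    (\<forall>q\<in>positive_quasiroots P \<Gamma>. lam q \<noteq> 0 \<and> c q = 1 / lam q)"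
proof (intro exI conjI ballI)
  define lam where "lam \<mu> = (\<Sum>\<gamma>\<in>simple_roots P. coord \<mu> \<gamma> * (1 / c0 \<gamma>))" for \<mu>
  have lam_add: "lam (\<mu> + \<nu>) = lam \<mu> + lam \<nu>" if "\<mu> \<in> weight_span" "\<nu> \<in> weight_span" for \<mu> \<nu>
    by (simp add: lam_def fun_space.representation_add[OF simple_roots_independent that(2,1)]
        distrib_right sum.distrib add_divide_distrib add.commute)
  have lam_scale: "lam (fun_scale a \<mu>) = a * lam \<mu>" if "\<mu> \<in> weight_span" for a \<mu>
    by (simp add: lam_def fun_space.representation_scale[OF simple_roots_independent that] sum_distrib_left)
  have sub: "fun_space.span (simple_roots P - \<Gamma>) \<subseteq> weight_span" by (rule fun_space.span_mono) auto
  show "linear_form_on fun_scale (fun_space.span (simple_roots P - \<Gamma>)) lam"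
    unfolding linear_form_on_def using lam_add lam_scale sub by blast
  fix q assume q: "q \<in> positive_quasiroots P \<Gamma>"
  then obtain js where js: "quasiroot_sum P \<Gamma> js q"
    using quasiroot_sum_exists unfolding positive_quasiroots_iff by blast
  have lam_simple: "lam \<gamma> = 1 / c0 \<gamma>" if "\<gamma> \<in> simple_roots P" for \<gamma>
  proof -
    have "lam \<gamma> = (\<Sum>\<beta>\<in>simple_roots P. if \<beta> = \<gamma> then 1 / c0 \<gamma> else 0)"
      unfolding lam_def
      by (rule sum.cong) (use fun_space.representation_basis[OF simple_roots_independent that] in auto)
    then show ?thesis using finite_simple that by simp
  qed
  have lam_list: "lam (sum_list xs) = (\<Sum>\<gamma>\<leftarrow>xs. 1 / c0 \<gamma>)" if "set xs \<subseteq> simple_roots P" for xs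
    using that
  proof (induction xs)
    case Nil
    have "lam 0 = 0" by (simp add: lam_def fun_space.representation_zero)
    then show ?case by (simp only: sum_list.Nil list.map)
  next
    case (Cons \<gamma> xs)
    then have IH: "lam (sum_list xs) = (\<Sum>\<gamma>\<leftarrow>xs. 1 / c0 \<gamma>)" by simp
    have "\<gamma> \<in> weight_span" "sum_list xs \<in> weight_span" "\<gamma> \<in> simple_roots P"
      using Cons.prems coord_sum_list(1)[of xs] by (auto intro: fun_space.span_base)
    then show ?case by (simp only: sum_list.Cons list.map lam_add lam_simple IH)
  qed
  have "lam q = (\<Sum>\<gamma>\<leftarrow>js. 1 / c0 \<gamma>)"
    using js lam_list[of js] unfolding quasiroot_sum_iff by blast
  moreover have "0 \<notin> set (map c0 js)" using js nonzero unfolding quasiroot_sum_iff by force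
  note coeff_zero_K[OF this]
  moreover have "coeff_denom 0 (map c0 js) \<noteq> 0" by (rule denominators[OF q js])
  moreover have "c q = coeff_num 0 (map c0 js) / coeff_denom 0 (map c0 js)"
    using formula q js unfolding given_by_formula_def by blast
  ultimately show "lam q \<noteq> 0" "c q = 1 / lam q" by (auto simp: o_def)
qed

end

section \<open>The Poisson bracket of functions\<close>

context levi_subset
begin

context
  fixes \<iota> :: "complex \<Rightarrow> 'a::comm_ring_1" and \<rho> :: "'g \<Rightarrow> 'a \<Rightarrow> 'a"
  assumes act: "acts_by_derivations \<iota> \<rho>"
begin

lemma \<iota>_add: "\<iota> (a + b) = \<iota> a + \<iota> b" and \<iota>_mult: "\<iota> (a * b) = \<iota> a * \<iota> b"
  and \<rho>_add_vector: "\<rho> (x + y) f = \<rho> x f + \<rho> y f" and \<rho>_scale: "\<rho> (scaleC a x) f = \<iota> a * \<rho> x f"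
  and \<rho>_bracket: "\<rho> (lie_bracket x y) f = \<rho> x (\<rho> y f) - \<rho> y (\<rho> x f)"
  and \<rho>_add: "\<rho> x (f + g) = \<rho> x f + \<rho> x g" and \<rho>_const: "\<rho> x (\<iota> a) = 0"
  and \<rho>_mult: "\<rho> x (f * g) = \<rho> x f * g + f * \<rho> x g"
  using act unfolding acts_by_derivations_def by simp_all

lemma \<iota>_0: "\<iota> 0 = 0" using \<iota>_add[of 0 0] by simp

lemma \<iota>_neg: "\<iota> (- a) = - \<iota> a"
  using \<iota>_add[of "- a" a] by (simp add: \<iota>_0 eq_neg_iff_add_eq_0)

lemma \<rho>_0: "\<rho> x 0 = 0" using \<rho>_add[of x 0 0] by simp

lemma \<rho>_0_vector: "\<rho> 0 f = 0" using \<rho>_add_vector[of 0 0 f] by simp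

lemma \<rho>_sum: "\<rho> x (\<Sum>i\<in>I. f i) = (\<Sum>i\<in>I. \<rho> x (f i))"
  by (induction I rule: infinite_finite_induct) (simp_all add: \<rho>_0 \<rho>_add)

lemma function_bracket_signed:
  "function_bracket \<iota> \<rho> h P E \<Gamma> c f g =
    (\<Sum>\<alpha>\<in>S. \<iota> (signed c \<alpha>) * (\<rho> (E \<alpha>) f * \<rho> (E (- \<alpha>)) g))"
  unfolding function_bracket_def S_eq sum_symmetric[OF Delta]
  by (rule sum.cong[OF refl]) (use P_subset signed_neg in \<open>auto simp: signed_def \<iota>_neg algebra_simps\<close>)

abbreviation invariants :: "'a set" where
  "invariants \<equiv> invariant_functions \<rho> (levi_subalgebra h E \<Gamma>)"

lemma invariantsD: "f \<in> invariants \<Longrightarrow> x \<in> h \<Longrightarrow> \<rho> x f = 0"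
  "f \<in> invariants \<Longrightarrow> \<alpha> \<in> L \<Longrightarrow> \<rho> (E \<alpha>) f = 0"
  unfolding invariant_functions_def levi_subalgebra_eq by (auto intro: lie.span_base)

lemma invariantsI:
  assumes "\<And>x. x \<in> h \<Longrightarrow> \<rho> x f = 0" "\<And>\<alpha>. \<alpha> \<in> L \<Longrightarrow> \<rho> (E \<alpha>) f = 0"
  shows "f \<in> invariants"
proof -
  have "\<rho> x f = 0" if "x \<in> lie.span (h \<union> E ` L)" for x
    using that
  proof (induction rule: lie.span_induct)
    case base
    show ?case by (simp add: lie.subspace_def \<rho>_0_vector \<rho>_add_vector \<rho>_scale)
  qed (use assms in auto)
  then show ?thesis by (simp add: invariant_functions_def levi_subalgebra_eq)
qed

lemma \<rho>_commute_bracket: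
  assumes "\<rho> x f = 0" shows "\<rho> x (\<rho> y f) = \<rho> (lie_bracket x y) f"
  by (simp add: \<rho>_bracket assms \<rho>_0)

text \<open>An element \<open>E \<gamma>\<close> of the Levi subalgebra acts on each factor. The term of \<open>\<alpha>\<close> in which it acts on the
  factor of \<open>f\<close> cancels against the term of \<open>\<gamma> + \<alpha>\<close> in which it acts on the factor of \<open>g\<close>.\<close>

lemma function_bracket_invariant:
  assumes f: "f \<in> invariants" and g: "g \<in> invariants"
  shows "function_bracket \<iota> \<rho> h P E \<Gamma> c f g \<in> invariants"
proof (rule invariantsI)
  have expand: "\<rho> x (function_bracket \<iota> \<rho> h P E \<Gamma> c f g) =
      (\<Sum>\<alpha>\<in>S. \<iota> (signed c \<alpha>) * (\<rho> (lie_bracket x (E \<alpha>)) f * \<rho> (E (- \<alpha>)) g)) +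
      (\<Sum>\<alpha>\<in>S. \<iota> (signed c \<alpha>) * (\<rho> (E \<alpha>) f * \<rho> (lie_bracket x (E (- \<alpha>))) g))"
    if "\<rho> x f = 0" "\<rho> x g = 0" for x
    unfolding function_bracket_signed \<rho>_sum sum.distrib[symmetric]
    by (rule sum.cong[OF refl])
      (simp add: \<rho>_mult \<rho>_const \<rho>_commute_bracket[OF that(1)] \<rho>_commute_bracket[OF that(2)] distrib_left)
  show "\<rho> x (function_bracket \<iota> \<rho> h P E \<Gamma> c f g) = 0" if x: "x \<in> h" for x
  proof -
    have br: "lie_bracket x (E \<alpha>) = scaleC (\<alpha> x) (E \<alpha>)" if "\<alpha> \<in> S" for \<alpha>
      using root_spaceD[OF root_vectors x] S_R that by blast
    have "\<rho> x (function_bracket \<iota> \<rho> h P E \<Gamma> c f g) =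
        (\<Sum>\<alpha>\<in>S. \<iota> (signed c \<alpha>) * (\<rho> (lie_bracket x (E \<alpha>)) f * \<rho> (E (- \<alpha>)) g) +
          \<iota> (signed c \<alpha>) * (\<rho> (E \<alpha>) f * \<rho> (lie_bracket x (E (- \<alpha>))) g))"
      using expand[OF invariantsD(1)[OF f x] invariantsD(1)[OF g x]] by (simp only: sum.distrib)
    also have "\<dots> = 0"
      using S_neg by (intro sum.neutral ballI) (simp add: br \<rho>_scale \<iota>_neg del: lie.scale_minus_left)
    finally show ?thesis .
  qed
  show "\<rho> (E \<gamma>) (function_bracket \<iota> \<rho> h P E \<Gamma> c f g) = 0" if \<gamma>: "\<gamma> \<in> L" for \<gamma>
  proof -
    let ?t1 = "\<lambda>\<alpha>. \<iota> (signed c \<alpha>) * (\<rho> (lie_bracket (E \<gamma>) (E \<alpha>)) f * \<rho> (E (- \<alpha>)) g)"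
    let ?t2 = "\<lambda>\<alpha>. \<iota> (signed c \<alpha>) * (\<rho> (E \<alpha>) f * \<rho> (lie_bracket (E \<gamma>) (E (- \<alpha>))) g)"
    have \<gamma>R: "\<gamma> \<in> R" by (rule L_R[OF \<gamma>])
    have zero: "lie_bracket (E \<gamma>) (E \<alpha>) = 0" if "\<alpha> \<in> S" "\<gamma> + \<alpha> \<notin> R" for \<alpha>
    proof -
      have "\<gamma> + \<alpha> \<noteq> 0" using that L_neg[OF \<gamma>] by (auto simp: add_eq_0_iff S_def)
      then show ?thesis using bracket_E_0[OF \<gamma>R S_R[OF that(1)] that(2)] by blast
    qed
    have shift_neg: "\<gamma> + - \<alpha> \<in> R \<longleftrightarrow> \<alpha> - \<gamma> \<in> R" for \<alpha>
      using R_neg[of "\<gamma> + - \<alpha>"] R_neg[of "\<alpha> - \<gamma>"] by auto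
    have "(\<Sum>\<alpha>\<in>S. ?t1 \<alpha>) = (\<Sum>\<alpha>\<in>{\<alpha> \<in> S. \<gamma> + \<alpha> \<in> R}. ?t1 \<alpha>)"
      by (rule sum.mono_neutral_right) (auto simp: finite_S zero \<rho>_0_vector)
    moreover have "(\<Sum>\<alpha>\<in>S. ?t2 \<alpha>) = (\<Sum>\<alpha>\<in>{\<alpha> \<in> S. \<alpha> - \<gamma> \<in> R}. ?t2 \<alpha>)"
    proof (rule sum.mono_neutral_right[OF finite_S], blast, intro ballI)
      fix \<alpha> assume \<alpha>: "\<alpha> \<in> S - {\<alpha> \<in> S. \<alpha> - \<gamma> \<in> R}"
      then have "\<gamma> + - \<alpha> \<notin> R" using shift_neg by blast
      then have "lie_bracket (E \<gamma>) (E (- \<alpha>)) = 0" using zero[OF S_neg] \<alpha> by blast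
      then show "?t2 \<alpha> = 0" by (simp only: \<rho>_0_vector mult_zero_right)
    qed
    moreover have "(\<Sum>\<alpha>\<in>{\<alpha> \<in> S. \<gamma> + \<alpha> \<in> R}. - ?t1 \<alpha>) = (\<Sum>\<alpha>\<in>{\<alpha> \<in> S. \<alpha> - \<gamma> \<in> R}. ?t2 \<alpha>)"
    proof (rule sum.reindex_bij_witness[where i = "\<lambda>\<alpha>. \<alpha> - \<gamma>" and j = "\<lambda>\<alpha>. \<gamma> + \<alpha>"])
      fix \<alpha> assume "\<alpha> \<in> {\<alpha> \<in> S. \<gamma> + \<alpha> \<in> R}"
      then have \<alpha>: "\<alpha> \<in> S" "\<alpha> \<in> R" "\<gamma> + \<alpha> \<in> R" using S_R by auto
      note shift = signed_levi_shift[OF \<gamma> \<alpha>(1,3)]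
      show "\<gamma> + \<alpha> - \<gamma> = \<alpha>" by simp
      then show "\<gamma> + \<alpha> \<in> {\<alpha> \<in> S. \<alpha> - \<gamma> \<in> R}" using \<alpha>(2) shift(1) by simp
      have sum: "\<gamma> + - (\<gamma> + \<alpha>) = - \<alpha>" by simp
      have "lie_bracket (E \<gamma>) (E (- (\<gamma> + \<alpha>))) = scaleC (- struct_const \<gamma> \<alpha>) (E (- \<alpha>))"
        using bracket_E[OF \<gamma>R R_neg[OF \<alpha>(3)]] R_neg[OF \<alpha>(2)] unfolding sum struct_const_shift by blast
      then show "?t2 (\<gamma> + \<alpha>) = - ?t1 \<alpha>"
        by (simp only: shift(2) bracket_E[OF \<gamma>R \<alpha>(2,3)] \<rho>_scale \<iota>_neg) (simp add: algebra_simps)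
    next
      fix \<alpha> assume "\<alpha> \<in> {\<alpha> \<in> S. \<alpha> - \<gamma> \<in> R}"
      then have \<alpha>: "\<alpha> \<in> S" "- \<gamma> + \<alpha> \<in> R" using S_R by auto
      show "\<gamma> + (\<alpha> - \<gamma>) = \<alpha>" by simp
      then show "\<alpha> - \<gamma> \<in> {\<alpha> \<in> S. \<gamma> + \<alpha> \<in> R}"
        using signed_levi_shift(1)[OF L_neg[OF \<gamma>] \<alpha>] S_R[OF \<alpha>(1)] by simp
    qed
    ultimately have "(\<Sum>\<alpha>\<in>S. ?t2 \<alpha>) = - (\<Sum>\<alpha>\<in>S. ?t1 \<alpha>)"
      by (simp only: sum_negf)
    then show ?thesis
      unfolding expand[OF invariantsD(2)[OF f \<gamma>] invariantsD(2)[OF g \<gamma>]] by (simp only: right_minus)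
  qed
qed

text \<open>In the double bracket the terms with second derivatives of \<open>k\<close> come in commutators
  \<open>[E (- \<alpha>), E (- \<beta>)]\<close>. On invariant functions such a commutator acts through its projection
  to the complement of the Levi subalgebra, so only triples of roots remain, and they carry the same
  quadratic expressions as the Schouten bracket.\<close>

lemma function_bracket_jacobi:
  assumes fgk: "f \<in> invariants" "g \<in> invariants" "k \<in> invariants"
    and zero: "\<forall>(\<alpha>, \<beta>, \<gamma>)\<in>triples. pair_sum (signed c) \<alpha> \<beta> \<gamma> = 0"
  shows "function_bracket \<iota> \<rho> h P E \<Gamma> c f (function_bracket \<iota> \<rho> h P E \<Gamma> c g k) +
    function_bracket \<iota> \<rho> h P E \<Gamma> c g (function_bracket \<iota> \<rho> h P E \<Gamma> c k f) +
    function_bracket \<iota> \<rho> h P E \<Gamma> c k (function_bracket \<iota> \<rho> h P E \<Gamma> c f g) = 0"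
proof -
  let ?br = "function_bracket \<iota> \<rho> h P E \<Gamma> c" and ?c = "signed c"
  define F where "F \<alpha> = \<rho> (E \<alpha>)" for \<alpha>
  define X where "X f g k = (\<Sum>\<alpha>\<in>S. \<Sum>\<beta>\<in>S. \<iota> (?c \<alpha> * ?c \<beta>) * (F \<alpha> f * F \<beta> g * F (- \<alpha>) (F (- \<beta>) k)))" for f g k
  define Y where "Y f g k = (\<Sum>\<alpha>\<in>S. \<Sum>\<beta>\<in>S. \<iota> (?c \<alpha> * ?c \<beta>) * (F \<alpha> f * F (- \<alpha>) (F \<beta> g) * F (- \<beta>) k))" for f g k
  \<comment> \<open>The substitution of \<open>- \<beta>\<close> for \<open>\<beta>\<close> turns the second derivatives of \<open>g\<close> into the form of \<open>X\<close>.\<close>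
  have Y: "Y f g k = - X f k g" for f g k
  proof -
    have "(\<Sum>\<beta>\<in>S. \<iota> (?c \<alpha> * ?c \<beta>) * (F \<alpha> f * F (- \<alpha>) (F \<beta> g) * F (- \<beta>) k)) =
        (\<Sum>\<beta>\<in>S. - (\<iota> (?c \<alpha> * ?c \<beta>) * (F \<alpha> f * F \<beta> k * F (- \<alpha>) (F (- \<beta>) g))))" for \<alpha>
      by (rule sum.reindex_bij_witness[where i = uminus and j = uminus])
        (use S_neg S_R signed_neg in \<open>auto simp: \<iota>_neg mult_ac\<close>)
    then show ?thesis unfolding X_def Y_def by (simp only: sum_negf)
  qed
  have double: "?br f (?br g k) = X f g k - X f k g" for f g k
  proof -
    have "?br f (?br g k) = (\<Sum>\<alpha>\<in>S. \<Sum>\<beta>\<in>S. \<iota> (?c \<alpha>) * (F \<alpha> f * F (- \<alpha>) (\<iota> (?c \<beta>) * (F \<beta> g * F (- \<beta>) k))))"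
      by (simp only: function_bracket_signed F_def \<rho>_sum sum_distrib_left)
    also have "\<dots> = X f g k + Y f g k"
      unfolding X_def Y_def sum.distrib[symmetric]
      by (intro sum.cong[OF refl]) (simp add: F_def \<rho>_mult \<rho>_const \<iota>_mult algebra_simps)
    finally show ?thesis by (simp add: Y)
  qed
  define Z where "Z f g k = (\<Sum>(\<alpha>, \<beta>, \<gamma>)\<in>triples.
      \<iota> (?c \<alpha> * ?c \<beta> * triple_const (- \<alpha>) (- \<beta>) (- \<gamma>)) * (F \<alpha> f * F \<beta> g * F \<gamma> k))" for f g k
  have commutator: "X f g k - X g f k = Z f g k" if k: "k \<in> invariants" for f g k
  proof -
    have pr: "\<rho> (lie_bracket (E (- \<alpha>)) (E (- \<beta>))) k =
        (if \<alpha> + \<beta> \<in> S then \<iota> (triple_const (- \<alpha>) (- \<beta>) (- (- (\<alpha> + \<beta>)))) * F (- (\<alpha> + \<beta>)) k else 0)"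
      if ab: "\<alpha> \<in> S" "\<beta> \<in> S" for \<alpha> \<beta>
    proof -
      have R: "- \<alpha> \<in> R" "- \<beta> \<in> R" using ab S_R S_neg by auto
      have sum: "- \<alpha> + - \<beta> = - (\<alpha> + \<beta>)" by simp
      consider "\<alpha> + \<beta> \<in> S" | "\<alpha> + \<beta> \<in> L" | "\<alpha> + \<beta> = 0" | "\<alpha> + \<beta> \<notin> R" "\<alpha> + \<beta> \<noteq> 0"
        unfolding S_def by blast
      then show ?thesis
      proof cases
        case 1
        have "- \<alpha> + - \<beta> \<in> R" unfolding sum using 1 S_R S_neg by blast
        from bracket_E[OF R this] show ?thesis
          using 1 by (simp only: sum struct_const_triple \<rho>_scale F_def if_True)
      next
        case 2
        have r: "- \<alpha> + - \<beta> \<in> R" unfolding sum using 2 L_R L_neg by blast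
        have "\<rho> (E (- \<alpha> + - \<beta>)) k = 0"
          unfolding sum by (rule invariantsD(2)[OF k L_neg[OF 2]])
        moreover have "\<alpha> + \<beta> \<notin> S" using 2 by (simp add: S_def)
        ultimately show ?thesis
          by (simp only: bracket_E[OF R r] \<rho>_scale mult_zero_right if_False)
      next
        case 3
        then have "\<beta> = - \<alpha>" by (simp add: add_eq_0_iff)
        then have "lie_bracket (E (- \<alpha>)) (E (- \<beta>)) = T (- \<alpha>)" by (simp only: T_def)
        moreover have "\<rho> (T (- \<alpha>)) k = 0" by (rule invariantsD(1)[OF k T_in_h[OF R(1)]])
        moreover have "\<alpha> + \<beta> \<notin> S" using 3 S_R roots_nonzero by blast
        ultimately show ?thesis by (simp only: if_False)
      next
        case 4
        then have "- \<alpha> + - \<beta> \<notin> R" "- \<alpha> + - \<beta> \<noteq> 0"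
          unfolding sum using R_neg[of "- (\<alpha> + \<beta>)"] by (metis minus_minus, metis neg_equal_0_iff_equal)
        moreover have "\<alpha> + \<beta> \<notin> S" using 4 S_R by blast
        ultimately show ?thesis by (simp only: bracket_E_0[OF R] \<rho>_0_vector if_False simp_thms)
      qed
    qed
    have "X g f k = (\<Sum>\<alpha>\<in>S. \<Sum>\<beta>\<in>S. \<iota> (?c \<alpha> * ?c \<beta>) * (F \<alpha> f * F \<beta> g * F (- \<beta>) (F (- \<alpha>) k)))"
      unfolding X_def by (subst sum.swap) (simp only: mult_ac)
    then have "X f g k - X g f k =
        (\<Sum>\<alpha>\<in>S. \<Sum>\<beta>\<in>S. \<iota> (?c \<alpha> * ?c \<beta>) * (F \<alpha> f * F \<beta> g * \<rho> (lie_bracket (E (- \<alpha>)) (E (- \<beta>))) k))"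
      by (simp only: X_def sum_subtractf[symmetric] right_diff_distrib[symmetric] F_def \<rho>_bracket)
    also have "\<dots> = (\<Sum>\<alpha>\<in>S. \<Sum>\<beta>\<in>S. if \<alpha> + \<beta> \<in> S then
        \<iota> (?c \<alpha> * ?c \<beta> * triple_const (- \<alpha>) (- \<beta>) (- (- (\<alpha> + \<beta>)))) * (F \<alpha> f * F \<beta> g * F (- (\<alpha> + \<beta>)) k) else 0)"
      by (intro sum.cong[OF refl]) (simp add: pr \<iota>_mult mult_ac del: minus_add_distrib minus_minus)
    also have "\<dots> = Z f g k"
      unfolding Z_def
      by (rule sum_triples[of "\<lambda>\<alpha> \<beta> \<gamma>. \<iota> (?c \<alpha> * ?c \<beta> * triple_const (- \<alpha>) (- \<beta>) (- \<gamma>)) * (F \<alpha> f * F \<beta> g * F \<gamma> k)"])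
    finally show ?thesis .
  qed
  have "?br f (?br g k) + ?br g (?br k f) + ?br k (?br f g) = Z f g k + Z g k f + Z k f g"
    unfolding double commutator[OF fgk(3), symmetric] commutator[OF fgk(1), symmetric]
      commutator[OF fgk(2), symmetric] by simp
  also have "Z g k f = (\<Sum>(\<alpha>, \<beta>, \<gamma>)\<in>triples.
      \<iota> (?c \<beta> * ?c \<gamma> * triple_const (- \<beta>) (- \<gamma>) (- \<alpha>)) * (F \<beta> g * F \<gamma> k * F \<alpha> f))"
    unfolding Z_def by (rule sum_triples_cyclic)
  also have "Z k f g = (\<Sum>(\<alpha>, \<beta>, \<gamma>)\<in>triples.
      \<iota> (?c \<gamma> * ?c \<alpha> * triple_const (- \<gamma>) (- \<alpha>) (- \<beta>)) * (F \<gamma> k * F \<alpha> f * F \<beta> g))"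
    unfolding Z_def by (subst sum_triples_cyclic, rule sum_triples_cyclic)
  also have "Z f g k + (\<Sum>(\<alpha>, \<beta>, \<gamma>)\<in>triples.
      \<iota> (?c \<beta> * ?c \<gamma> * triple_const (- \<beta>) (- \<gamma>) (- \<alpha>)) * (F \<beta> g * F \<gamma> k * F \<alpha> f)) +
      (\<Sum>(\<alpha>, \<beta>, \<gamma>)\<in>triples.
      \<iota> (?c \<gamma> * ?c \<alpha> * triple_const (- \<gamma>) (- \<alpha>) (- \<beta>)) * (F \<gamma> k * F \<alpha> f * F \<beta> g)) =
      (\<Sum>(\<alpha>, \<beta>, \<gamma>)\<in>triples.
      \<iota> (pair_sum ?c \<alpha> \<beta> \<gamma> * triple_const (- \<alpha>) (- \<beta>) (- \<gamma>)) * (F \<alpha> f * F \<beta> g * F \<gamma> k))"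
    unfolding Z_def sum.distrib[symmetric]
  proof (rule sum.cong[OF refl], clarify)
    fix \<alpha> \<beta> \<gamma>
    have "triple_const (- \<beta>) (- \<gamma>) (- \<alpha>) = triple_const (- \<alpha>) (- \<beta>) (- \<gamma>)"
      "triple_const (- \<gamma>) (- \<alpha>) (- \<beta>) = triple_const (- \<alpha>) (- \<beta>) (- \<gamma>)"
      using triple_const_cyclic[of "- \<beta>" "- \<gamma>" "- \<alpha>"] triple_const_cyclic[of "- \<gamma>" "- \<alpha>" "- \<beta>"] by simp_all
    then show "\<iota> (?c \<alpha> * ?c \<beta> * triple_const (- \<alpha>) (- \<beta>) (- \<gamma>)) * (F \<alpha> f * F \<beta> g * F \<gamma> k) +
        \<iota> (?c \<beta> * ?c \<gamma> * triple_const (- \<beta>) (- \<gamma>) (- \<alpha>)) * (F \<beta> g * F \<gamma> k * F \<alpha> f) +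
        \<iota> (?c \<gamma> * ?c \<alpha> * triple_const (- \<gamma>) (- \<alpha>) (- \<beta>)) * (F \<gamma> k * F \<alpha> f * F \<beta> g) =
        \<iota> (pair_sum ?c \<alpha> \<beta> \<gamma> * triple_const (- \<alpha>) (- \<beta>) (- \<gamma>)) * (F \<alpha> f * F \<beta> g * F \<gamma> k)"
      by (simp only: pair_sum_def \<iota>_mult \<iota>_add) (simp add: algebra_simps)
  qed
  also have "\<dots> = 0"
    by (rule sum.neutral) (use zero in \<open>auto simp: \<iota>_0\<close>)
  finally show ?thesis .
qed

lemma function_bracket_poisson:
  assumes zero: "\<forall>(\<alpha>, \<beta>, \<gamma>)\<in>triples. pair_sum (signed c) \<alpha> \<beta> \<gamma> = 0"
  shows "poisson_bracket_on \<iota> invariants (function_bracket \<iota> \<rho> h P E \<Gamma> c)"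
  unfolding poisson_bracket_on_def
proof (intro conjI ballI allI)
  fix f g k a assume f: "f \<in> invariants" and g: "g \<in> invariants"
  let ?br = "function_bracket \<iota> \<rho> h P E \<Gamma> c"
  show "?br f g \<in> invariants" by (rule function_bracket_invariant[OF f g])
  show "?br g f = - ?br f g"
    unfolding function_bracket_def sum_negf[symmetric]
    by (intro sum.cong[OF refl]) (simp add: algebra_simps)
  show "?br f (\<iota> a * g) = \<iota> a * ?br f g"
    by (simp add: function_bracket_signed \<rho>_mult \<rho>_const sum_distrib_left mult_ac)
  show "?br f (g + k) = ?br f g + ?br f k"
    by (simp add: function_bracket_signed \<rho>_add distrib_left sum.distrib)
  show "?br f (g * k) = ?br f g * k + g * ?br f k"
    by (simp add: function_bracket_signed \<rho>_mult sum_distrib_left sum_distrib_right sum.distrib[symmetric] algebra_simps)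
  show "?br f (?br g k) + ?br g (?br k f) + ?br k (?br f g) = 0" if "k \<in> invariants"
    by (rule function_bracket_jacobi[OF f g that zero])
qed

end

end

section \<open>Existence and uniqueness of the solution, and the Poisson case\<close>

theorem proposition3p4:
  fixes h :: "'g::complex_lie_algebra set"
    and P \<Gamma> :: "('g \<Rightarrow> complex) set"
    and E :: "('g \<Rightarrow> complex) \<Rightarrow> 'g"
    and K :: complex
    and c0 :: "('g \<Rightarrow> complex) \<Rightarrow> complex"
  assumes simple: "simple_lie_algebra TYPE('g)"
    and cartan: "cartan_subalgebra h"
    and positive: "positive_system (roots h) P"
    and \<Gamma>: "\<Gamma> \<subseteq> simple_roots P"
    and root_vectors: "\<And>\<alpha>. \<alpha> \<in> roots h \<Longrightarrow> E \<alpha> \<in> root_space h \<alpha>"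
    and normalized: "\<And>\<alpha>. \<alpha> \<in> P \<Longrightarrow> killing (E \<alpha>) (E (- \<alpha>)) = 1"
    and nonzero: "\<And>\<gamma>. \<gamma> \<in> simple_roots P - \<Gamma> \<Longrightarrow> c0 \<gamma> \<noteq> 0"
    and denominators: "\<And>q js. q \<in> positive_quasiroots P \<Gamma> \<Longrightarrow> quasiroot_sum P \<Gamma> js q \<Longrightarrow>
           coeff_denom K (map c0 js) \<noteq> 0"
  shows "\<exists>c :: ('g \<Rightarrow> complex) \<Rightarrow> complex.
     given_by_formula P \<Gamma> K c0 c \<and>
     (\<forall>c'. given_by_formula P \<Gamma> K c0 c' \<longrightarrow> (\<forall>q\<in>positive_quasiroots P \<Gamma>. c' q = c q)) \<and>
     (\<forall>\<gamma>\<in>simple_roots P - \<Gamma>. c (bar P \<Gamma> \<gamma>) = c0 \<gamma>) \<and>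
     bivector h P E \<Gamma> c \<in> invariant_polyvector_fields 2 h P E \<Gamma> \<and>
     schouten_M h P E \<Gamma> (bivector h P E \<Gamma> c) (bivector h P E \<Gamma> c) = pv_scale (K\<^sup>2) (phi_M h P E \<Gamma>) \<and>
     (\<forall>c'. (\<forall>\<gamma>\<in>simple_roots P - \<Gamma>. c' (bar P \<Gamma> \<gamma>) = c0 \<gamma>) \<and>
           schouten_M h P E \<Gamma> (bivector h P E \<Gamma> c') (bivector h P E \<Gamma> c') = pv_scale (K\<^sup>2) (phi_M h P E \<Gamma>)
           \<longrightarrow> (\<forall>q\<in>positive_quasiroots P \<Gamma>. c' q = c q)) \<and>
     (K = 0 \<longrightarrow>
        poisson_bivector_field h P E \<Gamma> (bivector h P E \<Gamma> c) \<and>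
        (\<forall>(\<iota> :: complex \<Rightarrow> 'a::comm_ring_1) \<rho>. acts_by_derivations \<iota> \<rho> \<longrightarrow>
           poisson_bracket_on \<iota> (invariant_functions \<rho> (levi_subalgebra h E \<Gamma>))
             (function_bracket \<iota> \<rho> h P E \<Gamma> c)) \<and>
        (\<exists>lam. linear_form_on fun_scale (fun_space.span (simple_roots P - \<Gamma>)) lam \<and>
           (\<forall>q\<in>positive_quasiroots P \<Gamma>. lam q \<noteq> 0 \<and> c q = 1 / lam q)))"
proof -
  interpret levi_subset h P E \<Gamma>
    by unfold_locales (fact simple cartan positive root_vectors normalized \<Gamma>)+
  obtain c where c: "given_by_formula P \<Gamma> K c0 c" using formula_exists by blast
  note schouten = formula_schouten[OF denominators c]
  have poisson: "poisson_bivector_field h P E \<Gamma> (bivector h P E \<Gamma> c) \<and>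
      (\<forall>(\<iota> :: complex \<Rightarrow> 'a::comm_ring_1) \<rho>. acts_by_derivations \<iota> \<rho> \<longrightarrow>
         poisson_bracket_on \<iota> (invariant_functions \<rho> (levi_subalgebra h E \<Gamma>))
           (function_bracket \<iota> \<rho> h P E \<Gamma> c)) \<and>
      (\<exists>lam. linear_form_on fun_scale (fun_space.span (simple_roots P - \<Gamma>)) lam \<and>
         (\<forall>q\<in>positive_quasiroots P \<Gamma>. lam q \<noteq> 0 \<and> c q = 1 / lam q))" if K: "K = 0"
  proof (intro conjI allI impI)
    show "poisson_bivector_field h P E \<Gamma> (bivector h P E \<Gamma> c)"
      unfolding poisson_bivector_field_def using bivector_invariant_field schouten K by simp
    have "\<forall>(\<alpha>, \<beta>, \<gamma>)\<in>triples. pair_sum (signed c) \<alpha> \<beta> \<gamma> = 0"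
      using formula_pair_sum[OF denominators c] K by simp
    then show "poisson_bracket_on \<iota> (invariant_functions \<rho> (levi_subalgebra h E \<Gamma>))
        (function_bracket \<iota> \<rho> h P E \<Gamma> c)" if "acts_by_derivations \<iota> \<rho>" for \<iota> :: "complex \<Rightarrow> 'a" and \<rho>
      by (rule function_bracket_poisson[OF that])
    show "\<exists>lam. linear_form_on fun_scale (fun_space.span (simple_roots P - \<Gamma>)) lam \<and>
        (\<forall>q\<in>positive_quasiroots P \<Gamma>. lam q \<noteq> 0 \<and> c q = 1 / lam q)"
      by (rule formula_linear_form) (use c nonzero denominators K in auto)
  qed
  show ?thesis
  proof (rule exI[of _ c], intro conjI allI impI ballI)
    show "given_by_formula P \<Gamma> K c0 c" by (rule c)
    show "c' q = c q" if "given_by_formula P \<Gamma> K c0 c'" "q \<in> positive_quasiroots P \<Gamma>" for c' q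
      by (rule formula_unique[OF c that])
    show "c (bar P \<Gamma> \<gamma>) = c0 \<gamma>" if "\<gamma> \<in> simple_roots P - \<Gamma>" for \<gamma>
      by (rule formula_simple[OF denominators c that])
    show "bivector h P E \<Gamma> c \<in> invariant_polyvector_fields 2 h P E \<Gamma>" by (rule bivector_invariant_field)
    show "schouten_M h P E \<Gamma> (bivector h P E \<Gamma> c) (bivector h P E \<Gamma> c) = pv_scale (K\<^sup>2) (phi_M h P E \<Gamma>)"
      by (rule schouten)
    show "c' q = c q" if "(\<forall>\<gamma>\<in>simple_roots P - \<Gamma>. c' (bar P \<Gamma> \<gamma>) = c0 \<gamma>) \<and>
        schouten_M h P E \<Gamma> (bivector h P E \<Gamma> c') (bivector h P E \<Gamma> c') = pv_scale (K\<^sup>2) (phi_M h P E \<Gamma>)"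
      "q \<in> positive_quasiroots P \<Gamma>" for c' q
      by (rule formula_unique_solution[OF denominators c]) (use that in auto)
  qed (use poisson in blast)+
qed

end
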